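(* If $t\geq s>1$ and $u\in(\Sigma_t^s)'(\mathbf R^d)$ then $$\{0\}\times\pi_2\mathrm{WF}_s(u)\subseteq\mathrm{WF}^{t,s}(u).$$
   Context: Notation: $\mathbf N=\{0,1,2,\dots\}$, $D^\beta=(-i)^{|\beta|}\partial^\beta$, $\pi_2(x,\xi)=\xi$ for $(x,\xi)\in T^*\mathbf R^d\simeq\mathbf R^{2d}$. For $s,t>0$ with $s+t>1$, the (Beurling type) Gelfand--Shilov space $\Sigma_t^s(\mathbf R^d)$ consists of all $f\in C^\infty(\mathbf R^d)$ such that for every $h>0$ $$\|f\|_{\mathcal S_{t,h}^s}=\sup_{\alpha,\beta\in\mathbf N^d,\,x\in\mathbf R^d}\frac{|x^\alpha D^\beta f(x)|}{h^{|\alpha+\beta|}\alpha!^t\beta!^s}<\infty,$$ with the Fréchet topology given by these seminorms. $(\Sigma_t^s)'(\mathbf R^d)$ is its topological dual; the action $(u,\varphi)$ is conjugate linear in $\varphi$ and consistent with the $L^2$ inner product. Short-time Fourier transform: with $T_xf(y)=f(y-x)$, $M_\xi f(y)=e^{i\langle y,\xi\rangle}f(y)$, set $V_\psi u(x,\xi)=(2\pi)^{-d/2}(u,M_\xi T_x\psi)$. Wave front set $\mathrm{WF}^{t,s}$: for $u\in(\Sigma_t^s)'(\mathbf R^d)$ and a fixed $\psi\in\Sigma_t^s(\mathbf R^d)\setminus\{0\}$, $(x_0,\xi_0)\in T^*\mathbf R^d\setminus0$ satisfies $(x_0,\xi_0)\notin\mathrm{WF}^{t,s}(u)$ if there is an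 open set $U\subseteq T^*\mathbf R^d\setminus0$ containing $(x_0,\xi_0)$ such that $$\sup_{\lambda>0,\,(x,\xi)\in U}e^{r\lambda}|V_\psi u(\lambda^tx,\lambda^s\xi)|<\infty\quad\forall r>0.$$ The definition does not depend on the choice of $\psi$. Gevrey notions ($s>1$, Beurling type): $G^s(\mathbf R^d)$ is the set of $f\in C^\infty(\mathbf R^d)$ such that for each compact $K\subseteq\mathbf R^d$ and each $h>0$ there is $C_{K,h}>0$ with $|\partial^\alpha f(x)|\leq C_{K,h}h^{|\alpha|}\alpha!^s$ for $x\in K$, $\alpha\in\mathbf N^d$. $G_c^s(\mathbf R^d)$ is the subspace of compactly supported functions and $\mathscr D_s'(\mathbf R^d)$ its topological dual (Gevrey ultradistributions). One has $(\Sigma_t^s)'(\mathbf R^d)\subseteq\mathscr D_s'(\mathbf R^d)$ for $s>1$, $t>0$. Gevrey wave front set: for $u\in\mathscr D_s'(\mathbf R^d)$, a point $(x_0,\xi_0)\in\mathbf R^d\times(\mathbf R^d\setminus0)$ satisfies $(x_0,\xi_0)\notin\mathrm{WF}_s(u)$ if there exist $\varphi\in G_c^s(\mathbf R^d)$ with $\varphi(x_0)=1$ and an open conical neighborhood $\Gamma\subseteq\mathbf R^d\setminus0$ of $\xi_0$ such that $\sup_{\xi\in\Gamma}e^{r|\xi|^{1/s}}|\widehat{u\varphi}(\xi)|<\infty$ for all $r>0$, where $\widehat f(\xi)=(2\pi)^{-d/2}\int f(x)e^{-i\langle x,\xi\rangle}dx$. *)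

theory Defs
  imports "HOL-Analysis.Analysis"
begin

type_synonym 'n mindex = "'n \<Rightarrow> nat"

definition msize :: "('n::finite) mindex \<Rightarrow> nat" where
  "msize \<alpha> = (\<Sum>i\<in>UNIV. \<alpha> i)"

definition mfact :: "('n::finite) mindex \<Rightarrow> real" where
  "mfact \<alpha> = (\<Prod>i\<in>UNIV. fact (\<alpha> i))"

definition mpow :: "real^'n \<Rightarrow> ('n::finite) mindex \<Rightarrow> real" where
  "mpow x \<alpha> = (\<Prod>i\<in>UNIV. (x $ i) ^ \<alpha> i)"

definition partial_deriv :: "'n::finite \<Rightarrow> (real^'n \<Rightarrow> complex) \<Rightarrow> real^'n \<Rightarrow> complex" where
  "partial_deriv i f = (\<lambda>x. frechet_derivative f (at x) (axis i 1))"

text \<open>Differentiability of every iterated partial derivative makes all of them continuous,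
  so the following is membership in the space of infinitely differentiable functions.\<close>

definition smooth_fun :: "(real^('n::finite) \<Rightarrow> complex) \<Rightarrow> bool" where
  "smooth_fun f \<longleftrightarrow> (\<forall>ks x. foldr partial_deriv ks f differentiable (at x))"

text \<open>The index type carries no order, so the order in which the partial derivatives are
  taken is chosen arbitrarily; for smooth functions it does not matter.\<close>

definition mderiv :: "('n::finite) mindex \<Rightarrow> (real^'n \<Rightarrow> complex) \<Rightarrow> real^'n \<Rightarrow> complex" where
  "mderiv \<alpha> f = foldr partial_deriv (SOME ks. \<forall>i. count_list ks i = \<alpha> i) f"

lemma mderiv_order_exists: "\<exists>ks. \<forall>i. count_list ks i = \<alpha> i" for \<alpha> :: "('n::finite) mindex"
proof -
  obtain ks where "mset ks = Abs_multiset \<alpha>"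
    using ex_mset by blast
  then have "count (mset ks) = \<alpha>"
    by (simp add: Abs_multiset_inverse)
  then show ?thesis
    by (metis count_mset)
qed

definition Dop :: "('n::finite) mindex \<Rightarrow> (real^'n \<Rightarrow> complex) \<Rightarrow> real^'n \<Rightarrow> complex" where
  "Dop \<beta> f = (\<lambda>x. (- \<i>) ^ msize \<beta> * mderiv \<beta> f x)"

definition GS_seminorm ::
    "real \<Rightarrow> real \<Rightarrow> real \<Rightarrow> (real^('n::finite) \<Rightarrow> complex) \<Rightarrow> ennreal" where
  "GS_seminorm t s h f =
     (SUP (\<alpha>, \<beta>, x)\<in>UNIV.
        ennreal (cmod (complex_of_real (mpow x \<alpha>) * Dop \<beta> f x)
          / (h ^ msize (\<lambda>i. \<alpha> i + \<beta> i) * mfact \<alpha> powr t * mfact \<beta> powr s)))"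

definition GS_space :: "real \<Rightarrow> real \<Rightarrow> (real^('n::finite) \<Rightarrow> complex) set" where
  "GS_space t s = {f. smooth_fun f \<and> (\<forall>h>0. GS_seminorm t s h f < \<infinity>)}"

definition GS_topology :: "real \<Rightarrow> real \<Rightarrow> (real^('n::finite) \<Rightarrow> complex) topology" where
  "GS_topology t s = topology_generated_by
     {{f \<in> GS_space t s. GS_seminorm t s h (\<lambda>x. f x - g x) < ennreal \<epsilon>} |g h \<epsilon>.
        g \<in> GS_space t s \<and> h > 0 \<and> \<epsilon> > 0}"

text \<open>Functionals are represented by total functions on the function space; only their values
  on \<open>GS_space t s\<close> are constrained. The value \<open>u \<phi>\<close> is the sesquilinear pairing
  \<open>(u, \<phi>)\<close>, conjugate linear in \<open>\<phi>\<close>.\<close>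

definition GS_dual :: "real \<Rightarrow> real \<Rightarrow> ((real^('n::finite) \<Rightarrow> complex) \<Rightarrow> complex) set" where
  "GS_dual t s = {u.
     (\<forall>\<phi>\<in>GS_space t s. \<forall>\<eta>\<in>GS_space t s. u (\<lambda>x. \<phi> x + \<eta> x) = u \<phi> + u \<eta>) \<and>
     (\<forall>\<phi>\<in>GS_space t s. \<forall>c. u (\<lambda>x. c * \<phi> x) = cnj c * u \<phi>) \<and>
     continuous_map (GS_topology t s) euclidean u}"

definition translate :: "real^('n::finite) \<Rightarrow> (real^'n \<Rightarrow> complex) \<Rightarrow> real^'n \<Rightarrow> complex" where
  "translate x f = (\<lambda>y. f (y - x))"

definition modulate :: "real^('n::finite) \<Rightarrow> (real^'n \<Rightarrow> complex) \<Rightarrow> real^'n \<Rightarrow> complex" where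
  "modulate \<xi> f = (\<lambda>y. exp (\<i> * complex_of_real (y \<bullet> \<xi>)) * f y)"

definition STFT ::
    "(real^'n \<Rightarrow> complex) \<Rightarrow> ((real^'n \<Rightarrow> complex) \<Rightarrow> complex) \<Rightarrow>
      real^('n::finite) \<Rightarrow> real^'n \<Rightarrow> complex" where
  "STFT \<psi> u x \<xi> = complex_of_real ((2 * pi) powr (- real CARD('n) / 2))
     * u (modulate \<xi> (translate x \<psi>))"

text \<open>The window \<open>\<psi>\<close> is an explicit parameter. The cotangent bundle is identified with the
  space of pairs, from which only the origin \<open>(0, 0)\<close> is removed.\<close>

definition GS_WF ::
    "real \<Rightarrow> real \<Rightarrow> (real^'n \<Rightarrow> complex) \<Rightarrow> ((real^'n \<Rightarrow> complex) \<Rightarrow> complex) \<Rightarrow>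
      ((real^('n::finite)) \<times> (real^'n)) set" where
  "GS_WF t s \<psi> u = {p. p \<noteq> 0 \<and>
     \<not> (\<exists>U. open U \<and> U \<subseteq> - {0} \<and> p \<in> U \<and>
          (\<forall>r>0. bdd_above
            {exp (r * l) * cmod (STFT \<psi> u ((l powr t) *\<^sub>R x) ((l powr s) *\<^sub>R \<xi>)) |l x \<xi>.
               l > 0 \<and> (x, \<xi>) \<in> U}))}"

definition Gevrey :: "real \<Rightarrow> (real^('n::finite) \<Rightarrow> complex) set" where
  "Gevrey s = {f. smooth_fun f \<and>
     (\<forall>K h. compact K \<longrightarrow> h > 0 \<longrightarrow>
        (\<exists>C>0. \<forall>x\<in>K. \<forall>\<alpha>. cmod (mderiv \<alpha> f x) \<le> C * h ^ msize \<alpha> * mfact \<alpha> powr s))}"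

definition Gevrey_c :: "real \<Rightarrow> (real^('n::finite) \<Rightarrow> complex) set" where
  "Gevrey_c s = {f \<in> Gevrey s. compact (closure {x. f x \<noteq> 0})}"

text \<open>The product of an ultradistribution with a Gevrey function, from
  \<open>(u \<phi>, \<eta>) = (u, cnj \<phi> \<eta>)\<close>.\<close>

definition udist_mult ::
    "((real^('n::finite) \<Rightarrow> complex) \<Rightarrow> complex) \<Rightarrow> (real^'n \<Rightarrow> complex) \<Rightarrow>
      (real^'n \<Rightarrow> complex) \<Rightarrow> complex" where
  "udist_mult u \<phi> = (\<lambda>\<eta>. u (\<lambda>x. cnj (\<phi> x) * \<eta> x))"

text \<open>The Fourier transform of a compactly supported ultradistribution is the function obtained
  by testing against exponentials; conjugate linearity of the pairing turns \<open>exp (i x \<xi>)\<close> into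
  the usual kernel \<open>exp (- i x \<xi>)\<close>.\<close>

definition udist_fourier ::
    "((real^'n \<Rightarrow> complex) \<Rightarrow> complex) \<Rightarrow> real^('n::finite) \<Rightarrow> complex" where
  "udist_fourier v \<xi> = complex_of_real ((2 * pi) powr (- real CARD('n) / 2))
     * v (\<lambda>x. exp (\<i> * complex_of_real (x \<bullet> \<xi>)))"

text \<open>The library predicate \<open>conic\<close> allows the factor 0 and so would force \<open>0 \<in> \<Gamma>\<close>.\<close>

definition open_cone :: "(real^('n::finite)) set \<Rightarrow> bool" where
  "open_cone \<Gamma> \<longleftrightarrow> open \<Gamma> \<and> 0 \<notin> \<Gamma> \<and> (\<forall>\<xi>\<in>\<Gamma>. \<forall>c>0. c *\<^sub>R \<xi> \<in> \<Gamma>)"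

text \<open>Only the values of \<open>u\<close> on \<open>Gevrey_c s\<close> enter here, so the restriction of an element of
  \<open>GS_dual t s\<close> to an ultradistribution on \<open>Gevrey_c s\<close> (a subset of \<open>GS_space t s\<close>) is implicit.\<close>

definition Gevrey_WF ::
    "real \<Rightarrow> ((real^'n \<Rightarrow> complex) \<Rightarrow> complex) \<Rightarrow> ((real^('n::finite)) \<times> (real^'n)) set" where
  "Gevrey_WF s u = {(x0, \<xi>0). \<xi>0 \<noteq> 0 \<and>
     \<not> (\<exists>\<phi>\<in>Gevrey_c s. \<phi> x0 = 1 \<and>
          (\<exists>\<Gamma>. open_cone \<Gamma> \<and> \<xi>0 \<in> \<Gamma> \<and>
            (\<forall>r>0. bdd_above
              {exp (r * norm \<xi> powr (1 / s)) * cmod (udist_fourier (udist_mult u \<phi>) \<xi>) |\<xi>.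
                 \<xi> \<in> \<Gamma>})))}"

end

theory Submission
  imports Defs "HOL-Complex_Analysis.Complex_Analysis"
begin

text \<open>Let \<open>(0, \<xi>\<^sub>0)\<close> lie outside the global wave front set. Pick \<open>y\<^sub>0\<close> with \<open>\<psi> y\<^sub>0 \<noteq> 0\<close>, put \<open>a = x\<^sub>0 - y\<^sub>0\<close> and
  localize at \<open>x\<^sub>0\<close> with the cutoff \<open>\<phi>\<close> whose conjugate is a multiple of \<open>T\<^sub>a\<psi> \<chi>\<close>, where \<open>\<chi>\<close> is a Gevrey function supported
  near \<open>x\<^sub>0\<close>. Expanding only \<open>\<chi>\<close> in exponentials writes the Fourier transform of \<open>u \<phi>\<close> at \<open>\<xi>\<close> as a superposition of the
  values \<open>V\<^sub>\<psi>u(a, \<xi> + \<zeta>)\<close>, with coefficients that decay like \<open>exp (- r \<bar>\<zeta>\<bar>\<^bsup>1/s\<^esup>)\<close> for every \<open>r\<close>; a single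
  base point \<open>a\<close> enters. For \<open>\<xi>\<close> large in a narrow cone and \<open>\<bar>\<zeta>\<bar>\<close> small compared to \<open>\<bar>\<xi>\<bar>\<close>, rescaling brings \<open>(a, \<xi> + \<zeta>)\<close> into
  the neighbourhood of \<open>(0, \<xi>\<^sub>0)\<close> where \<open>V\<^sub>\<psi>u\<close> decays; for larger \<open>\<zeta>\<close> the coefficients beat the growth of \<open>V\<^sub>\<psi>u\<close>.
  To pair \<open>u\<close> with the superposition without integrating in the test function space, the expansion is truncated to
  finite sums: the Fourier series of \<open>\<chi>\<close> with period \<open>2 \<pi> N\<close> agrees with \<open>\<chi>\<close> on a box of size \<open>N\<close>, and the decay
  of \<open>T\<^sub>a\<psi>\<close> makes the error outside the box vanish as \<open>N\<close> tends to infinity.\<close>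

section \<open>Partial derivatives of smooth functions\<close>

text \<open>The window \<open>\<psi>\<close> is given and arbitrary: it may vanish at
  \<open>x0\<close> and need not have compact support. Building the cutoff from a translate of
  \<open>\<psi>\<close> itself avoids a change of window. The base point \<open>a\<close> produced
  by the translation is harmless, because \<open>a / l^t\<close> tends to 0 as \<open>l\<close>
  grows; this is why only the fibre over 0 matters, wherever \<open>x0\<close> lies. The estimates
  rest on opposite quantifiers. A continuous \<open>u\<close> grows at most at one unknown
  exponential rate and sees derivatives at one unknown scale \<open>h\<close>, whereas test
  functions of Beurling type satisfy their bounds for every rate and every \<open>h\<close>. The
  constants of \<open>u\<close> are therefore fixed first, and the test functions are then used at
  the rate and scale required. Derivatives are indexed by lists, so that inductions add one
  derivative at a time; the symmetry of second derivatives links lists with multi-indices.\<close>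

abbreviation pderivs :: "'n::finite list \<Rightarrow> (real^'n \<Rightarrow> complex) \<Rightarrow> real^'n \<Rightarrow> complex" where
  "pderivs ks f \<equiv> foldr partial_deriv ks f"

lemma smooth_fun_pderivs: "smooth_fun f \<Longrightarrow> smooth_fun (pderivs ks f)"
  unfolding smooth_fun_def by (metis foldr_append o_apply)

lemma smooth_fun_partial_deriv: "smooth_fun f \<Longrightarrow> smooth_fun (partial_deriv i f)"
  using smooth_fun_pderivs[of f "[i]"] by simp

lemma smooth_fun_differentiable: "smooth_fun f \<Longrightarrow> f differentiable (at x)"
  unfolding smooth_fun_def by (metis foldr.simps(1) id_apply)

lemma smooth_fun_continuous_on: "smooth_fun f \<Longrightarrow> continuous_on S f"
  by (meson continuous_at_imp_continuous_on differentiable_imp_continuous_within smooth_fun_differentiable)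

lemma partial_deriv_eqI: "(f has_derivative f') (at x) \<Longrightarrow> partial_deriv i f x = f' (axis i 1)"
  unfolding partial_deriv_def using frechet_derivative_at by metis

lemma partial_deriv_line:
  assumes "smooth_fun f"
  shows "((\<lambda>\<tau>. f (z + \<tau> *\<^sub>R axis i 1)) has_vector_derivative
    partial_deriv i f (z + \<tau> *\<^sub>R axis i 1)) (at \<tau> within S)"
proof -
  let ?g = "\<lambda>\<tau>. z + \<tau> *\<^sub>R axis i (1::real)"
  have f: "(f has_derivative frechet_derivative f (at (?g \<tau>))) (at (?g \<tau>))"
    using smooth_fun_differentiable[OF assms] frechet_derivative_works by blast
  have "(?g has_derivative (\<lambda>\<tau>. \<tau> *\<^sub>R axis i 1)) (at \<tau>)"
    by (auto intro!: derivative_eq_intros)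
  from has_derivative_compose[OF this f]
  have "((\<lambda>\<tau>. f (?g \<tau>)) has_derivative (\<lambda>h. frechet_derivative f (at (?g \<tau>)) (h *\<^sub>R axis i 1))) (at \<tau>)" .
  moreover have "linear (frechet_derivative f (at (?g \<tau>)))"
    using f has_derivative_linear by blast
  ultimately show ?thesis
    by (auto simp: has_vector_derivative_def partial_deriv_def linear_scale intro: has_derivative_at_withinI)
qed

text \<open>Differentiating \<open>f (x + s e\<^sub>i + \<tau> e\<^sub>j) = f (x + \<tau> e\<^sub>j) + \<integral>\<^sub>0\<^sup>s \<partial>\<^sub>i f (x + \<sigma> e\<^sub>i + \<tau> e\<^sub>j) d\<sigma>\<close>
  in \<open>\<tau>\<close> under the integral sign and then in \<open>s\<close> gives the symmetry.\<close>

lemma partial_deriv_commute: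
  assumes f: "smooth_fun f"
  shows "partial_deriv i (partial_deriv j f) = partial_deriv j (partial_deriv i f)"
proof
  fix x :: "real^'a"
  let ?ei = "axis i (1::real)" and ?ej = "axis j (1::real)"
  note fi = smooth_fun_partial_deriv[OF f, of i] and fj = smooth_fun_partial_deriv[OF f, of j]
  note fij = smooth_fun_partial_deriv[OF fi, of j]
  define A where "A s = integral {0..s} (\<lambda>\<sigma>. partial_deriv j (partial_deriv i f) (x + \<sigma> *\<^sub>R ?ei))" for s
  have A: "partial_deriv j f (x + s *\<^sub>R ?ei) = partial_deriv j f x + A s" if "s \<ge> 0" for s
  proof -
    have ftc: "f (x + \<tau> *\<^sub>R ?ej + s *\<^sub>R ?ei) =
      f (x + \<tau> *\<^sub>R ?ej) + integral {0..s} (\<lambda>\<sigma>. partial_deriv i f (x + \<tau> *\<^sub>R ?ej + \<sigma> *\<^sub>R ?ei))" for \<tau>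
      using fundamental_theorem_of_calculus[OF that partial_deriv_line[OF f, of "x + \<tau> *\<^sub>R ?ej" i]]
      by (simp add: has_integral_iff)
    have "((\<lambda>\<tau>. integral (cbox 0 s) (\<lambda>\<sigma>. partial_deriv i f (x + \<tau> *\<^sub>R ?ej + \<sigma> *\<^sub>R ?ei))) has_vector_derivative
      integral (cbox 0 s) (\<lambda>\<sigma>. partial_deriv j (partial_deriv i f) (x + 0 *\<^sub>R ?ej + \<sigma> *\<^sub>R ?ei))) (at 0 within UNIV)"
    proof (rule leibniz_rule_vector_derivative)
      fix \<tau> \<sigma> :: real
      show "((\<lambda>\<tau>. partial_deriv i f (x + \<tau> *\<^sub>R ?ej + \<sigma> *\<^sub>R ?ei)) has_vector_derivative
        partial_deriv j (partial_deriv i f) (x + \<tau> *\<^sub>R ?ej + \<sigma> *\<^sub>R ?ei)) (at \<tau> within UNIV)"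
        using partial_deriv_line[OF fi, of "x + \<sigma> *\<^sub>R ?ei" j \<tau> UNIV] by (simp add: add_ac)
    next
      fix \<tau>
      show "(\<lambda>\<sigma>. partial_deriv i f (x + \<tau> *\<^sub>R ?ej + \<sigma> *\<^sub>R ?ei)) integrable_on cbox 0 s"
        by (intro integrable_continuous continuous_on_compose2[OF smooth_fun_continuous_on[OF fi, of UNIV]])
           (auto intro!: continuous_intros)
    next
      show "continuous_on (UNIV \<times> cbox 0 s) (\<lambda>(\<tau>, \<sigma>). partial_deriv j (partial_deriv i f) (x + \<tau> *\<^sub>R ?ej + \<sigma> *\<^sub>R ?ei))"
        unfolding split_def
        by (intro continuous_on_compose2[OF smooth_fun_continuous_on[OF fij, of UNIV]])
           (auto intro!: continuous_intros)
    qed auto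
    then have "((\<lambda>\<tau>. f (x + \<tau> *\<^sub>R ?ej) + integral {0..s} (\<lambda>\<sigma>. partial_deriv i f (x + \<tau> *\<^sub>R ?ej + \<sigma> *\<^sub>R ?ei)))
       has_vector_derivative (partial_deriv j f x + A s)) (at 0)"
      using partial_deriv_line[OF f, of x j 0 UNIV] unfolding A_def
      by (intro has_vector_derivative_add) auto
    moreover have "((\<lambda>\<tau>. f (x + \<tau> *\<^sub>R ?ej + s *\<^sub>R ?ei)) has_vector_derivative partial_deriv j f (x + s *\<^sub>R ?ei)) (at 0)"
      using partial_deriv_line[OF f, of "x + s *\<^sub>R ?ei" j 0 UNIV] by (simp add: add_ac)
    ultimately show ?thesis
      unfolding ftc using vector_derivative_unique_at by blast
  qed
  \<comment> \<open>The formula involving \<open>A\<close> is available for \<open>s \<ge> 0\<close>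
    only, so the derivatives at 0 are one-sided and are compared within
    \<open>{0..1}\<close>.\<close>
  have "((\<lambda>s. partial_deriv j f x + A s) has_vector_derivative
      0 + partial_deriv j (partial_deriv i f) (x + 0 *\<^sub>R ?ei)) (at 0 within {0..1})"
    unfolding A_def
    by (intro has_vector_derivative_add has_vector_derivative_const integral_has_vector_derivative
        continuous_on_compose2[OF smooth_fun_continuous_on[OF fij, of UNIV]])
       (auto intro!: continuous_intros)
  then have "((\<lambda>s. partial_deriv j f (x + s *\<^sub>R ?ei)) has_vector_derivative
      0 + partial_deriv j (partial_deriv i f) (x + 0 *\<^sub>R ?ei)) (at 0 within {0..1})"
    by (rule has_vector_derivative_transform[rotated 2]) (auto simp: A)
  moreover have "((\<lambda>s. partial_deriv j f (x + s *\<^sub>R ?ei)) has_vector_derivative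
      partial_deriv i (partial_deriv j f) x) (at 0 within {0..1})"
    using partial_deriv_line[OF fj, of x i 0] by simp
  ultimately show "partial_deriv i (partial_deriv j f) x = partial_deriv j (partial_deriv i f) x"
    using vector_derivative_unique_within_closed_interval[of 0 1 0] by force
qed

lemma pderivs_move:
  assumes "smooth_fun f"
  shows "pderivs (xs @ k # ys) f = pderivs (k # xs @ ys) f"
proof (induction xs)
  case (Cons x xs)
  then have "pderivs ((x # xs) @ k # ys) f = partial_deriv x (partial_deriv k (pderivs (xs @ ys) f))"
    by simp
  also have "\<dots> = partial_deriv k (partial_deriv x (pderivs (xs @ ys) f))"
    by (rule partial_deriv_commute) (rule smooth_fun_pderivs[OF assms])
  finally show ?case by simp
qed simp

lemma pderivs_cong_mset:
  assumes "smooth_fun f"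
  shows "mset ks = mset ls \<Longrightarrow> pderivs ks f = pderivs ls f"
proof (induction ks arbitrary: ls)
  case (Cons k ks)
  then obtain xs ys where ls: "ls = xs @ k # ys"
    by (metis list.set_intros(1) set_mset_mset split_list)
  with Cons.prems have "mset ks = mset (xs @ ys)" by simp
  from Cons.IH[OF this] have "pderivs ks f = pderivs (xs @ ys) f" .
  then show ?case unfolding ls pderivs_move[OF assms] by simp
qed simp

lemma pderivs_cong_count:
  assumes "smooth_fun f" "count_list ks = count_list ls"
  shows "pderivs ks f = pderivs ls f"
  using assms by (intro pderivs_cong_mset multiset_eqI) (simp_all add: count_mset)

lemma mderiv_eq_pderivs:
  assumes "smooth_fun f"
  shows "mderiv (count_list ks) f = pderivs ks f"
proof -
  have "\<forall>i. count_list (SOME ls. \<forall>i. count_list ls i = count_list ks i) i = count_list ks i"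
    by (rule someI[where x = ks]) simp
  then show ?thesis
    unfolding mderiv_def by (intro pderivs_cong_count[OF assms]) auto
qed

lemma ex_count_list: "\<exists>ks. count_list ks = \<alpha>" for \<alpha> :: "('n::finite) mindex"
  using mderiv_order_exists[of \<alpha>] by auto

lemma msize_count_list: "msize (count_list ks) = length ks"
  unfolding msize_def by (rule sum_count_set) auto

text \<open>The index set of Leibniz's rule: each entry of the list differentiates one of the two
  factors. Listing all distributions, with repetitions, takes the place of binomial
  coefficients.\<close>

fun splits :: "'a list \<Rightarrow> ('a list \<times> 'a list) list" where
  "splits [] = [([], [])]"
| "splits (k # ks) = map (\<lambda>(a, b). (k # a, b)) (splits ks) @ map (\<lambda>(a, b). (a, k # b)) (splits ks)"

lemma length_splits: "length (splits ks) = 2 ^ length ks"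
  by (induction ks) auto

lemma splits_count: "(a, b) \<in> set (splits ks) \<Longrightarrow> count_list ks i = count_list a i + count_list b i"
  by (induction ks arbitrary: a b) (force split: if_splits)+

lemma splits_length: "(a, b) \<in> set (splits ks) \<Longrightarrow> length ks = length a + length b"
  by (induction ks arbitrary: a b) (force split: if_splits)+

lemma pderivs_mult:
  fixes f g :: "real^'n::finite \<Rightarrow> complex"
  assumes "smooth_fun f" "smooth_fun g"
  shows "pderivs ks (\<lambda>x. f x * g x) = (\<lambda>x. \<Sum>(a, b)\<leftarrow>splits ks. pderivs a f x * pderivs b g x)"
proof (induction ks)
  case (Cons k ks)
  have D: "((\<lambda>x. \<Sum>(a, b)\<leftarrow>S. pderivs a f x * pderivs b g x) has_derivative
     (\<lambda>h. \<Sum>(a, b)\<leftarrow>S. pderivs a f x * frechet_derivative (pderivs b g) (at x) h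
        + frechet_derivative (pderivs a f) (at x) h * pderivs b g x)) (at x)" for S x
  proof (induction S)
    case (Cons p S)
    obtain a b where p: "p = (a, b)" by force
    have "(pderivs a f has_derivative frechet_derivative (pderivs a f) (at x)) (at x)"
      "(pderivs b g has_derivative frechet_derivative (pderivs b g) (at x)) (at x)"
      using assms unfolding smooth_fun_def by (auto simp: frechet_derivative_works)
    from has_derivative_add[OF has_derivative_mult[OF this] Cons]
    show ?case by (simp add: p)
  qed simp
  show ?case
  proof
    fix x
    have "pderivs (k # ks) (\<lambda>x. f x * g x) x =
      (\<Sum>(a, b)\<leftarrow>splits ks. pderivs a f x * pderivs (k # b) g x + pderivs (k # a) f x * pderivs b g x)"
      unfolding foldr.simps o_apply Cons
      by (subst partial_deriv_eqI[OF D]) (simp add: partial_deriv_def split_def)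
    also have "\<dots> = (\<Sum>(a, b)\<leftarrow>splits (k # ks). pderivs a f x * pderivs b g x)"
      by (simp add: split_def o_def sum_list_addf add_ac)
    finally show "pderivs (k # ks) (\<lambda>x. f x * g x) x =
      (\<Sum>(a, b)\<leftarrow>splits (k # ks). pderivs a f x * pderivs b g x)" .
  qed
qed simp

lemma sum_list_differentiable:
  fixes f :: "'a \<Rightarrow> 'b::real_normed_vector \<Rightarrow> 'c::real_normed_vector"
  shows "(\<And>a. a \<in> set S \<Longrightarrow> f a differentiable (at x)) \<Longrightarrow> (\<lambda>x. \<Sum>a\<leftarrow>S. f a x) differentiable (at x)"
  by (induction S) (auto intro!: differentiable_add)

lemma smooth_fun_mult:
  assumes "smooth_fun f" "smooth_fun g"
  shows "smooth_fun (\<lambda>x. f x * g x)"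
  using assms unfolding smooth_fun_def pderivs_mult[OF assms]
  by (auto intro!: sum_list_differentiable differentiable_mult simp: split_def)

lemma smooth_funI:
  assumes "\<And>ks. pderivs ks f = F ks" "\<And>ks x. F ks differentiable (at x)"
  shows "smooth_fun f"
  using assms by (simp add: smooth_fun_def)

lemma pderivs_bounded_linear:
  fixes L :: "complex \<Rightarrow> complex"
  assumes f: "smooth_fun f" and L: "bounded_linear L"
  shows "pderivs ks (\<lambda>x. L (f x)) = (\<lambda>x. L (pderivs ks f x))"
proof (induction ks)
  case (Cons k ks)
  have "((\<lambda>x. L (pderivs ks f x)) has_derivative
      (\<lambda>h. L (frechet_derivative (pderivs ks f) (at x) h))) (at x)" for x
    using f unfolding smooth_fun_def
    by (intro bounded_linear.has_derivative[OF L]) (simp add: frechet_derivative_works)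
  from partial_deriv_eqI[OF this] show ?case
    by (simp add: Cons partial_deriv_def[of k "pderivs ks f"])
qed simp

lemma smooth_fun_bounded_linear:
  fixes L :: "complex \<Rightarrow> complex"
  assumes f: "smooth_fun f" and L: "bounded_linear L"
  shows "smooth_fun (\<lambda>x. L (f x))"
  using f unfolding smooth_fun_def pderivs_bounded_linear[OF assms]
  by (metis L bounded_linear.has_derivative differentiable_def)

lemma pderivs_add:
  assumes "smooth_fun f" "smooth_fun g"
  shows "pderivs ks (\<lambda>x. f x + g x) = (\<lambda>x. pderivs ks f x + pderivs ks g x)"
proof (induction ks)
  case (Cons k ks)
  have "((\<lambda>x. pderivs ks f x + pderivs ks g x) has_derivative
      (\<lambda>h. frechet_derivative (pderivs ks f) (at x) h + frechet_derivative (pderivs ks g) (at x) h)) (at x)" for x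
    using assms unfolding smooth_fun_def
    by (intro has_derivative_add) (simp_all add: frechet_derivative_works)
  from partial_deriv_eqI[OF this] show ?case
    by (simp add: Cons partial_deriv_def[of k "pderivs ks f"] partial_deriv_def[of k "pderivs ks g"])
qed simp

lemma smooth_fun_add:
  assumes "smooth_fun f" "smooth_fun g"
  shows "smooth_fun (\<lambda>x. f x + g x)"
  using assms unfolding smooth_fun_def pderivs_add[OF assms] by (auto intro!: differentiable_add)

lemma pderivs_diff:
  assumes "smooth_fun f" "smooth_fun g"
  shows "pderivs ks (\<lambda>x. f x - g x) = (\<lambda>x. pderivs ks f x - pderivs ks g x)"
  using pderivs_add[OF assms(1) smooth_fun_bounded_linear[OF assms(2) bounded_linear_minus[OF bounded_linear_ident]]]
    pderivs_bounded_linear[OF assms(2) bounded_linear_minus[OF bounded_linear_ident]] by simp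

lemma smooth_fun_diff:
  assumes "smooth_fun f" "smooth_fun g"
  shows "smooth_fun (\<lambda>x. f x - g x)"
  using assms unfolding smooth_fun_def pderivs_diff[OF assms] by (auto intro!: differentiable_diff)

lemma pderivs_translate: "smooth_fun f \<Longrightarrow> pderivs ks (translate a f) = translate a (pderivs ks f)"
proof (induction ks)
  case (Cons k ks)
  show ?case
  proof
    fix x
    have "(pderivs ks f has_derivative frechet_derivative (pderivs ks f) (at (x - a))) (at (x - a))"
      using Cons.prems unfolding smooth_fun_def by (simp add: frechet_derivative_works)
    then have "((\<lambda>x. pderivs ks f (x - a)) has_derivative frechet_derivative (pderivs ks f) (at (x - a))) (at x)"
      by (rule has_derivative_compose[rotated]) (auto intro!: derivative_eq_intros)
    then show "pderivs (k # ks) (translate a f) x = translate a (pderivs (k # ks) f) x"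
      using Cons by (simp add: translate_def partial_deriv_eqI) (simp add: partial_deriv_def)
  qed
qed simp

lemma smooth_fun_translate:
  assumes "smooth_fun f" shows "smooth_fun (translate a f)"
proof (rule smooth_funI)
  show "pderivs ks (translate a f) = translate a (pderivs ks f)" for ks
    by (rule pderivs_translate[OF assms])
  show "translate a (pderivs ks f) differentiable (at x)" for ks x
    unfolding translate_def
    using differentiable_chain_at[of "\<lambda>x. x - a" x "pderivs ks f"] assms
    by (auto simp: smooth_fun_def o_def)
qed

section \<open>Tensor products of functions of one variable\<close>

definition tensor :: "('n::finite \<Rightarrow> nat \<Rightarrow> real \<Rightarrow> complex) \<Rightarrow> real^'n \<Rightarrow> complex" where
  "tensor J y = (\<Prod>i\<in>UNIV. J i 0 (y $ i))"

text \<open>All derivatives are carried along explicitly, so that differentiating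
  \<open>tensor J\<close> only raises indices in \<open>J\<close>, and bounds in one variable
  multiply over the coordinates.\<close>

definition jet :: "(nat \<Rightarrow> real \<Rightarrow> complex) \<Rightarrow> bool" where
  "jet J \<longleftrightarrow> (\<forall>n x. (J n has_vector_derivative J (Suc n) x) (at x))"

lemma tensor_has_derivative:
  assumes "\<And>i. jet (J i)"
  shows "((\<lambda>y. \<Prod>i\<in>UNIV. J i (m i) (y $ i)) has_derivative
    (\<lambda>h. \<Sum>i\<in>UNIV. (h $ i *\<^sub>R J i (Suc (m i)) (y $ i)) * (\<Prod>j\<in>UNIV - {i}. J j (m j) (y $ j)))) (at y)"
proof (rule has_derivative_prod)
  fix i
  have "(J i (m i) has_derivative (\<lambda>h. h *\<^sub>R J i (Suc (m i)) (y $ i))) (at (y $ i))"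
    using assms unfolding jet_def has_vector_derivative_def by blast
  from has_derivative_compose[OF bounded_linear_imp_has_derivative[OF bounded_linear_vec_nth] this]
  show "((\<lambda>y. J i (m i) (y $ i)) has_derivative (\<lambda>h. h $ i *\<^sub>R J i (Suc (m i)) (y $ i))) (at y)"
    by simp
qed

lemma pderivs_tensor:
  assumes "\<And>i. jet (J i)"
  shows "pderivs ks (tensor J) = (\<lambda>y. \<Prod>i\<in>UNIV. J i (count_list ks i) (y $ i))"
proof (induction ks)
  case (Cons k ks)
  show ?case
  proof
    fix y
    have "pderivs (k # ks) (tensor J) y = (\<Sum>i\<in>UNIV. (axis k (1::real) $ i *\<^sub>R J i (Suc (count_list ks i)) (y $ i)) *
        (\<Prod>j\<in>UNIV - {i}. J j (count_list ks j) (y $ j)))"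
      unfolding foldr.simps o_apply Cons by (subst partial_deriv_eqI[OF tensor_has_derivative[OF assms]]) simp
    also have "\<dots> = (\<Sum>i\<in>{k}. (axis k (1::real) $ i *\<^sub>R J i (Suc (count_list ks i)) (y $ i)) *
        (\<Prod>j\<in>UNIV - {i}. J j (count_list ks j) (y $ j)))"
      by (rule sum.mono_neutral_right) (auto simp: axis_def)
    also have "\<dots> = J k (count_list (k # ks) k) (y $ k) * (\<Prod>j\<in>UNIV - {k}. J j (count_list (k # ks) j) (y $ j))"
      by simp
    also have "\<dots> = (\<Prod>i\<in>UNIV. J i (count_list (k # ks) i) (y $ i))"
      by (rule prod.remove[symmetric]) auto
    finally show "pderivs (k # ks) (tensor J) y = (\<Prod>i\<in>UNIV. J i (count_list (k # ks) i) (y $ i))" .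
  qed
qed (simp add: tensor_def[abs_def])

lemma smooth_fun_tensor:
  assumes "\<And>i. jet (J i)" shows "smooth_fun (tensor J)"
proof (rule smooth_funI)
  show "(\<lambda>y. \<Prod>i\<in>UNIV. J i (count_list ks i) (y $ i)) differentiable (at x)" for ks x
    using tensor_has_derivative[of J, OF assms] unfolding differentiable_def by blast
qed (rule pderivs_tensor[OF assms])

section \<open>Gelfand--Shilov bounds with exponential weights\<close>

text \<open>With \<open>S = x + y\<close>, both \<open>x / S\<close> and \<open>y / S\<close> lie in
  [0, 1], where \<open>z \<le> z powr p\<close>, and they add up to 1.\<close>

lemma powr_add_le_powr_add:
  fixes x y p :: real
  assumes "0 \<le> x" "0 \<le> y" "0 < p" "p \<le> 1"
  shows "(x + y) powr p \<le> x powr p + y powr p"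
proof (cases "x + y = 0")
  case False
  define S where "S = x + y"
  have S: "S > 0" using False assms by (simp add: S_def)
  have *: "z / S \<le> (z / S) powr p" if "0 \<le> z" "z \<le> S" for z
  proof (cases "z = 0")
    case False
    then have "(z / S) powr 1 \<le> (z / S) powr p"
      using that S assms by (intro powr_mono') auto
    then show ?thesis using that S by simp
  qed simp
  have "1 = x / S + y / S" using S by (simp add: S_def flip: add_divide_distrib)
  also have "\<dots> \<le> (x / S) powr p + (y / S) powr p"
    using assms S by (intro add_mono *) (auto simp: S_def)
  also have "\<dots> = (x powr p + y powr p) / S powr p"
    using assms S by (simp add: powr_divide add_divide_distrib)
  finally show ?thesis using S by (simp add: field_simps S_def)
qed (use assms in auto)

lemma powr_sum_le_sum_powr:
  fixes f :: "'a \<Rightarrow> real"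
  assumes "finite A" "\<And>i. i \<in> A \<Longrightarrow> 0 \<le> f i" "0 < p" "p \<le> 1"
  shows "(\<Sum>i\<in>A. f i) powr p \<le> (\<Sum>i\<in>A. f i powr p)"
  using assms(1,2)
proof (induction A)
  case (insert a A)
  then have "(f a + (\<Sum>i\<in>A. f i)) powr p \<le> f a powr p + (\<Sum>i\<in>A. f i) powr p"
    using assms by (intro powr_add_le_powr_add sum_nonneg) auto
  with insert show ?case by force
qed simp

text \<open>For \<open>p \<ge> 1\<close> comparable to \<open>norm y powr (1 / p)\<close>, but
  additive over the coordinates, so that its exponentials factor as monomials and tensor products
  do. It serves with \<open>p = t\<close> in position and with \<open>p = s\<close> in
  frequency.\<close>

definition wt :: "real \<Rightarrow> real^'n::finite \<Rightarrow> real" where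
  "wt p y = (\<Sum>i\<in>UNIV. \<bar>y $ i\<bar> powr (1 / p))"

lemma wt_nonneg: "0 \<le> wt p y"
  unfolding wt_def by (simp add: sum_nonneg)

lemma wt_add_le:
  assumes "p \<ge> 1" shows "wt p (x + y) \<le> wt p x + wt p y"
proof -
  have "\<bar>x $ i + y $ i\<bar> powr (1 / p) \<le> \<bar>x $ i\<bar> powr (1 / p) + \<bar>y $ i\<bar> powr (1 / p)" for i
    using assms
    by (intro order_trans[OF powr_mono2 powr_add_le_powr_add]) auto
  then show ?thesis
    unfolding wt_def sum.distrib[symmetric] by (intro sum_mono) simp
qed

lemma norm_powr_le_wt:
  assumes "p \<ge> 1" shows "norm y powr (1 / p) \<le> wt p y"
proof -
  have "norm y powr (1 / p) \<le> (\<Sum>i\<in>UNIV. \<bar>y $ i\<bar>) powr (1 / p)"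
    using assms by (intro powr_mono2 norm_le_l1_cart) auto
  also have "\<dots> \<le> wt p y"
    unfolding wt_def using assms by (intro powr_sum_le_sum_powr) auto
  finally show ?thesis .
qed

lemma wt_le_norm_powr:
  fixes y :: "real^'n::finite"
  assumes "p \<ge> 1" shows "wt p y \<le> CARD('n) * norm y powr (1 / p)"
proof -
  have "wt p y \<le> (\<Sum>i\<in>(UNIV::'n set). norm y powr (1 / p))"
    unfolding wt_def using assms by (intro sum_mono powr_mono2) (auto simp: component_le_norm_cart)
  then show ?thesis by simp
qed

lemma power_le_fact_mult_exp:
  fixes z :: real assumes "z \<ge> 0" shows "z ^ n \<le> fact n * exp z"
proof -
  have "(\<Sum>k\<in>{n}. z ^ k /\<^sub>R fact k) \<le> (\<Sum>k. z ^ k /\<^sub>R fact k)"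
    using assms by (intro sum_le_suminf summable_exp_generic) auto
  then show ?thesis by (simp add: exp_def field_simps)
qed

text \<open>The inequality \<open>z ^ n \<le> fact n * exp z\<close> at
  \<open>z = (v / h) powr (1 / p)\<close>, raised to the power \<open>p\<close>. In position it
  trades monomials for exponential weights; in frequency it turns powers of a frequency into Gevrey
  bounds.\<close>

lemma power_le_fact_powr_mult_exp:
  fixes v h p :: real
  assumes "v \<ge> 0" "h > 0" "p > 0"
  shows "v ^ n \<le> h ^ n * fact n powr p * exp (p * h powr (- 1 / p) * v powr (1 / p))"
proof -
  define z where "z = (v / h) powr (1 / p)"
  have z: "z \<ge> 0" by (simp add: z_def)
  have zp: "z powr p = v / h" using assms by (simp add: z_def powr_powr)
  have pz: "p * z = p * h powr (- 1 / p) * v powr (1 / p)"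
    using assms by (simp add: z_def powr_divide powr_minus field_simps)
  have "(v / h) ^ n = (z powr p) ^ n" by (simp add: zp)
  also have "\<dots> = (z ^ n) powr p"
    using z by (cases "z = 0") (auto simp: powr_powr powr_realpow[symmetric] mult.commute power_0_left)
  also have "\<dots> \<le> (fact n * exp z) powr p"
    using z assms by (intro powr_mono2 power_le_fact_mult_exp) auto
  also have "\<dots> = fact n powr p * exp (p * z)"
    by (simp add: powr_mult exp_powr_real mult.commute)
  finally show ?thesis using assms unfolding pz by (simp add: field_simps power_divide)
qed

text \<open>If every \<open>(2 x)\<^sup>n / n!\<close> were below \<open>exp x / 4\<close>, then
  \<open>exp x = (\<Sum>n. (1/2)\<^sup>n (2 x)\<^sup>n / n!)\<close> would be at most \<open>exp x / 2\<close>.\<close>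

lemma ex_exp_le_power:
  fixes x :: real assumes "x \<ge> 0"
  shows "\<exists>n. exp x * fact n \<le> 4 * (2 * x) ^ n"
proof (rule ccontr)
  assume "\<not> ?thesis"
  then have *: "4 * (2 * x) ^ n < exp x * fact n" for n by (simp add: not_le)
  have lt: "x ^ n /\<^sub>R fact n \<le> exp x / 4 * (1/2) ^ n" for n
    using *[of n] by (simp add: field_simps power_mult_distrib)
  have e: "(\<Sum>n. x ^ n /\<^sub>R fact n) = exp x" by (simp add: exp_def)
  have "(\<Sum>n. x ^ n /\<^sub>R fact n) \<le> (\<Sum>n. exp x / 4 * (1/2) ^ n)"
    by (rule suminf_le[OF lt]) (auto intro!: summable_mult summable_geometric summable_exp)
  also have "\<dots> = exp x / 2" by (subst suminf_mult) (auto simp: suminf_geometric)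
  finally have "exp x \<le> exp x / 2" unfolding e .
  then show False by simp
qed

text \<open>A converse of \<open>power_le_fact_powr_mult_exp\<close>, with \<open>n\<close> adapted
  to \<open>v\<close>: it is \<open>ex_exp_le_power\<close> at \<open>B * z\<close>, raised to the
  power \<open>p\<close>. Since \<open>B * p = R\<close>, the exponential comes out at rate
  \<open>R\<close>, and the factor \<open>2 * B\<close> is absorbed into \<open>h\<close>.\<close>

lemma ex_exp_powr_le_power:
  fixes R p :: real
  assumes "R > 0" "p > 0"
  obtains h K where "h > 0" "K > 0"
    "\<And>v. v \<ge> 0 \<Longrightarrow> \<exists>n. exp (R * v powr (1 / p)) * (h ^ n * fact n powr p) \<le> K * v ^ n"
proof
  define B where "B = R / p"
  have B: "B > 0" using assms by (simp add: B_def)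
  show "(1 / (2 * B)) powr p > 0" "(4::real) powr p > 0" using B by auto
  fix v :: real assume v: "v \<ge> 0"
  define z where "z = v powr (1 / p)"
  have z: "z \<ge> 0" by (simp add: z_def)
  have zp: "z powr p = v" using assms v by (simp add: z_def powr_powr)
  obtain n where n: "exp (B * z) * fact n \<le> 4 * (2 * (B * z)) ^ n"
    using ex_exp_le_power[of "B * z"] B z by auto
  have pw: "(a ^ n) powr p = (a powr p) ^ n" if "a \<ge> 0" for a :: real
    using that by (cases "a = 0") (auto simp: powr_powr powr_realpow[symmetric] mult.commute power_0_left)
  have "(exp (B * z) * fact n * (1 / (2 * B)) ^ n) powr p \<le> (4 * z ^ n) powr p"
    using n B assms by (intro powr_mono2) (auto simp: field_simps power_mult_distrib)
  then have "exp (B * z) powr p * ((1 / (2 * B)) powr p) ^ n * fact n powr p \<le> 4 powr p * v ^ n"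
    using B z by (simp add: powr_mult pw zp mult_ac)
  moreover have "exp (B * z) powr p = exp (R * z)"
    using assms by (simp add: exp_powr_real B_def)
  ultimately show "\<exists>n. exp (R * v powr (1 / p)) * (((1 / (2 * B)) powr p) ^ n * fact n powr p) \<le> 4 powr p * v ^ n"
    unfolding z_def by (auto simp: mult_ac)
qed

lemma mfact_pos: "mfact \<alpha> > 0"
  unfolding mfact_def by (simp add: prod_pos)

lemma mfact_powr: "mfact \<alpha> powr p = (\<Prod>i\<in>UNIV. fact (\<alpha> i) powr p)"
  unfolding mfact_def by (rule prod_powr_distrib)

lemma power_msize: "h ^ msize \<alpha> = (\<Prod>i\<in>UNIV. h ^ \<alpha> i)" for h :: real
  unfolding msize_def by (simp add: power_sum)

lemma abs_mpow: "\<bar>mpow y \<alpha>\<bar> = (\<Prod>i\<in>UNIV. \<bar>y $ i\<bar> ^ \<alpha> i)"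
  unfolding mpow_def by (simp add: abs_prod power_abs)

lemma abs_mpow_le:
  fixes y :: "real^'n::finite"
  assumes "h > 0" "p > 0"
  shows "\<bar>mpow y \<alpha>\<bar> \<le> h ^ msize \<alpha> * mfact \<alpha> powr p * exp (p * h powr (- 1 / p) * wt p y)"
proof -
  have "\<bar>mpow y \<alpha>\<bar> \<le> (\<Prod>i\<in>UNIV. h ^ \<alpha> i * fact (\<alpha> i) powr p * exp (p * h powr (- 1 / p) * \<bar>y $ i\<bar> powr (1 / p)))"
    unfolding abs_mpow using assms by (intro prod_mono conjI power_le_fact_powr_mult_exp) auto
  then show ?thesis
    by (simp add: prod.distrib mfact_powr power_msize wt_def sum_distrib_left exp_sum)
qed

text \<open>The exponents are chosen separately in each coordinate and depend on \<open>y\<close>;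
  \<open>h\<close> and \<open>K\<close> do not.\<close>

lemma ex_exp_wt_le_mpow:
  assumes "R > 0" "p > 0"
  obtains h K where "h > 0" "K > 0"
    "\<And>y::real^'n::finite. \<exists>\<alpha>. exp (R * wt p y) * (h ^ msize \<alpha> * mfact \<alpha> powr p) \<le> K * \<bar>mpow y \<alpha>\<bar>"
proof -
  obtain h K where hK: "h > 0" "K > 0"
    "\<And>v. v \<ge> 0 \<Longrightarrow> \<exists>n. exp (R * v powr (1 / p)) * (h ^ n * fact n powr p) \<le> K * v ^ n"
    using ex_exp_powr_le_power[OF assms] by metis
  show ?thesis
  proof (rule that)
    show "h > 0" "K ^ CARD('n) > 0" using hK by auto
    fix y :: "real^'n"
    have "\<exists>\<alpha>. \<forall>i. exp (R * \<bar>y $ i\<bar> powr (1 / p)) * (h ^ \<alpha> i * fact (\<alpha> i) powr p) \<le> K * \<bar>y $ i\<bar> ^ \<alpha> i"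
      using hK(3) by (intro choice) simp
    then obtain \<alpha> where "\<forall>i. exp (R * \<bar>y $ i\<bar> powr (1 / p)) * (h ^ \<alpha> i * fact (\<alpha> i) powr p) \<le> K * \<bar>y $ i\<bar> ^ \<alpha> i"
      by blast
    then have "(\<Prod>i\<in>UNIV. exp (R * \<bar>y $ i\<bar> powr (1 / p)) * (h ^ \<alpha> i * fact (\<alpha> i) powr p)) \<le>
        (\<Prod>i\<in>UNIV. K * \<bar>y $ i\<bar> ^ \<alpha> i)"
      using hK by (intro prod_mono) auto
    then show "\<exists>\<alpha>. exp (R * wt p y) * (h ^ msize \<alpha> * mfact \<alpha> powr p) \<le> K ^ CARD('n) * \<bar>mpow y \<alpha>\<bar>"
      by (auto simp: prod.distrib mfact_powr power_msize wt_def sum_distrib_left exp_sum abs_mpow)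
  qed
qed

text \<open>Separates the size in space, \<open>g\<close>, from the growth in the order of
  differentiation. Every multi-index is the count of some list, so for smooth functions all
  \<open>mderiv\<close> are covered.\<close>

definition gevrey_bound :: "real \<Rightarrow> real \<Rightarrow> (real^'n::finite \<Rightarrow> real) \<Rightarrow> (real^'n \<Rightarrow> complex) \<Rightarrow> bool" where
  "gevrey_bound s h g f \<longleftrightarrow>
    (\<forall>ks y. cmod (pderivs ks f y) \<le> g y * (h ^ length ks * mfact (count_list ks) powr s))"

lemma gevrey_boundD:
  "gevrey_bound s h g f \<Longrightarrow> cmod (pderivs ks f y) \<le> g y * (h ^ length ks * mfact (count_list ks) powr s)"
  unfolding gevrey_bound_def by blast

lemma gevrey_bound_mono:
  assumes "gevrey_bound s h g f" "\<And>y. g y \<le> g' y" "\<And>y. 0 \<le> g' y" "h \<le> h'" "0 \<le> h"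
  shows "gevrey_bound s h' g' f"
  unfolding gevrey_bound_def
proof (intro allI)
  fix ks y
  have "cmod (pderivs ks f y) \<le> g y * (h ^ length ks * mfact (count_list ks) powr s)"
    by (rule gevrey_boundD[OF assms(1)])
  also have "\<dots> \<le> g' y * (h' ^ length ks * mfact (count_list ks) powr s)"
    using assms by (intro mult_mono power_mono) auto
  finally show "cmod (pderivs ks f y) \<le> g' y * (h' ^ length ks * mfact (count_list ks) powr s)" .
qed

lemma mfact_mult_le:
  assumes "(a, b) \<in> set (splits ks)"
  shows "mfact (count_list a) * mfact (count_list b) \<le> mfact (count_list ks)"
proof -
  have "fact m * fact n \<le> (fact (m + n) :: real)" for m n
    using dvd_imp_le[OF fact_fact_dvd_fact[of m n, where 'a = nat]]
    by (metis fact_nonzero gr0I of_nat_fact of_nat_le_iff of_nat_mult)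
  then show ?thesis
    unfolding mfact_def prod.distrib[symmetric] splits_count[OF assms] by (intro prod_mono) auto
qed

lemma norm_sum_list_le: "norm (sum_list xs) \<le> (\<Sum>x\<leftarrow>xs. norm x)" for xs :: "'a::real_normed_vector list"
  by (induction xs) (auto intro: norm_triangle_le)

text \<open>Each Leibniz term obeys the same bound because a product of factorials is at most the
  factorial of the sum; the number \<open>2 ^ length ks\<close> of terms is absorbed by doubling
  \<open>h\<close>.\<close>

lemma gevrey_bound_mult:
  assumes "smooth_fun f1" "smooth_fun f2" "gevrey_bound s h g1 f1" "gevrey_bound s h g2 f2"
    and pos: "\<And>y. 0 \<le> g1 y" "\<And>y. 0 \<le> g2 y" "0 \<le> h" "0 \<le> s"
  shows "gevrey_bound s (2 * h) (\<lambda>y. g1 y * g2 y) (\<lambda>y. f1 y * f2 y)"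
  unfolding gevrey_bound_def
proof (intro allI)
  fix ks :: "'a list" and y :: "real^'a"
  define B where "B = g1 y * g2 y * (h ^ length ks * mfact (count_list ks) powr s)"
  have le: "cmod (pderivs a f1 y * pderivs b f2 y) \<le> B" if ab: "(a, b) \<in> set (splits ks)" for a b
  proof -
    have "cmod (pderivs a f1 y * pderivs b f2 y) \<le>
      (g1 y * (h ^ length a * mfact (count_list a) powr s)) * (g2 y * (h ^ length b * mfact (count_list b) powr s))"
      unfolding norm_mult using pos by (intro mult_mono gevrey_boundD assms) auto
    also have "\<dots> = g1 y * g2 y * (h ^ length ks * (mfact (count_list a) * mfact (count_list b)) powr s)"
      by (simp add: splits_length[OF ab] power_add powr_mult mfact_pos less_imp_le mult_ac)
    also have "\<dots> \<le> B"
      unfolding B_def using pos mfact_mult_le[OF ab] by (intro mult_left_mono powr_mono2) (auto simp: mfact_pos less_imp_le)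
    finally show ?thesis .
  qed
  have "cmod (pderivs ks (\<lambda>y. f1 y * f2 y) y) \<le> (\<Sum>(a, b)\<leftarrow>splits ks. cmod (pderivs a f1 y * pderivs b f2 y))"
    unfolding pderivs_mult[OF assms(1,2)] split_def
    by (rule order_trans[OF norm_sum_list_le]) (simp add: o_def)
  also have "\<dots> \<le> (\<Sum>_\<leftarrow>splits ks. B)"
    using le by (intro sum_list_mono) auto
  also have "\<dots> = g1 y * g2 y * ((2 * h) ^ length ks * mfact (count_list ks) powr s)"
    by (simp add: sum_list_triv length_splits B_def power_mult_distrib mult_ac)
  finally show "cmod (pderivs ks (\<lambda>y. f1 y * f2 y) y) \<le> g1 y * g2 y * ((2 * h) ^ length ks * mfact (count_list ks) powr s)" .
qed

lemma gevrey_bound_add: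
  assumes "smooth_fun f1" "smooth_fun f2" "gevrey_bound s h g1 f1" "gevrey_bound s h g2 f2"
  shows "gevrey_bound s h (\<lambda>y. g1 y + g2 y) (\<lambda>y. f1 y + f2 y)"
  unfolding gevrey_bound_def pderivs_add[OF assms(1,2)]
  using order_trans[OF norm_triangle_ineq add_mono[OF gevrey_boundD[OF assms(3)] gevrey_boundD[OF assms(4)]]]
  by (simp add: distrib_right)

lemma gevrey_bound_cmult:
  assumes "smooth_fun f" "gevrey_bound s h g f"
  shows "gevrey_bound s h (\<lambda>y. cmod c * g y) (\<lambda>y. c * f y)"
  unfolding gevrey_bound_def pderivs_bounded_linear[OF assms(1) bounded_linear_mult_right]
  using mult_left_mono[OF gevrey_boundD[OF assms(2)] norm_ge_zero[of c]]
  by (simp add: norm_mult mult.assoc)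

section \<open>Seminorms, decay at every exponential rate, and the vector space structure\<close>

definition GS_le :: "real \<Rightarrow> real \<Rightarrow> real \<Rightarrow> real \<Rightarrow> (real^'n::finite \<Rightarrow> complex) \<Rightarrow> bool" where
  "GS_le t s h M f \<longleftrightarrow> (\<forall>\<alpha> \<beta> x. \<bar>mpow x \<alpha>\<bar> * cmod (mderiv \<beta> f x)
      \<le> M * (h ^ (msize \<alpha> + msize \<beta>) * mfact \<alpha> powr t * mfact \<beta> powr s))"

lemma GS_seminorm_le_iff:
  assumes "h > 0" "M \<ge> 0"
  shows "GS_seminorm t s h f \<le> ennreal M \<longleftrightarrow> GS_le t s h M f"
proof -
  have "msize (\<lambda>i. \<alpha> i + \<beta> i) = msize \<alpha> + msize \<beta>" for \<alpha> \<beta> :: "('a::finite) mindex"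
    by (simp add: msize_def sum.distrib)
  moreover have "0 < h ^ (msize \<alpha> + msize \<beta>) * mfact \<alpha> powr t * mfact \<beta> powr s" for \<alpha> \<beta> :: "('a::finite) mindex"
    using assms mfact_pos[of \<alpha>] mfact_pos[of \<beta>] by simp
  ultimately show ?thesis
    using assms
    by (auto simp: GS_seminorm_def GS_le_def SUP_le_iff ennreal_le_iff Dop_def norm_mult norm_power pos_divide_le_eq)
qed

lemma GS_seminorm_less_iff:
  assumes "h > 0"
  shows "GS_seminorm t s h f < ennreal \<epsilon> \<longleftrightarrow> (\<exists>M. 0 \<le> M \<and> M < \<epsilon> \<and> GS_le t s h M f)"
proof
  assume L: "GS_seminorm t s h f < ennreal \<epsilon>"
  then obtain M where M: "0 \<le> M" "GS_seminorm t s h f = ennreal M"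
    by (cases "GS_seminorm t s h f") auto
  with L have "M < \<epsilon>" by (simp add: ennreal_less_iff)
  moreover have "GS_le t s h M f" using GS_seminorm_le_iff[OF assms, of M t s f] M by simp
  ultimately show "\<exists>M. 0 \<le> M \<and> M < \<epsilon> \<and> GS_le t s h M f" using M by blast
next
  assume "\<exists>M. 0 \<le> M \<and> M < \<epsilon> \<and> GS_le t s h M f"
  then obtain M where M: "0 \<le> M" "M < \<epsilon>" "GS_le t s h M f" by blast
  then have "GS_seminorm t s h f \<le> ennreal M" using GS_seminorm_le_iff[OF assms] by blast
  also have "\<dots> < ennreal \<epsilon>" using M by (simp add: ennreal_less_iff)
  finally show "GS_seminorm t s h f < ennreal \<epsilon>" .
qed

lemma GS_space_iff:
  "f \<in> GS_space t s \<longleftrightarrow> smooth_fun f \<and> (\<forall>h>0. \<exists>M\<ge>0. GS_le t s h M f)"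
proof -
  have "GS_seminorm t s h f < \<infinity> \<longleftrightarrow> (\<exists>M\<ge>0. GS_le t s h M f)" if "h > 0" for h
  proof
    assume "GS_seminorm t s h f < \<infinity>"
    then obtain M where "0 \<le> M" "GS_seminorm t s h f = ennreal M"
      by (cases "GS_seminorm t s h f") auto
    then show "\<exists>M\<ge>0. GS_le t s h M f" using GS_seminorm_le_iff[OF that, of M t s f] by auto
  next
    assume "\<exists>M\<ge>0. GS_le t s h M f"
    then obtain M where "0 \<le> M" "GS_le t s h M f" by blast
    then show "GS_seminorm t s h f < \<infinity>"
      using GS_seminorm_le_iff[OF that, of M t s f] by (simp add: le_less_trans)
  qed
  then show ?thesis unfolding GS_space_def by auto
qed

lemma GS_le_mono:
  assumes "GS_le t s h M f" "h \<le> h'" "M \<le> M'" "0 < h" "0 \<le> M"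
  shows "GS_le t s h' M' f"
  unfolding GS_le_def
proof (intro allI)
  fix \<alpha> \<beta> :: "'a mindex" and x :: "real^'a"
  have "\<bar>mpow x \<alpha>\<bar> * cmod (mderiv \<beta> f x) \<le> M * (h ^ (msize \<alpha> + msize \<beta>) * mfact \<alpha> powr t * mfact \<beta> powr s)"
    using assms(1) unfolding GS_le_def by blast
  also have "\<dots> \<le> M' * (h' ^ (msize \<alpha> + msize \<beta>) * mfact \<alpha> powr t * mfact \<beta> powr s)"
    using assms by (intro mult_mono power_mono) auto
  finally show "\<bar>mpow x \<alpha>\<bar> * cmod (mderiv \<beta> f x) \<le> M' * (h' ^ (msize \<alpha> + msize \<beta>) * mfact \<alpha> powr t * mfact \<beta> powr s)" .
qed

text \<open>The rate \<open>t * h powr (- 1 / t)\<close> is the one at which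
  \<open>abs_mpow_le\<close> lets monomials grow, so the two exponentials cancel.\<close>

lemma GS_le_if_gevrey_bound:
  assumes f: "smooth_fun f" and h: "h > 0" and t: "t > 0" and M: "M \<ge> 0"
    and b: "gevrey_bound s h (\<lambda>y. M * exp (- (t * h powr (- 1 / t)) * wt t y)) f"
  shows "GS_le t s h M f"
  unfolding GS_le_def
proof (intro allI)
  fix \<alpha> \<beta> :: "'a mindex" and x :: "real^'a"
  obtain ks where \<beta>: "\<beta> = count_list ks" using ex_count_list[of \<beta>] by auto
  let ?c = "t * h powr (- 1 / t)"
  have "\<bar>mpow x \<alpha>\<bar> * cmod (mderiv \<beta> f x) \<le> (h ^ msize \<alpha> * mfact \<alpha> powr t * exp (?c * wt t x)) *
      (M * exp (- ?c * wt t x) * (h ^ msize \<beta> * mfact \<beta> powr s))"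
    unfolding \<beta> mderiv_eq_pderivs[OF f] msize_count_list
    by (intro mult_mono abs_mpow_le gevrey_boundD[OF b] h t) (use h in auto)
  also have "\<dots> = M * (h ^ (msize \<alpha> + msize \<beta>) * mfact \<alpha> powr t * mfact \<beta> powr s)"
    by (simp add: exp_minus field_simps power_add)
  finally show "\<bar>mpow x \<alpha>\<bar> * cmod (mderiv \<beta> f x) \<le> M * (h ^ (msize \<alpha> + msize \<beta>) * mfact \<alpha> powr t * mfact \<beta> powr s)" .
qed

text \<open>A seminorm bounds all monomials at once, so at each \<open>y\<close> it may be used with
  an \<open>\<alpha>\<close> whose monomial dominates the exponential. The scale \<open>k\<close>
  has to serve the weight (\<open>h1\<close>) as well as the derivatives (\<open>h\<close>), hence
  the minimum.\<close>

lemma GS_spaceD_bound: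
  fixes f :: "real^'n::finite \<Rightarrow> complex"
  assumes f: "f \<in> GS_space t s" and "h > 0" "R > 0" "t > 0"
  obtains M where "M \<ge> 0" "gevrey_bound s h (\<lambda>y. M * exp (- R * wt t y)) f"
proof -
  obtain h1 K where hK: "h1 > 0" "K > 0"
    "\<And>y::real^'n. \<exists>\<alpha>. exp (R * wt t y) * (h1 ^ msize \<alpha> * mfact \<alpha> powr t) \<le> K * \<bar>mpow y \<alpha>\<bar>"
    using ex_exp_wt_le_mpow[OF \<open>R > 0\<close> \<open>t > 0\<close>] by metis
  define k where "k = min h h1"
  have k: "0 < k" "k \<le> h" "k \<le> h1" using hK \<open>h > 0\<close> by (auto simp: k_def)
  have sm: "smooth_fun f" using f GS_space_iff by blast
  obtain M where M: "M \<ge> 0" "GS_le t s k M f" using f k GS_space_iff by blast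
  have "gevrey_bound s h (\<lambda>y. (K * M) * exp (- R * wt t y)) f"
    unfolding gevrey_bound_def
  proof (intro allI)
    fix ks :: "'n list" and y :: "real^'n"
    obtain \<alpha> where \<alpha>: "exp (R * wt t y) * (h1 ^ msize \<alpha> * mfact \<alpha> powr t) \<le> K * \<bar>mpow y \<alpha>\<bar>"
      using hK(3) by blast
    define a where "a = h1 ^ msize \<alpha> * mfact \<alpha> powr t"
    have a: "a > 0" unfolding a_def using hK mfact_pos[of \<alpha>] by simp
    let ?L = "cmod (pderivs ks f y)" and ?b = "h ^ length ks * mfact (count_list ks) powr s"
    have "exp (R * wt t y) * a * ?L \<le> K * \<bar>mpow y \<alpha>\<bar> * ?L"
      unfolding a_def by (rule mult_right_mono[OF \<alpha>]) simp
    also have "\<dots> = K * (\<bar>mpow y \<alpha>\<bar> * cmod (mderiv (count_list ks) f y))"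
      by (simp add: mderiv_eq_pderivs[OF sm])
    also have "\<dots> \<le> K * (M * (k ^ (msize \<alpha> + length ks) * mfact \<alpha> powr t * mfact (count_list ks) powr s))"
      using M(2) hK unfolding GS_le_def msize_count_list[symmetric] by (intro mult_left_mono) auto
    also have "\<dots> = K * (M * ((k ^ msize \<alpha> * mfact \<alpha> powr t) * (k ^ length ks * mfact (count_list ks) powr s)))"
      by (simp add: power_add mult_ac)
    also have "\<dots> \<le> K * (M * (a * ?b))"
      unfolding a_def using hK M k by (intro mult_left_mono mult_mono power_mono) auto
    finally have "a * (exp (R * wt t y) * ?L) \<le> a * (K * M * ?b)" by (simp add: mult_ac)
    then have "exp (R * wt t y) * ?L \<le> K * M * ?b" using a by simp
    then show "?L \<le> K * M * exp (- R * wt t y) * ?b"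
      by (simp add: exp_minus field_simps)
  qed
  then show ?thesis using that[of "K * M"] M hK by simp
qed

lemma GS_spaceI_bound:
  assumes "smooth_fun f" "t > 0"
    and "\<And>h R. h > 0 \<Longrightarrow> R > 0 \<Longrightarrow> \<exists>M\<ge>0. gevrey_bound s h (\<lambda>y. M * exp (- R * wt t y)) f"
  shows "f \<in> GS_space t s"
  unfolding GS_space_iff
proof (intro conjI allI impI assms(1))
  fix h :: real assume h: "h > 0"
  then have "t * h powr (- 1 / t) > 0" using assms(2) by simp
  then show "\<exists>M\<ge>0. GS_le t s h M f"
    using assms(3)[OF h, of "t * h powr (- 1 / t)"] GS_le_if_gevrey_bound[OF assms(1) h assms(2)] by blast
qed

lemma GS_space_smooth: "f \<in> GS_space t s \<Longrightarrow> smooth_fun f"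
  unfolding GS_space_def by blast

lemma GS_space_cmult:
  assumes "f \<in> GS_space t s" "t > 0"
  shows "(\<lambda>x. c * f x) \<in> GS_space t s"
proof (rule GS_spaceI_bound[OF _ assms(2)])
  note f = GS_space_smooth[OF assms(1)]
  show "smooth_fun (\<lambda>x. c * f x)"
    by (rule smooth_fun_bounded_linear[OF f bounded_linear_mult_right])
  fix h R :: real assume "h > 0" "R > 0"
  then obtain M where "M \<ge> 0" "gevrey_bound s h (\<lambda>y. M * exp (- R * wt t y)) f"
    by (rule GS_spaceD_bound[OF assms(1) _ _ assms(2)])
  with gevrey_bound_cmult[OF f this(2), of c]
  show "\<exists>M\<ge>0. gevrey_bound s h (\<lambda>y. M * exp (- R * wt t y)) (\<lambda>x. c * f x)"
    by (intro exI[of _ "cmod c * M"]) (simp add: mult.assoc)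
qed

lemma GS_space_add:
  assumes "f \<in> GS_space t s" "g \<in> GS_space t s" "t > 0"
  shows "(\<lambda>x. f x + g x) \<in> GS_space t s"
proof (rule GS_spaceI_bound[OF _ assms(3)])
  note f = GS_space_smooth[OF assms(1)] and g = GS_space_smooth[OF assms(2)]
  show "smooth_fun (\<lambda>x. f x + g x)"
    by (rule smooth_fun_add[OF f g])
  fix h R :: real assume "h > 0" "R > 0"
  obtain M where M: "M \<ge> 0" "gevrey_bound s h (\<lambda>y. M * exp (- R * wt t y)) f"
    by (rule GS_spaceD_bound[OF assms(1) \<open>h > 0\<close> \<open>R > 0\<close> assms(3)])
  obtain N where N: "N \<ge> 0" "gevrey_bound s h (\<lambda>y. N * exp (- R * wt t y)) g"
    by (rule GS_spaceD_bound[OF assms(2) \<open>h > 0\<close> \<open>R > 0\<close> assms(3)])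
  from gevrey_bound_add[OF f g M(2) N(2)] M(1) N(1)
  show "\<exists>M\<ge>0. gevrey_bound s h (\<lambda>y. M * exp (- R * wt t y)) (\<lambda>x. f x + g x)"
    by (intro exI[of _ "M + N"]) (simp add: algebra_simps)
qed

lemma pderivs_zero: "pderivs ks (\<lambda>x. 0) = (\<lambda>x. 0)"
  by (induction ks) (auto simp: partial_deriv_def)

lemma GS_space_zero:
  assumes "t > 0" shows "(\<lambda>x. 0) \<in> GS_space t s"
proof (rule GS_spaceI_bound[OF _ assms])
  show "smooth_fun (\<lambda>x. 0)" by (simp add: smooth_fun_def pderivs_zero)
  show "\<exists>M\<ge>0. gevrey_bound s h (\<lambda>y. M * exp (- R * wt t y)) (\<lambda>x. 0)" for h R
    by (rule exI[of _ 0]) (simp add: gevrey_bound_def pderivs_zero)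
qed

lemma GS_le_diff:
  assumes f: "smooth_fun f" and g: "smooth_fun g"
    and "GS_le t s h M f" "GS_le t s h N (\<lambda>x. 0 - g x)"
  shows "GS_le t s h (M + N) (\<lambda>x. f x - g x)"
  unfolding GS_le_def
proof (intro allI)
  fix \<alpha> \<beta> :: "'a mindex" and x :: "real^'a"
  obtain ks where \<beta>: "\<beta> = count_list ks" using ex_count_list[of \<beta>] by auto
  have g': "smooth_fun (\<lambda>x. 0 - g x)"
    using smooth_fun_bounded_linear[OF g bounded_linear_minus[OF bounded_linear_ident]] by simp
  have eq: "(\<lambda>x. f x - g x) = (\<lambda>x. f x + (0 - g x))" by simp
  have "mderiv \<beta> (\<lambda>x. f x - g x) x = mderiv \<beta> f x + mderiv \<beta> (\<lambda>x. 0 - g x) x"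
    unfolding \<beta> mderiv_eq_pderivs[OF f] mderiv_eq_pderivs[OF g'] mderiv_eq_pderivs[OF smooth_fun_diff[OF f g]]
    unfolding eq pderivs_add[OF f g'] ..
  then have "\<bar>mpow x \<alpha>\<bar> * cmod (mderiv \<beta> (\<lambda>x. f x - g x) x) \<le>
      \<bar>mpow x \<alpha>\<bar> * cmod (mderiv \<beta> f x) + \<bar>mpow x \<alpha>\<bar> * cmod (mderiv \<beta> (\<lambda>x. 0 - g x) x)"
    by (metis abs_ge_zero distrib_left mult_left_mono norm_triangle_ineq)
  also have "\<dots> \<le> (M + N) * (h ^ (msize \<alpha> + msize \<beta>) * mfact \<alpha> powr t * mfact \<beta> powr s)"
    using assms(3,4) unfolding GS_le_def by (simp add: distrib_right add_mono)
  finally show "\<bar>mpow x \<alpha>\<bar> * cmod (mderiv \<beta> (\<lambda>x. f x - g x) x) \<le>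
      (M + N) * (h ^ (msize \<alpha> + msize \<beta>) * mfact \<alpha> powr t * mfact \<beta> powr s)" .
qed

section \<open>Continuity of a functional as a single seminorm estimate\<close>

lemma GS_topology_nhds_zero:
  fixes W :: "(real^'n::finite \<Rightarrow> complex) set"
  assumes "openin (GS_topology t s) W" "(\<lambda>x. 0) \<in> W"
  obtains h \<epsilon> where "h > 0" "\<epsilon> > 0"
    "\<And>f M. f \<in> GS_space t s \<Longrightarrow> 0 \<le> M \<Longrightarrow> M < \<epsilon> \<Longrightarrow> GS_le t s h M f \<Longrightarrow> f \<in> W"
proof -
  let ?P = "\<lambda>W :: (real^'n \<Rightarrow> complex) set. \<exists>h \<epsilon>. h > 0 \<and> \<epsilon> > 0 \<and> (\<forall>f M. f \<in> GS_space t s \<longrightarrow> 0 \<le> M \<longrightarrow> M < \<epsilon> \<longrightarrow> GS_le t s h M f \<longrightarrow> f \<in> W)"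
  from assms have "generate_topology_on
     {{f \<in> GS_space t s. GS_seminorm t s h (\<lambda>x. f x - g x) < ennreal \<epsilon>} |(g :: real^'n \<Rightarrow> complex) h \<epsilon>.
        g \<in> GS_space t s \<and> h > 0 \<and> \<epsilon> > 0} W"
    unfolding GS_topology_def by (rule_tac openin_topology_generated_by)
  then have "(\<lambda>x. 0) \<in> W \<longrightarrow> ?P W"
  proof induction
    case (Int A B)
    show ?case
    proof
      assume "(\<lambda>x. 0) \<in> A \<inter> B"
      then have "?P A" "?P B" using Int.IH by simp_all
      then obtain h1 \<epsilon>1 h2 \<epsilon>2 where *: "h1 > 0" "\<epsilon>1 > 0" "h2 > 0" "\<epsilon>2 > 0"
        "\<And>f M. f \<in> GS_space t s \<Longrightarrow> 0 \<le> M \<Longrightarrow> M < \<epsilon>1 \<Longrightarrow> GS_le t s h1 M f \<Longrightarrow> f \<in> A"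
        "\<And>f M. f \<in> GS_space t s \<Longrightarrow> 0 \<le> M \<Longrightarrow> M < \<epsilon>2 \<Longrightarrow> GS_le t s h2 M f \<Longrightarrow> f \<in> B"
        by metis
      \<comment> \<open>A smaller \<open>h\<close> gives a larger seminorm, so the minimum of the
        two scales controls both.\<close>
      show "?P (A \<inter> B)"
      proof (intro exI conjI allI impI)
        show "min h1 h2 > 0" "min \<epsilon>1 \<epsilon>2 > 0" using * by auto
        fix f :: "real^'n \<Rightarrow> complex" and M assume f: "f \<in> GS_space t s" "0 \<le> M" "M < min \<epsilon>1 \<epsilon>2" "GS_le t s (min h1 h2) M f"
        have "GS_le t s h1 M f" "GS_le t s h2 M f"
          using * f by (auto intro!: GS_le_mono[OF f(4)])
        with f * show "f \<in> A \<inter> B" by auto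
      qed
    qed
  next
    case (UN K)
    show ?case
    proof
      assume "(\<lambda>x. 0) \<in> \<Union>K"
      then obtain k where k: "k \<in> K" "(\<lambda>x. 0) \<in> k" by blast
      with UN.IH obtain h \<epsilon> where *: "h > 0" "\<epsilon> > 0"
        "\<And>f M. f \<in> GS_space t s \<Longrightarrow> 0 \<le> M \<Longrightarrow> M < \<epsilon> \<Longrightarrow> GS_le t s h M f \<Longrightarrow> f \<in> k"
        by metis
      show "?P (\<Union>K)"
        by (intro exI[of _ h] exI[of _ \<epsilon>] conjI allI impI UnionI[OF k(1)] *)
    qed
  next
    case (Basis S)
    then obtain g h \<epsilon> where S: "S = {f \<in> GS_space t s. GS_seminorm t s h (\<lambda>x. f x - g x) < ennreal \<epsilon>}"
      "g \<in> GS_space t s" "h > 0" "\<epsilon> > 0" by blast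
    show ?case
    proof
      assume "(\<lambda>x. 0) \<in> S"
      then obtain N where N: "0 \<le> N" "N < \<epsilon>" "GS_le t s h N (\<lambda>x. 0 - g x)"
        unfolding S(1) GS_seminorm_less_iff[OF S(3)] by blast
      \<comment> \<open>The generating balls are centred anywhere. If 0 is at distance at most
        \<open>N < \<epsilon>\<close> from \<open>g\<close>, the ball of radius
        \<open>\<epsilon> - N\<close> around 0 lies inside.\<close>
      show "?P S"
      proof (intro exI conjI allI impI)
        show "h > 0" "\<epsilon> - N > 0" using S N by auto
        fix f :: "real^'n \<Rightarrow> complex" and M assume f: "f \<in> GS_space t s" "0 \<le> M" "M < \<epsilon> - N" "GS_le t s h M f"
        have "GS_le t s h (M + N) (\<lambda>x. f x - g x)"
          using GS_le_diff f S N GS_space_smooth by blast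
        then show "f \<in> S"
          unfolding S(1) GS_seminorm_less_iff[OF S(3)] mem_Collect_eq
          using f N by (intro conjI exI[of _ "M + N"]) auto
      qed
    qed
  qed simp
  with assms(2) show ?thesis using that by blast
qed

text \<open>Continuity at 0 gives a neighbourhood on which \<open>cmod (u f) < 1\<close>, and
  scaling does the rest. Exponential weights in the hypothesis spare later estimates any mention of
  seminorms.\<close>

lemma GS_dual_bound:
  fixes u :: "(real^'n::finite \<Rightarrow> complex) \<Rightarrow> complex"
  assumes u: "u \<in> GS_dual t s" and t: "t > 0"
  obtains h R C where "h > 0" "R > 0" "C \<ge> 0"
    "\<And>f M. f \<in> GS_space t s \<Longrightarrow> 0 \<le> M \<Longrightarrow> gevrey_bound s h (\<lambda>y. M * exp (- R * wt t y)) f \<Longrightarrow> cmod (u f) \<le> C * M"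
proof -
  have u_mult: "\<And>\<phi> c. \<phi> \<in> GS_space t s \<Longrightarrow> u (\<lambda>x. c * \<phi> x) = cnj c * u \<phi>"
    and cont: "continuous_map (GS_topology t s) euclidean u"
    using u unfolding GS_dual_def by blast+
  have top: "topspace (GS_topology t s) = (GS_space t s :: (real^'n \<Rightarrow> complex) set)"
  proof
    show "GS_space t s \<subseteq> topspace (GS_topology t s :: (real^'n \<Rightarrow> complex) topology)"
    proof
      fix f :: "real^'n \<Rightarrow> complex" assume f: "f \<in> GS_space t s"
      have "GS_le t s 1 0 (\<lambda>x::real^'n. 0)"
        using GS_space_smooth[OF GS_space_zero[OF t, where 'a = 'n and s = s]] t
        by (intro GS_le_if_gevrey_bound) (auto simp: gevrey_bound_def pderivs_zero)
      then have "GS_seminorm t s 1 (\<lambda>x. f x - f x) < ennreal 1"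
        by (subst GS_seminorm_less_iff) (auto intro!: exI[of _ 0])
      with f show "f \<in> topspace (GS_topology t s)"
        unfolding GS_topology_def topology_generated_by_topspace
        by (intro UnionI[of "{g \<in> GS_space t s. GS_seminorm t s 1 (\<lambda>x. g x - f x) < ennreal 1}"])
           (blast intro: zero_less_one, simp)
    qed
  qed (auto simp: GS_topology_def)
  have "openin (GS_topology t s) {f \<in> topspace (GS_topology t s). u f \<in> ball 0 1}"
    using cont by (rule openin_continuous_map_preimage) (simp flip: open_openin)
  moreover have "(\<lambda>x. 0) \<in> {f \<in> topspace (GS_topology t s). u f \<in> ball 0 1}"
    using u_mult[OF GS_space_zero[OF t], of 0] GS_space_zero[OF t] by (simp add: top)
  ultimately obtain h \<epsilon> where h: "h > 0" and \<epsilon>: "\<epsilon> > 0" and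
    W: "\<And>f M. f \<in> GS_space t s \<Longrightarrow> 0 \<le> M \<Longrightarrow> M < \<epsilon> \<Longrightarrow> GS_le t s h M f \<Longrightarrow> cmod (u f) < 1"
    by (rule GS_topology_nhds_zero) auto
  show ?thesis
  proof (rule that)
    show "h > 0" "t * h powr (- 1 / t) > 0" "2 / \<epsilon> \<ge> 0" using h \<epsilon> t by auto
    fix f :: "real^'n \<Rightarrow> complex" and M assume f: "f \<in> GS_space t s" and M: "0 \<le> (M::real)"
      and b: "gevrey_bound s h (\<lambda>y. M * exp (- (t * h powr (- 1 / t)) * wt t y)) f"
    show "cmod (u f) \<le> 2 / \<epsilon> * M"
    proof (rule field_le_epsilon)
      fix e :: real assume e: "e > 0"
      \<comment> \<open>\<open>M\<close> may be 0, so the scaling factor is formed with a slightly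
        larger \<open>N\<close>; this costs exactly the arbitrary \<open>e\<close>.\<close>
      define N where "N = M + e * \<epsilon> / 2"
      have N: "N > 0" "M \<le> N" using M e \<epsilon> by (auto simp: N_def add_nonneg_pos)
      define c where "c = \<epsilon> / (2 * N)"
      have c: "c > 0" using N \<epsilon> by (simp add: c_def)
      let ?g = "\<lambda>x. complex_of_real c * f x"
      have "gevrey_bound s h (\<lambda>y. (c * M) * exp (- (t * h powr (- 1 / t)) * wt t y)) ?g"
        using gevrey_bound_cmult[OF GS_space_smooth[OF f] b, of "complex_of_real c"] c by (simp add: mult.assoc)
      then have "GS_le t s h (c * M) ?g"
        using c M h t GS_space_smooth[OF GS_space_cmult[OF f t]] by (intro GS_le_if_gevrey_bound) auto
      moreover have "c * M < \<epsilon>"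
        using N \<epsilon> M by (simp add: c_def field_simps)
      ultimately have "cmod (u ?g) < 1"
        using c M by (intro W[OF GS_space_cmult[OF f t]]) auto
      then have "c * cmod (u f) < 1"
        using u_mult[OF f, of "complex_of_real c"] c by (simp add: norm_mult)
      then have "cmod (u f) \<le> 2 / \<epsilon> * N"
        using N \<epsilon> by (simp add: c_def field_simps)
      also have "\<dots> = 2 / \<epsilon> * M + e" using \<epsilon> by (simp add: N_def field_simps)
      finally show "cmod (u f) \<le> 2 / \<epsilon> * M + e" .
    qed
  qed
qed

section \<open>A compactly supported Gevrey function\<close>

text \<open>The root of order \<open>p\<close> of \<open>v ^ n \<le> fact n * exp v\<close> at
  \<open>v = p * \<kappa> ^ p / 2\<close>. Since \<open>p \<ge> 2\<close>, this \<open>v\<close> is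
  at least \<open>\<kappa> ^ p\<close>, and the root of its exponential is
  \<open>exp (\<kappa> ^ p / 2)\<close>.\<close>

lemma power_mult_exp_le_fact_root:
  fixes \<kappa> :: real assumes "\<kappa> > 0" "p \<ge> 2"
  shows "\<kappa> ^ n * exp (- (\<kappa> ^ p / 2)) \<le> fact n powr (1 / real p)"
proof -
  let ?v = "\<kappa> ^ p"
  have "?v ^ n \<le> (real p * ?v / 2) ^ n"
    using assms by (intro power_mono) (auto simp: field_simps)
  also have "\<dots> \<le> fact n * exp (real p * ?v / 2)"
    using assms by (intro power_le_fact_mult_exp) auto
  finally have "(?v ^ n) powr (1 / real p) \<le> (fact n * exp (real p * ?v / 2)) powr (1 / real p)"
    using assms by (intro powr_mono2) auto
  moreover have "(?v ^ n) powr (1 / real p) = \<kappa> ^ n"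
    using assms by (simp add: powr_powr flip: powr_realpow)
  ultimately have "\<kappa> ^ n \<le> fact n powr (1 / real p) * exp (\<kappa> ^ p / 2)"
    using assms by (simp add: powr_mult exp_powr_real)
  then show ?thesis by (simp add: exp_minus field_simps)
qed

text \<open>On the disc of radius \<open>\<theta> * (1 - \<bar>x\<bar>)\<close> about
  \<open>x\<close> one has \<open>1 - z^2 = (1 - x^2) * v\<close> with \<open>v\<close> close to 1.
  Hence the real part of \<open>1 / (1 - z^2)^p\<close> keeps at least half of its value at
  \<open>x\<close>, and \<open>F\<close> stays small on the whole disc.\<close>

lemma higher_deriv_exp_bump_bound:
  fixes p :: nat
  assumes p: "p \<ge> 2"
  defines "F \<equiv> \<lambda>z :: complex. exp (- 1 / (1 - z\<^sup>2) ^ p)"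
  obtains \<theta> where "0 < \<theta>" "\<And>n x. \<bar>x\<bar> < 1 \<Longrightarrow>
    cmod ((deriv ^^ n) F (of_real x)) \<le> fact n * (2 / \<theta>) ^ n * ((1 / (1 - x\<^sup>2)) ^ n * exp (- ((1 / (1 - x\<^sup>2)) ^ p / 2)))"
proof -
  have "isCont (\<lambda>v :: complex. 1 / v ^ p) 1"
    by (intro continuous_intros) auto
  then obtain \<delta> where \<delta>: "\<delta> > 0" "\<And>v :: complex. dist v 1 < \<delta> \<Longrightarrow> dist (1 / v ^ p) (1 / 1 ^ p) < 1 / 2"
    unfolding continuous_at_eps_delta by (metis half_gt_zero_iff zero_less_one)
  \<comment> \<open>Below, \<open>v - 1\<close> has modulus at most
    \<open>2 * \<theta> + \<theta> ^ 2 < 4 * \<theta>\<close>; this has to stay below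
    \<open>\<delta>\<close>, and below 1 so that \<open>v \<noteq> 0\<close>.\<close>
  define \<theta> where "\<theta> = min (1 / 4) (\<delta> / 4)"
  have \<theta>: "\<theta> > 0" "\<theta> \<le> 1 / 4" "4 * \<theta> \<le> \<delta>" using \<delta> by (auto simp: \<theta>_def)
  show ?thesis
  proof (rule that[OF \<theta>(1)])
    fix n and x :: real assume x: "\<bar>x\<bar> < 1"
    define q where "q = 1 - x\<^sup>2"
    define r where "r = \<theta> * (1 - \<bar>x\<bar>)"
    have q: "q > 0" unfolding q_def using x by (simp add: abs_square_less_1)
    have r: "r > 0" unfolding r_def using x \<theta> by simp
    have qr: "\<theta> * q / 2 \<le> r"
    proof -
      have "q = (1 - \<bar>x\<bar>) * (1 + \<bar>x\<bar>)" by (simp add: q_def algebra_simps power2_eq_square)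
      also have "\<dots> \<le> (1 - \<bar>x\<bar>) * 2" using x by (intro mult_left_mono) auto
      finally show ?thesis unfolding r_def using \<theta> by simp
    qed
    have key: "1 - z\<^sup>2 \<noteq> 0 \<and> cmod (F z) \<le> exp (- ((1 / q) ^ p / 2))" if z: "z \<in> cball (of_real x) r" for z
    proof -
      define \<omega> where "\<omega> = z - of_real x"
      \<comment> \<open>Relative perturbations of the factors of
        \<open>1 - z^2 = (1 - z) * (1 + z)\<close>. Both are at most \<open>\<theta>\<close>, as
        \<open>1 - \<bar>x\<bar>\<close> is the smaller of the distances from \<open>x\<close> to 1
        and -1.\<close>
      define w1 where "w1 = - \<omega> / of_real (1 - x)"
      define w2 where "w2 = \<omega> / of_real (1 + x)"
      define v where "v = (1 + w1) * (1 + w2)"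
      have \<omega>: "cmod \<omega> \<le> \<theta> * (1 - \<bar>x\<bar>)" using z by (simp add: \<omega>_def r_def dist_norm norm_minus_commute)
      have "cmod \<omega> \<le> \<theta> * \<bar>1 - x\<bar>" "cmod \<omega> \<le> \<theta> * \<bar>1 + x\<bar>"
        using x \<theta> by (auto intro!: order_trans[OF \<omega>] mult_left_mono)
      then have w: "cmod w1 \<le> \<theta>" "cmod w2 \<le> \<theta>"
        using x by (auto simp: w1_def w2_def norm_divide divide_le_eq simp del: of_real_diff of_real_add)
      have nz: "complex_of_real (1 - x) \<noteq> 0" "complex_of_real (1 + x) \<noteq> 0"
        using x by (simp_all only: of_real_eq_0_iff)
      have "of_real (1 - x) * (1 + w1) = of_real (1 - x) - \<omega>" "of_real (1 + x) * (1 + w2) = of_real (1 + x) + \<omega>"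
        unfolding w1_def w2_def distrib_left by (simp_all only: times_divide_eq_right nonzero_mult_div_cancel_left[OF nz(1)] nonzero_mult_div_cancel_left[OF nz(2)]) simp_all
      then have "1 - z\<^sup>2 = (of_real (1 - x) * (1 + w1)) * (of_real (1 + x) * (1 + w2))"
        by (simp only:) (simp add: \<omega>_def algebra_simps power2_eq_square)
      also have "\<dots> = of_real q * v"
        by (simp add: v_def q_def algebra_simps power2_eq_square)
      finally have zq: "1 - z\<^sup>2 = of_real q * v" .
      have "cmod (v - 1) = cmod (w1 + w2 + w1 * w2)" by (simp add: v_def algebra_simps)
      also have "\<dots> \<le> \<theta> + \<theta> + \<theta> * \<theta>"
        using w \<theta> by (intro order_trans[OF norm_triangle_ineq] add_mono) (auto simp: norm_mult intro!: mult_mono)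
      also have "\<dots> < 4 * \<theta>" using \<theta> mult_strict_right_mono[of \<theta> 1 \<theta>] by simp
      finally have "dist v 1 < 4 * \<theta>" by (simp add: dist_norm)
      with \<theta> have v: "dist v 1 < \<delta>" "dist v 1 < 1" by auto
      then have v0: "v \<noteq> 0" by auto
      have "cmod (1 / v ^ p - 1) < 1 / 2" using \<delta>(2)[OF v(1)] by (simp add: dist_norm)
      then have "Re (1 / v ^ p) \<ge> 1 / 2"
        using abs_Re_le_cmod[of "1 / v ^ p - 1"] by simp
      then have "(1 / q) ^ p * (1 / 2) \<le> (1 / q) ^ p * Re (1 / v ^ p)"
        using q by (intro mult_left_mono) auto
      also have "\<dots> = Re (of_real ((1 / q) ^ p) * (1 / v ^ p))"
        by (simp only: scaleR_conv_of_real[symmetric] scaleR_complex.simps)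
      also have "of_real ((1 / q) ^ p) * (1 / v ^ p) = 1 / (1 - z\<^sup>2) ^ p"
        by (simp add: zq power_mult_distrib power_divide)
      finally have "cmod (F z) \<le> exp (- ((1 / q) ^ p / 2))"
        by (simp add: F_def)
      with zq q v0 show ?thesis by simp
    qed
    have hol: "F holomorphic_on cball (of_real x) r"
      unfolding F_def using key by (intro holomorphic_intros) auto
    have "cmod ((deriv ^^ n) F (of_real x)) \<le> fact n * exp (- ((1 / q) ^ p / 2)) / r ^ n"
    proof (rule Cauchy_inequality)
      show "F holomorphic_on ball (of_real x) r" using hol holomorphic_on_subset ball_subset_cball by blast
      show "continuous_on (cball (of_real x) r) F" using hol holomorphic_on_imp_continuous_on by blast
      show "cmod (F z) \<le> exp (- ((1 / q) ^ p / 2))" if "cmod (of_real x - z) = r" for z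
        using key[of z] that by (simp add: dist_norm)
    qed (rule r)
    also have "\<dots> \<le> fact n * exp (- ((1 / q) ^ p / 2)) / (\<theta> * q / 2) ^ n"
      using qr q \<theta> r by (intro divide_left_mono power_mono mult_pos_pos zero_less_power) auto
    also have "\<dots> = fact n * (2 / \<theta>) ^ n * ((1 / q) ^ n * exp (- ((1 / q) ^ p / 2)))"
      by (simp add: power_divide power_mult_distrib field_simps)
    finally show "cmod ((deriv ^^ n) F (of_real x)) \<le>
        fact n * (2 / \<theta>) ^ n * ((1 / (1 - x\<^sup>2)) ^ n * exp (- ((1 / (1 - x\<^sup>2)) ^ p / 2)))"
      by (simp add: q_def)
  qed
qed

text \<open>The derivatives of \<open>exp (- 1 / (1 - x\<^sup>2)\<^sup>p)\<close> on \<open>(-1, 1)\<close>, extended by zero.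
  Cauchy's inequality on discs of radius proportional to the distance to \<open>\<plusminus> 1\<close> shows Gevrey order \<open>1 + 1/p\<close>.\<close>

lemma ex_gevrey_bump:
  fixes s :: real assumes s: "s > 1"
  obtains B where "jet B" "\<And>n x. \<bar>x\<bar> \<ge> 1 \<Longrightarrow> B n x = 0" "B 0 0 \<noteq> 0"
    "\<And>h. h > 0 \<Longrightarrow> \<exists>C>0. \<forall>n x. cmod (B n x) \<le> C * (h ^ n * fact n powr s)"
proof -
  \<comment> \<open>The strict inequality \<open>1 / p < s - 1\<close> leaves a margin beyond the
    order \<open>1 + 1 / p\<close>, from which every \<open>h\<close> is reached. The summand 2
    secures \<open>p \<ge> 2\<close>.\<close>
  obtain p0 :: nat where p0: "1 / (s - 1) < real p0" using reals_Archimedean2 by blast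
  define p where "p = p0 + 2"
  have p: "p \<ge> 2" "1 / real p < s - 1"
  proof -
    have "1 / (s - 1) < real p" using p0 by (simp add: p_def)
    then show "1 / real p < s - 1" using s by (simp add: p_def field_simps)
  qed (simp add: p_def)
  define F where "F = (\<lambda>z :: complex. exp (- 1 / (1 - z\<^sup>2) ^ p))"
  obtain \<theta> where \<theta>: "0 < \<theta>" and bound: "\<And>n x. \<bar>x\<bar> < 1 \<Longrightarrow>
    cmod ((deriv ^^ n) F (of_real x)) \<le> fact n * (2 / \<theta>) ^ n * ((1 / (1 - x\<^sup>2)) ^ n * exp (- ((1 / (1 - x\<^sup>2)) ^ p / 2)))"
    unfolding F_def using higher_deriv_exp_bump_bound[OF p(1)] by metis
  define B where "B n x = (if \<bar>x\<bar> < 1 then (deriv ^^ n) F (of_real x) else 0)" for n and x :: real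
  have q: "1 - x\<^sup>2 > 0" if "\<bar>x\<bar> < 1" for x :: real using that by (simp add: abs_square_less_1)
  have hol: "F holomorphic_on {z. z\<^sup>2 \<noteq> 1}"
    unfolding F_def by (intro holomorphic_intros) auto
  have op: "open {z :: complex. z\<^sup>2 \<noteq> 1}" by (intro open_Collect_neq continuous_intros)
  show ?thesis
  proof (rule that)
    show "B n x = 0" if "\<bar>x\<bar> \<ge> 1" for n x using that by (simp add: B_def)
    show "B 0 0 \<noteq> 0" by (simp add: B_def F_def)
    show "\<exists>C>0. \<forall>n x. cmod (B n x) \<le> C * (h ^ n * fact n powr s)" if h: "h > 0" for h
    proof -
      \<comment> \<open>The margin: for every \<open>h\<close> the geometric factor
        \<open>(2 / \<theta>) ^ n\<close> is at most a constant times
        \<open>h ^ n * fact n powr \<sigma>\<close>.\<close>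
      define \<sigma> where "\<sigma> = s - 1 - 1 / real p"
      define C where "C = exp (\<sigma> * h powr (- 1 / \<sigma>) * (2 / \<theta>) powr (1 / \<sigma>))"
      have \<sigma>: "\<sigma> > 0" using p by (simp add: \<sigma>_def)
      have "cmod (B n x) \<le> C * (h ^ n * fact n powr s)" for n x
      proof (cases "\<bar>x\<bar> < 1")
        case True
        let ?k = "1 / (1 - x\<^sup>2)"
        have k: "?k ^ n * exp (- (?k ^ p / 2)) \<le> fact n powr (1 / real p)"
          using q[OF True] by (intro power_mult_exp_le_fact_root p) simp
        have "cmod (B n x) \<le> fact n * (2 / \<theta>) ^ n * (?k ^ n * exp (- (?k ^ p / 2)))"
          using bound[OF True, of n] True unfolding B_def by simp
        also have "\<dots> \<le> fact n * (2 / \<theta>) ^ n * fact n powr (1 / real p)"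
          using \<theta> by (intro mult_left_mono[OF k]) auto
        also have "\<dots> \<le> fact n * (h ^ n * fact n powr \<sigma> * C) * fact n powr (1 / real p)"
          unfolding C_def using power_le_fact_powr_mult_exp[OF _ h \<sigma>, of "2 / \<theta>" n] \<theta> h
          by (intro mult_mono) auto
        also have "\<dots> = C * (h ^ n * (fact n powr 1 * fact n powr \<sigma> * fact n powr (1 / real p)))"
          by simp
        also have "fact n powr 1 * fact n powr \<sigma> * fact n powr (1 / real p) = fact n powr s"
          unfolding powr_add[symmetric] by (simp add: \<sigma>_def)
        finally show ?thesis .
      qed (use h in \<open>simp add: B_def C_def\<close>)
      then show ?thesis by (intro exI[of _ C]) (auto simp: C_def)
    qed
    show "jet B"
      unfolding jet_def
    proof (intro allI)
      fix n x
      show "(B n has_vector_derivative B (Suc n) x) (at x)"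
      proof (cases "\<bar>x\<bar> < 1")
        case True
        have "(deriv ^^ n) F holomorphic_on {z. z\<^sup>2 \<noteq> 1}"
          by (rule holomorphic_higher_deriv[OF hol op])
        then have "((deriv ^^ n) F has_field_derivative (deriv ^^ Suc n) F (of_real x)) (at (of_real x))"
          using holomorphic_derivI[OF _ op, of "(deriv ^^ n) F" "of_real x"] q[OF True]
          by (simp flip: of_real_power)
        then have "((\<lambda>y. (deriv ^^ n) F (of_real y)) has_vector_derivative B (Suc n) x) (at x)"
          using True by (simp only: B_def if_True has_vector_derivative_real_field)
        then show ?thesis
          by (rule has_vector_derivative_transform_within_open[of _ _ _ "{-1<..<1}"]) (use True in \<open>auto simp: B_def\<close>)
      next
        case False
        \<comment> \<open>Index \<open>n + 2\<close> instead of \<open>n\<close> gains two powers of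
          \<open>1 - y^2\<close>. So \<open>B n\<close> vanishes quadratically at every
          \<open>x\<close> with \<open>\<bar>x\<bar> \<ge> 1\<close> and has derivative 0
          there.\<close>
        define D where "D = fact n * (2 / \<theta>) ^ n * fact (n + 2) powr (1 / real p)"
        have D: "cmod (B n y) \<le> 4 * D * \<bar>y - x\<bar> ^ 2" for y
        proof (cases "\<bar>y\<bar> < 1")
          case True
          let ?k = "1 / (1 - y\<^sup>2)"
          have k0: "?k > 0" using q[OF True] by simp
          have k: "?k ^ n * exp (- (?k ^ p / 2)) \<le> fact (n + 2) powr (1 / real p) * (1 - y\<^sup>2)\<^sup>2"
          proof -
            have "?k ^ (n + 2) * exp (- (?k ^ p / 2)) \<le> fact (n + 2) powr (1 / real p)"
              by (rule power_mult_exp_le_fact_root[OF k0 p(1)])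
            then have "?k ^ n * exp (- (?k ^ p / 2)) * ?k\<^sup>2 * (1 - y\<^sup>2)\<^sup>2 \<le> fact (n + 2) powr (1 / real p) * (1 - y\<^sup>2)\<^sup>2"
              by (intro mult_right_mono) (simp_all only: power_add mult_ac zero_le_power2)
            moreover have "?k\<^sup>2 * (1 - y\<^sup>2)\<^sup>2 = 1" using q[OF True] by (simp add: power_divide)
            ultimately show ?thesis by (simp only: mult.assoc mult_1_right)
          qed
          have "1 - y\<^sup>2 = (1 - \<bar>y\<bar>) * (1 + \<bar>y\<bar>)" by (simp add: algebra_simps power2_eq_square)
          also have "\<dots> \<le> (1 - \<bar>y\<bar>) * 2" using True by (intro mult_left_mono) auto
          also have "\<dots> \<le> \<bar>y - x\<bar> * 2"
          proof (rule mult_right_mono)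
            have "1 \<le> \<bar>x\<bar>" using False by simp
            also have "\<dots> \<le> \<bar>y\<bar> + \<bar>y - x\<bar>" by (simp add: abs_if)
            finally show "1 - \<bar>y\<bar> \<le> \<bar>y - x\<bar>" by simp
          qed simp
          finally have "(1 - y\<^sup>2)\<^sup>2 \<le> (\<bar>y - x\<bar> * 2)\<^sup>2" using q[OF True] by (intro power_mono) auto
          then have "fact (n + 2) powr (1 / real p) * (1 - y\<^sup>2)\<^sup>2 \<le> fact (n + 2) powr (1 / real p) * (\<bar>y - x\<bar> * 2)\<^sup>2"
            by (intro mult_left_mono) auto
          from mult_left_mono[OF order_trans[OF k this], of "fact n * (2 / \<theta>) ^ n"]
          have "fact n * (2 / \<theta>) ^ n * (?k ^ n * exp (- (?k ^ p / 2))) \<le> 4 * D * \<bar>y - x\<bar> ^ 2"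
            using \<theta> by (simp add: D_def power_mult_distrib mult_ac)
          with bound[OF True, of n] True show ?thesis by (simp add: B_def)
        qed (use \<theta> in \<open>simp add: B_def D_def\<close>)
        have "(B n has_derivative (\<lambda>h. 0)) (at x)"
          unfolding has_derivative_iff_norm
        proof
          have lim: "((\<lambda>y. 4 * D * \<bar>y - x\<bar>) \<longlongrightarrow> 0) (at x)"
            by (rule tendsto_eq_intros refl | simp)+
          have Bx: "B n x = 0" using False by (simp add: B_def)
          have "norm (norm (B n y - B n x - 0) / norm (y - x)) \<le> 4 * D * \<bar>y - x\<bar>" for y
          proof (cases "y = x")
            case False
            then show ?thesis
              using D[of y] by (simp add: Bx divide_le_eq power2_eq_square mult.assoc)
          qed simp
          then show "((\<lambda>y. norm (B n y - B n x - 0) / norm (y - x)) \<longlongrightarrow> 0) (at x)"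
            by (intro Lim_null_comparison[OF always_eventually lim]) blast
        qed simp
        then show ?thesis using False by (simp add: has_vector_derivative_def B_def)
      qed
    qed
  qed
qed

section \<open>Fourier series of the cutoff\<close>

text \<open>The period is \<open>2 * pi * N\<close>: the frequencies \<open>k / N\<close> get denser
  as \<open>N\<close> grows, and sums over them become Riemann sums.\<close>

definition fourier_coeff :: "real \<Rightarrow> (real \<Rightarrow> complex) \<Rightarrow> int \<Rightarrow> complex" where
  "fourier_coeff N f k = integral {-(pi * N)..pi * N} (\<lambda>x. f x * cis (- (of_int k * x / N))) / of_real (2 * pi * N)"

lemma has_integral_cis:
  assumes N: "N > 0"
  shows "((\<lambda>x. cis (of_int k * x / N)) has_integral (if k = 0 then of_real (2 * pi * N) else 0)) {-(pi * N)..pi * N}"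
proof (cases "k = 0")
  case True
  have "((\<lambda>x. 1) has_integral complex_of_real (2 * pi * N)) {-(pi * N)..pi * N}"
    using has_integral_const_real[of "1::complex" "-(pi * N)" "pi * N"] N by (simp add: scaleR_conv_of_real mult_ac)
  then show ?thesis using True by simp
next
  case False
  define w where "w = real_of_int k / N"
  have w: "w \<noteq> 0" using False N by (simp add: w_def)
  have "((\<lambda>x. cis (w * x)) has_integral (cis (w * (pi * N)) / (\<i> * of_real w) - cis (w * (- (pi * N))) / (\<i> * of_real w)))
    {-(pi * N)..pi * N}"
  proof (rule fundamental_theorem_of_calculus)
    show "- (pi * N) \<le> pi * N" using N by simp
    fix x
    show "((\<lambda>x. cis (w * x) / (\<i> * of_real w)) has_vector_derivative cis (w * x)) (at x within {-(pi * N)..pi * N})"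
      using w unfolding cis_conv_exp of_real_mult
      by (auto intro!: has_vector_derivative_real_field derivative_eq_intros simp: field_simps)
  qed
  moreover have "cis (w * (pi * N)) = cis (w * (- (pi * N)))"
  proof -
    have eq: "w * (pi * N) = pi * of_int k" using N by (simp add: w_def)
    have "cis (2 * pi * of_int k) = 1" by (rule cis_multiple_2pi) simp
    then have "cis (- (pi * of_int k)) = cis (- (pi * of_int k)) * cis (2 * pi * of_int k)" by simp
    also have "\<dots> = cis (pi * of_int k)" unfolding cis_mult by simp
    finally have "cis (pi * of_int k) = cis (- (pi * of_int k))" ..
    then show ?thesis unfolding mult_minus_right eq .
  qed
  ultimately show ?thesis using False by (simp add: w_def mult.commute)
qed

text \<open>The squared distance from \<open>g\<close> to its partial sum \<open>S\<close> has
  nonnegative integral, which orthogonality of the exponentials evaluates.\<close>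

lemma bessel_inequality:
  assumes N: "N > 0" and g: "continuous_on {-(pi * N)..pi * N} g" and A: "finite A"
  shows "(\<Sum>k\<in>A. (cmod (fourier_coeff N g k))\<^sup>2) \<le> integral {-(pi * N)..pi * N} (\<lambda>x. (cmod (g x))\<^sup>2) / (2 * pi * N)"
proof -
  let ?J = "{-(pi * N)..pi * N}"
  define T where "T = 2 * pi * N"
  have T: "T > 0" using N by (simp add: T_def)
  define c where "c k = fourier_coeff N g k" for k
  define e where "e k x = cis (of_int k * x / N)" for k :: int and x
  have cis_cont [continuous_intros]: "continuous_on S (e k)" for S k
    unfolding e_def cis_conv_exp using N by (intro continuous_intros) auto
  have c: "((\<lambda>x. g x * cnj (e k x)) has_integral of_real T * c k) ?J" for k
  proof -
    have "(\<lambda>x. g x * cnj (e k x)) integrable_on ?J"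
      by (intro integrable_continuous_real continuous_intros g)
    then show ?thesis
      using T by (simp add: has_integral_iff c_def fourier_coeff_def T_def e_def cis_cnj)
  qed
  have c': "((\<lambda>x. cnj (g x) * e k x) has_integral of_real T * cnj (c k)) ?J" for k
    using has_integral_linear[OF c[of k] bounded_linear_cnj] by (simp add: o_def)
  have ee: "((\<lambda>x. e k x * cnj (e j x)) has_integral (if k = j then of_real T else 0)) ?J" for k j
  proof -
    have "e k x * cnj (e j x) = cis (of_int (k - j) * x / N)" for x
      by (simp add: e_def cis_cnj cis_mult diff_divide_distrib left_diff_distrib)
    then show ?thesis using has_integral_cis[OF N, of "k - j"] by (simp only: T_def right_minus_eq)
  qed
  define S where "S x = (\<Sum>k\<in>A. c k * e k x)" for x
  have "(\<lambda>x. (cmod (g x))\<^sup>2) integrable_on ?J"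
    by (intro integrable_continuous_real continuous_intros g)
  from has_integral_linear[OF integrable_integral[OF this] bounded_linear_of_real[where 'a = complex]]
  have gg: "((\<lambda>x. complex_of_real ((cmod (g x))\<^sup>2)) has_integral of_real (integral ?J (\<lambda>x. (cmod (g x))\<^sup>2))) ?J"
    by (simp add: o_def)
  have "((\<lambda>x. complex_of_real ((cmod (g x))\<^sup>2) - (\<Sum>k\<in>A. cnj (c k) * (g x * cnj (e k x)))
      - (\<Sum>k\<in>A. c k * (cnj (g x) * e k x)) + (\<Sum>k\<in>A. \<Sum>j\<in>A. (c k * cnj (c j)) * (e k x * cnj (e j x))))
    has_integral (of_real (integral ?J (\<lambda>x. (cmod (g x))\<^sup>2)) - (\<Sum>k\<in>A. cnj (c k) * (of_real T * c k))
      - (\<Sum>k\<in>A. c k * (of_real T * cnj (c k))) + (\<Sum>k\<in>A. \<Sum>j\<in>A. (c k * cnj (c j)) * (if k = j then of_real T else 0)))) ?J"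
    by (intro has_integral_add has_integral_diff gg has_integral_sum A has_integral_mult_right c c' ee)
  also have "(\<Sum>k\<in>A. \<Sum>j\<in>A. (c k * cnj (c j)) * (if k = j then of_real T else 0)) = (\<Sum>k\<in>A. c k * (of_real T * cnj (c k)))"
    using A by (intro sum.cong refl) (simp add: if_distrib cong: if_cong)
  also have "(\<Sum>k\<in>A. cnj (c k) * (of_real T * c k)) = of_real (T * (\<Sum>k\<in>A. (cmod (c k))\<^sup>2))"
    unfolding of_real_mult of_real_sum complex_norm_square sum_distrib_left by (simp only: mult_ac)
  also have "(\<lambda>x. complex_of_real ((cmod (g x))\<^sup>2) - (\<Sum>k\<in>A. cnj (c k) * (g x * cnj (e k x)))
      - (\<Sum>k\<in>A. c k * (cnj (g x) * e k x)) + (\<Sum>k\<in>A. \<Sum>j\<in>A. (c k * cnj (c j)) * (e k x * cnj (e j x)))) =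
      (\<lambda>x. complex_of_real ((cmod (g x - S x))\<^sup>2))"
  proof
    fix x
    have 1: "(\<Sum>k\<in>A. cnj (c k) * (g x * cnj (e k x))) = g x * cnj (S x)"
      by (simp add: S_def sum_distrib_left mult_ac)
    have 2: "(\<Sum>k\<in>A. c k * (cnj (g x) * e k x)) = cnj (g x) * S x"
      by (simp add: S_def sum_distrib_left mult_ac)
    have 3: "(\<Sum>k\<in>A. \<Sum>j\<in>A. (c k * cnj (c j)) * (e k x * cnj (e j x))) = S x * cnj (S x)"
      by (simp add: S_def sum_product mult_ac)
    show "complex_of_real ((cmod (g x))\<^sup>2) - (\<Sum>k\<in>A. cnj (c k) * (g x * cnj (e k x)))
      - (\<Sum>k\<in>A. c k * (cnj (g x) * e k x)) + (\<Sum>k\<in>A. \<Sum>j\<in>A. (c k * cnj (c j)) * (e k x * cnj (e j x))) =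
       complex_of_real ((cmod (g x - S x))\<^sup>2)"
      unfolding 1 2 3 complex_norm_square by (simp add: algebra_simps)
  qed
  finally have int: "((\<lambda>x. complex_of_real ((cmod (g x - S x))\<^sup>2)) has_integral
     of_real (integral ?J (\<lambda>x. (cmod (g x))\<^sup>2)) - of_real (T * (\<Sum>k\<in>A. (cmod (c k))\<^sup>2))) ?J"
    by simp
  have "((\<lambda>x. (cmod (g x - S x))\<^sup>2) has_integral
      integral ?J (\<lambda>x. (cmod (g x))\<^sup>2) - T * (\<Sum>k\<in>A. (cmod (c k))\<^sup>2)) ?J"
    using has_integral_linear[OF int bounded_linear_Re]
    by (simp only: o_def Re_complex_of_real of_real_diff[symmetric])
  from has_integral_nonneg[OF this]
  have "0 \<le> integral ?J (\<lambda>x. (cmod (g x))\<^sup>2) - T * (\<Sum>k\<in>A. (cmod (c k))\<^sup>2)"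
    by simp
  then show ?thesis
    using T by (simp add: c_def T_def field_simps)
qed

text \<open>Riemann-Lebesgue, because terms of a convergent series tend to 0. An injective
  \<open>h\<close> can run to either end of the integers.\<close>

lemma fourier_coeff_tendsto_0:
  fixes h :: "nat \<Rightarrow> int"
  assumes N: "N > 0" and g: "continuous_on {-(pi * N)..pi * N} g" and h: "inj h"
  shows "(\<lambda>n. fourier_coeff N g (h n)) \<longlonglongrightarrow> 0"
proof -
  let ?B = "integral {-(pi * N)..pi * N} (\<lambda>x. (cmod (g x))\<^sup>2) / (2 * pi * N)"
  have "summable (\<lambda>n. (cmod (fourier_coeff N g (h n)))\<^sup>2)"
  proof (rule bounded_imp_summable)
    show "(\<Sum>k\<le>n. (cmod (fourier_coeff N g (h k)))\<^sup>2) \<le> ?B" for n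
      using bessel_inequality[OF N g, of "h ` {..n}"] h
      by (simp add: sum.reindex inj_on_subset)
  qed simp
  then have "(\<lambda>n. (cmod (fourier_coeff N g (h n)))\<^sup>2) \<longlonglongrightarrow> 0" by (rule summable_LIMSEQ_zero)
  then have "(\<lambda>n. sqrt ((cmod (fourier_coeff N g (h n)))\<^sup>2)) \<longlonglongrightarrow> sqrt 0" by (rule tendsto_real_sqrt)
  then show ?thesis by (simp add: tendsto_norm_zero_iff)
qed

lemma cis_neq_1:
  assumes "\<theta> \<noteq> 0" "\<bar>\<theta>\<bar> < 2 * pi" shows "cis \<theta> \<noteq> 1"
proof
  assume "cis \<theta> = 1"
  then have "cos \<theta> = 1" by (metis Re_complex_of_real cis.simps(1) one_complex.simps(1))
  then obtain n :: int where n: "\<theta> = of_int n * 2 * pi" by (auto simp: cos_one_2pi_int)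
  with assms(2) have "\<bar>real_of_int n\<bar> * (2 * pi) < 1 * (2 * pi)" by (simp add: abs_mult)
  then have "\<bar>real_of_int n\<bar> < 1" by (rule mult_right_less_imp_less) simp
  then have "n = 0" by linarith
  with n assms(1) show False by simp
qed

lemma sum_symmetric_Suc:
  fixes F :: "int \<Rightarrow> 'a::comm_monoid_add"
  shows "(\<Sum>k\<in>{- int (Suc K)..int (Suc K)}. F k) =
    F (- int (Suc K)) + (F (int (Suc K)) + (\<Sum>k\<in>{- int K..int K}. F k))"
proof -
  have "{- int (Suc K)..int (Suc K)} = insert (- int (Suc K)) (insert (int (Suc K)) {- int K..int K})"
    by auto
  then show ?thesis by simp
qed

lemma tendsto_quotient_vector_derivative:
  fixes f :: "real \<Rightarrow> complex"
  assumes "(f has_vector_derivative f') (at p)"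
  shows "((\<lambda>x. (f x - f p) / of_real (x - p)) \<longlongrightarrow> f') (at p)"
proof -
  have "((\<lambda>x. norm (f x - f p - (x - p) *\<^sub>R f') / norm (x - p)) \<longlongrightarrow> 0) (at p)"
    using assms unfolding has_vector_derivative_def has_derivative_iff_norm by blast
  then have "((\<lambda>x. norm ((f x - f p) / of_real (x - p) - f')) \<longlongrightarrow> 0) (at p)"
  proof (rule Lim_transform_eventually)
    have "norm (f x - f p - (x - p) *\<^sub>R f') / norm (x - p) = norm ((f x - f p) / of_real (x - p) - f')"
      if "x \<noteq> p" for x
    proof -
      have "f x - f p - (x - p) *\<^sub>R f' = of_real (x - p) * ((f x - f p) / of_real (x - p) - f')"
        unfolding right_diff_distrib using that by (simp add: scaleR_conv_of_real del: of_real_diff)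
      then show ?thesis using that by (simp add: norm_mult del: of_real_diff)
    qed
    then show "\<forall>\<^sub>F x in at p. norm (f x - f p - (x - p) *\<^sub>R f') / norm (x - p) =
        norm ((f x - f p) / of_real (x - p) - f')"
      by (simp add: eventually_at_filter)
  qed
  then show ?thesis by (rule LIM_zero_cancel[OF tendsto_norm_zero_cancel])
qed

text \<open>Chernoff's argument: dividing \<open>f - f p\<close> by \<open>cis ((x - p) / N) - 1\<close> gives a continuous function \<open>g\<close>,
  and the partial sums of the Fourier series of \<open>f\<close> at \<open>p\<close> telescope in terms of the coefficients of \<open>g\<close>.\<close>

lemma fourier_series_tendsto:
  assumes N: "N > 0" and f: "continuous_on {-(pi * N)..pi * N} f"
    and p: "\<bar>p\<bar> < pi * N" and f': "(f has_vector_derivative f') (at p)"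
  shows "(\<lambda>K. \<Sum>k\<in>{- int K..int K}. fourier_coeff N f k * cis (of_int k * p / N)) \<longlonglongrightarrow> f p"
proof -
  let ?J = "{-(pi * N)..pi * N}"
  define T where "T = complex_of_real (2 * pi * N)"
  have T: "T \<noteq> 0" using N by (simp add: T_def)
  define d where "d x = cis ((x - p) / N) - 1" for x
  \<comment> \<open>At \<open>p\<close> the value is the limit of the quotient, since
    \<open>d\<close> has derivative \<open>\<i> / N\<close> there. Elsewhere on the interval
    \<open>d\<close> has no zero because \<open>\<bar>p\<bar> < pi * N\<close>.\<close>
  define g where "g x = (if x = p then f' * of_real N / \<i> else (f x - f p) / d x)" for x
  have d0: "d x \<noteq> 0" if "x \<in> ?J" "x \<noteq> p" for x
  proof -
    have "\<bar>x - p\<bar> < 2 * (pi * N)" using that p by auto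
    then have "\<bar>(x - p) / N\<bar> < 2 * pi" using N by (simp add: abs_divide field_simps)
    then show ?thesis unfolding d_def using that N cis_neq_1[of "(x - p) / N"] by simp
  qed
  have dd: "(d has_vector_derivative \<i> / of_real N) (at p)"
    unfolding d_def cis_conv_exp of_real_divide of_real_diff
    using N by (auto intro!: has_vector_derivative_real_field derivative_eq_intros)
  have dcont: "continuous_on S d" for S
    unfolding d_def cis_conv_exp using N by (intro continuous_intros) auto
  have gcont: "continuous_on ?J g"
    unfolding continuous_on_def
  proof
    fix x assume x: "x \<in> ?J"
    show "(g \<longlongrightarrow> g x) (at x within ?J)"
    proof (cases "x = p")
      case True
      have "((\<lambda>x. ((f x - f p) / of_real (x - p)) / ((d x - d p) / of_real (x - p))) \<longlongrightarrow> f' / (\<i> / of_real N)) (at p)"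
        using N by (intro tendsto_divide tendsto_quotient_vector_derivative f' dd) auto
      then have "((\<lambda>x. (f x - f p) / d x) \<longlongrightarrow> f' / (\<i> / of_real N)) (at p)"
        by (rule Lim_transform_eventually) (auto simp: d_def eventually_at_filter)
      then have "(g \<longlongrightarrow> f' / (\<i> / of_real N)) (at p)"
        by (rule Lim_transform_eventually) (auto simp: g_def eventually_at_filter)
      then show ?thesis
        using True by (auto simp: g_def intro: tendsto_within_subset)
    next
      case False
      have "((\<lambda>x. (f x - f p) / d x) \<longlongrightarrow> (f x - f p) / d x) (at x within ?J)"
        using f dcont[of ?J] x unfolding continuous_on_def
        by (intro tendsto_divide tendsto_diff tendsto_const d0[OF x False]) blast+
      moreover have "\<forall>\<^sub>F y in at x within ?J. (f y - f p) / d y = g y"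
        unfolding eventually_at using False
        by (intro exI[of _ "dist x p"]) (auto simp: g_def dist_commute)
      ultimately show ?thesis
        using False Lim_transform_eventually unfolding g_def[of x] if_not_P[OF False] by blast
    qed
  qed
  have fg: "f x = f p + g x * d x" if "x \<in> ?J" for x
    using d0[OF that] by (auto simp: g_def d_def)
  have ccont: "continuous_on S (\<lambda>x. cis (- (of_int k * x / N)))" for S and k :: int
    unfolding cis_conv_exp using N by (intro continuous_intros) auto
  have gI: "((\<lambda>x. g x * cis (- (of_int k * x / N))) has_integral T * fourier_coeff N g k) ?J" for k
    using T integrable_integral[OF integrable_continuous_real[OF continuous_on_mult[OF gcont ccont]]]
    by (simp add: fourier_coeff_def T_def)
  \<comment> \<open>Multiplication by \<open>cis (x / N)\<close> shifts the index of a Fourier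
    coefficient by one; this is applied to \<open>f = f p + g * d\<close>.\<close>
  have coeff: "fourier_coeff N f k = (if k = 0 then f p else 0) +
      cis (- (p / N)) * fourier_coeff N g (k - 1) - fourier_coeff N g k" for k
  proof -
    have "((\<lambda>x. f p * cis (of_int (- k) * x / N) + cis (- (p / N)) * (g x * cis (- (of_int (k - 1) * x / N)))
        - g x * cis (- (of_int k * x / N))) has_integral
        (f p * (if - k = 0 then of_real (2 * pi * N) else 0) + cis (- (p / N)) * (T * fourier_coeff N g (k - 1))
        - T * fourier_coeff N g k)) ?J"
      by (intro has_integral_add has_integral_diff has_integral_mult_right has_integral_cis N gI)
    then have "((\<lambda>x. f x * cis (- (of_int k * x / N))) has_integral
        (f p * (if - k = 0 then of_real (2 * pi * N) else 0) + cis (- (p / N)) * (T * fourier_coeff N g (k - 1))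
        - T * fourier_coeff N g k)) ?J"
    proof (rule has_integral_eq[rotated])
      fix x assume x: "x \<in> ?J"
      have "cis ((x - p) / N) * cis (- (of_int k * x / N)) = cis (- (p / N)) * cis (- (of_int (k - 1) * x / N))"
        unfolding cis_mult by (rule arg_cong[of _ _ cis]) (use N in \<open>simp add: field_simps\<close>)
      then show "f p * cis (of_int (- k) * x / N) + cis (- (p / N)) * (g x * cis (- (of_int (k - 1) * x / N)))
        - g x * cis (- (of_int k * x / N)) = f x * cis (- (of_int k * x / N))"
        unfolding fg[OF x] d_def by (simp add: algebra_simps)
    qed
    then have "integral ?J (\<lambda>x. f x * cis (- (of_int k * x / N))) =
        f p * (if k = 0 then T else 0) + cis (- (p / N)) * (T * fourier_coeff N g (k - 1)) - T * fourier_coeff N g k"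
      by (auto simp: has_integral_iff T_def)
    then show ?thesis
      unfolding fourier_coeff_def[of N f] T_def[symmetric] using T by (simp add: field_simps)
  qed
  \<comment> \<open>Including the phase at \<open>p\<close> removes the factor
    \<open>cis (- (p / N))\<close> from the recursion, which then telescopes.\<close>
  define G where "G k = fourier_coeff N g k * cis (of_int k * p / N)" for k
  have tele: "fourier_coeff N f k * cis (of_int k * p / N) = (if k = 0 then f p else 0) + (G (k - 1) - G k)" for k
  proof -
    have "cis (- (p / N)) * cis (of_int k * p / N) = cis (of_int (k - 1) * p / N)"
      by (simp add: cis_mult diff_divide_distrib left_diff_distrib)
    then show ?thesis unfolding coeff G_def by (simp add: algebra_simps)
  qed
  have sum_eq: "(\<Sum>k\<in>{- int K..int K}. fourier_coeff N f k * cis (of_int k * p / N)) = f p + (G (- int K - 1) - G (int K))" for K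
  proof (induction K)
    case (Suc K)
    have "G (- 1 - int K) = G (- int K - 1)" by (rule arg_cong) simp
    then show ?case using Suc unfolding sum_symmetric_Suc tele by simp
  qed (use tele[of 0] in simp)
  have G0: "(\<lambda>K. G (h K)) \<longlonglongrightarrow> 0" if "inj h" for h :: "nat \<Rightarrow> int"
    using tendsto_norm_zero[OF fourier_coeff_tendsto_0[OF N gcont that]]
    by (subst tendsto_norm_zero_iff[symmetric]) (simp add: G_def norm_mult)
  have "(\<lambda>K. G (- int K - 1)) \<longlonglongrightarrow> 0" "(\<lambda>K. G (int K)) \<longlonglongrightarrow> 0"
    by (rule G0, simp add: inj_def)+
  from tendsto_add[OF tendsto_const[of "f p"] tendsto_diff[OF this]]
  show ?thesis unfolding sum_eq by simp
qed

section \<open>Fourier transform of the bump and its trigonometric approximation\<close>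

definition bump_ft :: "(nat \<Rightarrow> real \<Rightarrow> complex) \<Rightarrow> real \<Rightarrow> complex" where
  "bump_ft B \<zeta> = integral {-1..1} (\<lambda>x. B 0 x * cis (- (\<zeta> * x)))"

lemma jet_continuous_on: "jet B \<Longrightarrow> continuous_on S (B n)"
  unfolding jet_def by (meson continuous_at_imp_continuous_on has_vector_derivative_continuous)

lemma has_vector_derivative_cis: "((\<lambda>x. cis (a * x)) has_vector_derivative \<i> * of_real a * cis (a * x)) (at x within S)"
  unfolding cis_conv_exp of_real_mult
  by (auto intro!: has_vector_derivative_real_field derivative_eq_intros)

text \<open>Integration by parts; the boundary terms vanish because every \<open>B n\<close> is 0 at
  -1 and 1.\<close>

lemma jet_has_integral_bump_ft:
  assumes B: "jet B" and supp: "\<And>n x. \<bar>x\<bar> \<ge> 1 \<Longrightarrow> B n x = 0"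
  shows "((\<lambda>x. B n x * cis (- (\<zeta> * x))) has_integral (\<i> * of_real \<zeta>) ^ n * bump_ft B \<zeta>) {-1..1}"
proof (induction n)
  case 0
  have "(\<lambda>x. B 0 x * cis (- (\<zeta> * x))) integrable_on {-1..1}"
    unfolding cis_conv_exp by (intro integrable_continuous_real continuous_intros jet_continuous_on B)
  then show ?case by (simp add: has_integral_iff bump_ft_def)
next
  case (Suc n)
  have "((\<lambda>x. B n x * (\<i> * of_real (- \<zeta>) * cis ((- \<zeta>) * x)) + B (Suc n) x * cis ((- \<zeta>) * x)) has_integral
      (B n 1 * cis ((- \<zeta>) * 1) - B n (-1) * cis ((- \<zeta>) * (-1)))) {-1..1}"
  proof (rule fundamental_theorem_of_calculus)
    fix x
    have "(B n has_vector_derivative B (Suc n) x) (at x within {-1..1})"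
      using B has_vector_derivative_at_within unfolding jet_def by blast
    from has_vector_derivative_mult[OF this has_vector_derivative_cis]
    show "((\<lambda>x. B n x * cis ((- \<zeta>) * x)) has_vector_derivative
      B n x * (\<i> * of_real (- \<zeta>) * cis ((- \<zeta>) * x)) + B (Suc n) x * cis ((- \<zeta>) * x)) (at x within {-1..1})" .
  qed simp
  then have "((\<lambda>x. B n x * (\<i> * of_real (- \<zeta>) * cis ((- \<zeta>) * x)) + B (Suc n) x * cis ((- \<zeta>) * x)) has_integral 0) {-1..1}"
    by (simp add: supp)
  from has_integral_add[OF this has_integral_mult_right[OF Suc, of "\<i> * of_real \<zeta>"]]
  show ?case by (simp add: algebra_simps)
qed

text \<open>For \<open>N \<ge> 1\<close> the support fits into one period, so Fourier coefficients
  are samples of the Fourier transform at \<open>k / N\<close>.\<close>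

lemma jet_fourier_coeff:
  assumes B: "jet B" and supp: "\<And>n x. \<bar>x\<bar> \<ge> 1 \<Longrightarrow> B n x = 0" and N: "N \<ge> 1"
  shows "fourier_coeff N (B n) k = (\<i> * of_real (of_int k / N)) ^ n * bump_ft B (of_int k / N) / of_real (2 * pi * N)"
proof -
  have "1 * 1 \<le> pi * N" using N pi_ge_two by (intro mult_mono) auto
  then have "((\<lambda>x. B n x * cis (- (of_int k / N * x))) has_integral (\<i> * of_real (of_int k / N)) ^ n * bump_ft B (of_int k / N))
      {-(pi * N)..pi * N}"
    by (intro has_integral_on_superset[OF jet_has_integral_bump_ft[OF B supp]]) (auto simp: supp)
  then show ?thesis by (simp add: fourier_coeff_def has_integral_iff)
qed

text \<open>\<open>B n\<close> controls \<open>\<bar>\<zeta>\<bar> ^ n\<close> times the transform,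
  and adapting \<open>n\<close> to \<open>\<zeta>\<close> turns this into exponential decay. The
  denominator keeps sums over a mesh \<open>1 / N\<close> bounded independently of
  \<open>N\<close>.\<close>

lemma bump_ft_decay:
  assumes B: "jet B" and supp: "\<And>n x. \<bar>x\<bar> \<ge> 1 \<Longrightarrow> B n x = 0" and s: "s > 1"
    and bound: "\<And>h. h > 0 \<Longrightarrow> \<exists>C>0. \<forall>n x. cmod (B n x) \<le> C * (h ^ n * fact n powr s)"
    and r: "r > 0"
  obtains A where "A \<ge> 0" "\<And>\<zeta>. cmod (bump_ft B \<zeta>) * exp (r * \<bar>\<zeta>\<bar> powr (1 / s)) \<le> A / (1 + \<zeta>\<^sup>2)"
proof -
  \<comment> \<open>The surplus \<open>s\<close> in the rate pays for \<open>1 + \<zeta>^2\<close>,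
    which is at most a multiple of
    \<open>exp (s * \<bar>\<zeta>\<bar> powr (1 / s))\<close>.\<close>
  obtain h K where h: "h > 0" "K > 0" and
    hK: "\<And>v. v \<ge> 0 \<Longrightarrow> \<exists>n. exp ((r + s) * v powr (1 / s)) * (h ^ n * fact n powr s) \<le> K * v ^ n"
    using ex_exp_powr_le_power[of "r + s" s] r s by auto
  obtain C where C: "C > 0" "\<And>n x. cmod (B n x) \<le> C * (h ^ n * fact n powr s)"
    using bound[OF h(1)] by blast
  have 1: "cmod (bump_ft B \<zeta>) * exp ((r + s) * \<bar>\<zeta>\<bar> powr (1 / s)) \<le> K * (2 * C)" for \<zeta>
  proof -
    obtain n where n: "exp ((r + s) * \<bar>\<zeta>\<bar> powr (1 / s)) * (h ^ n * fact n powr s) \<le> K * \<bar>\<zeta>\<bar> ^ n"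
      using hK[of "\<bar>\<zeta>\<bar>"] by auto
    let ?q = "h ^ n * fact n powr s"
    have q: "?q > 0" using h by simp
    have "cmod ((\<i> * of_real \<zeta>) ^ n * bump_ft B \<zeta>) \<le> C * ?q * measure lborel {-1..1::real}"
      using C q
      by (intro has_integral_bound_real[OF _ finite.emptyI jet_has_integral_bump_ft[OF B supp]]) (auto simp: norm_mult)
    then have le: "\<bar>\<zeta>\<bar> ^ n * cmod (bump_ft B \<zeta>) \<le> 2 * C * ?q"
      by (simp add: norm_mult norm_power mult_ac)
    have "cmod (bump_ft B \<zeta>) * exp ((r + s) * \<bar>\<zeta>\<bar> powr (1 / s)) * ?q \<le> cmod (bump_ft B \<zeta>) * (K * \<bar>\<zeta>\<bar> ^ n)"
      using mult_left_mono[OF n, of "cmod (bump_ft B \<zeta>)"] by (simp add: mult_ac)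
    also have "\<dots> = K * (\<bar>\<zeta>\<bar> ^ n * cmod (bump_ft B \<zeta>))" by simp
    also have "\<dots> \<le> K * (2 * C * ?q)" using le h by (intro mult_left_mono) auto
    also have "\<dots> = K * (2 * C) * ?q" by simp
    finally show ?thesis using q by (simp only: mult_le_cancel_right_pos)
  qed
  have 2: "1 + \<zeta>\<^sup>2 \<le> (1 + 2 powr s) * exp (s * \<bar>\<zeta>\<bar> powr (1 / s))" for \<zeta>
  proof -
    define E where "E = exp (s * \<bar>\<zeta>\<bar> powr (1 / s))"
    have "\<bar>\<zeta>\<bar> ^ 2 \<le> 1 ^ 2 * fact 2 powr s * exp (s * 1 powr (- 1 / s) * \<bar>\<zeta>\<bar> powr (1 / s))"
      using s by (intro power_le_fact_powr_mult_exp) auto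
    then have "\<zeta>\<^sup>2 \<le> 2 powr s * E" by (simp add: E_def)
    moreover have "1 \<le> E" using s by (simp add: E_def)
    ultimately show ?thesis unfolding E_def[symmetric] distrib_right by linarith
  qed
  show ?thesis
  proof (rule that[of "(1 + 2 powr s) * (K * (2 * C))"])
    show "0 \<le> (1 + 2 powr s) * (K * (2 * C))" using h C by simp
    fix \<zeta>
    have "cmod (bump_ft B \<zeta>) * exp (r * \<bar>\<zeta>\<bar> powr (1 / s)) * (1 + \<zeta>\<^sup>2) \<le>
        cmod (bump_ft B \<zeta>) * exp (r * \<bar>\<zeta>\<bar> powr (1 / s)) * ((1 + 2 powr s) * exp (s * \<bar>\<zeta>\<bar> powr (1 / s)))"
      by (intro mult_left_mono 2) auto
    also have "\<dots> = (1 + 2 powr s) * (cmod (bump_ft B \<zeta>) * exp ((r + s) * \<bar>\<zeta>\<bar> powr (1 / s)))"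
      by (simp add: algebra_simps exp_add)
    also have "\<dots> \<le> (1 + 2 powr s) * (K * (2 * C))" by (intro mult_left_mono 1) (simp add: add_nonneg_nonneg)
    finally show "cmod (bump_ft B \<zeta>) * exp (r * \<bar>\<zeta>\<bar> powr (1 / s)) \<le> (1 + 2 powr s) * (K * (2 * C)) / (1 + \<zeta>\<^sup>2)"
      by (simp add: pos_le_divide_eq add_pos_nonneg)
  qed
qed

text \<open>Comparison with \<open>\<integral> d\<zeta> / (1 + \<zeta>\<^sup>2) = \<pi>\<close>, uniformly in the mesh \<open>1 / N\<close>.\<close>

lemma riemann_sum_le:
  assumes N: "N \<ge> 1"
  shows "(\<Sum>k\<in>{- int K..int K}. 1 / N * (1 / (1 + (of_int k / N)\<^sup>2))) \<le> 1 + pi"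
proof -
  have "(\<Sum>k\<in>{- int K..int K}. 1 / N * (1 / (1 + (of_int k / N)\<^sup>2))) \<le> 1 / N + 2 * arctan (real K / N)"
  proof (induction K)
    case (Suc K)
    let ?a = "real K / N" and ?b = "real (Suc K) / N"
    have ab: "?a < ?b" "0 \<le> ?a" using N by (auto simp: divide_strict_right_mono)
    \<comment> \<open>The right endpoint gives a lower sum for the decreasing integrand, so each
      term is at most an increment of \<open>arctan\<close>.\<close>
    obtain z where z: "z > ?a" "z < ?b" "arctan ?b - arctan ?a = (?b - ?a) * inverse (1 + z\<^sup>2)"
      using MVT2[OF ab(1), of arctan "\<lambda>x. inverse (1 + x\<^sup>2)"] DERIV_arctan by blast
    have z0: "0 \<le> z" by (rule order_trans[OF ab(2) less_imp_le[OF z(1)]])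
    have "1 / N * (1 / (1 + ?b\<^sup>2)) \<le> 1 / N * (1 / (1 + z\<^sup>2))"
      using z z0 ab N by (intro mult_left_mono divide_left_mono add_left_mono power_mono mult_pos_pos add_pos_nonneg z0) auto
    also have "\<dots> = arctan ?b - arctan ?a"
      unfolding z(3) by (simp add: divide_inverse algebra_simps)
    finally have le: "1 / N * (1 / (1 + ?b\<^sup>2)) \<le> arctan ?b - arctan ?a" .
    have "(\<Sum>k\<in>{- int (Suc K)..int (Suc K)}. 1 / N * (1 / (1 + (of_int k / N)\<^sup>2))) =
       2 * (1 / N * (1 / (1 + ?b\<^sup>2))) + (\<Sum>k\<in>{- int K..int K}. 1 / N * (1 / (1 + (of_int k / N)\<^sup>2)))"
      unfolding sum_symmetric_Suc using power2_minus[of "1 + real K"] by (simp add: power_divide)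
    then show ?case using Suc le by linarith
  qed simp
  also have "\<dots> \<le> 1 + pi"
    using N arctan_ubound[of "real K / N"] by (intro add_mono) (auto simp: divide_le_eq)
  finally show ?thesis .
qed

text \<open>What matters is the order of the choices: \<open>A\<close> depends on the rate only,
  while the finite sum depends on \<open>h\<close> and \<open>N\<close>. One sum approximates all
  derivatives, with an error of the form that \<open>gevrey_bound\<close> asks for.\<close>

lemma bump_trig_approx:
  assumes B: "jet B" and supp: "\<And>n x. \<bar>x\<bar> \<ge> 1 \<Longrightarrow> B n x = 0" and s: "s > 1"
    and bound: "\<And>h. h > 0 \<Longrightarrow> \<exists>C>0. \<forall>n x. cmod (B n x) \<le> C * (h ^ n * fact n powr s)"
  obtains A :: "real \<Rightarrow> real" where
    "\<And>h N. h > 0 \<Longrightarrow> N \<ge> 1 \<Longrightarrow> \<exists>F c. finite F \<and>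
      (\<forall>r>0. (\<Sum>\<zeta>\<in>F. cmod (c \<zeta>) * exp (r * \<bar>\<zeta>\<bar> powr (1 / s))) \<le> A r) \<and>
      (\<forall>n x. \<bar>x\<bar> \<le> N \<longrightarrow> cmod (B n x - (\<Sum>\<zeta>\<in>F. c \<zeta> * ((\<i> * of_real \<zeta>) ^ n * cis (\<zeta> * x)))) \<le> 1 / N * (h ^ n * fact n powr s))"
proof -
  have "\<forall>r. \<exists>A. r > 0 \<longrightarrow> A \<ge> 0 \<and> (\<forall>\<zeta>. cmod (bump_ft B \<zeta>) * exp (r * \<bar>\<zeta>\<bar> powr (1 / s)) \<le> A / (1 + \<zeta>\<^sup>2))"
    using bump_ft_decay[OF B supp s bound] by metis
  then obtain A where A: "\<And>r. r > 0 \<Longrightarrow> A r \<ge> 0"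
    "\<And>r \<zeta>. r > 0 \<Longrightarrow> cmod (bump_ft B \<zeta>) * exp (r * \<bar>\<zeta>\<bar> powr (1 / s)) \<le> A r / (1 + \<zeta>\<^sup>2)"
    by metis
  show ?thesis
  proof (rule that[of "\<lambda>r. A r * (1 + pi)"])
    fix h N :: real assume h: "h > 0" and N: "N \<ge> 1"
    define c where "c \<zeta> = bump_ft B \<zeta> / of_real (2 * pi * N)" for \<zeta>
    define z where "z k = real_of_int k / N" for k
    define S where "S r K = (\<Sum>k\<in>{- int K..int K}. cmod (c (z k)) * exp (r * \<bar>z k\<bar> powr (1 / s)))" for r K
    have S: "S r K \<le> A r * (1 + pi)" if r: "r > 0" for r K
    proof -
      have "S r K \<le> (\<Sum>k\<in>{- int K..int K}. A r * (1 / N * (1 / (1 + (z k)\<^sup>2))))"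
        unfolding S_def
      proof (rule sum_mono)
        fix k
        have "cmod (c (z k)) * exp (r * \<bar>z k\<bar> powr (1 / s)) =
            cmod (bump_ft B (z k)) * exp (r * \<bar>z k\<bar> powr (1 / s)) * (1 / (2 * pi * N))"
          using N by (simp add: c_def norm_divide norm_mult)
        also have "\<dots> \<le> A r / (1 + (z k)\<^sup>2) * (1 / (1 * N))"
          using N A[OF r] pi_ge_two by (intro mult_mono divide_left_mono mult_right_mono) auto
        finally show "cmod (c (z k)) * exp (r * \<bar>z k\<bar> powr (1 / s)) \<le> A r * (1 / N * (1 / (1 + (z k)\<^sup>2)))"
          by (simp add: mult.commute)
      qed
      also have "\<dots> \<le> A r * (1 + pi)"
        unfolding sum_distrib_left[of "A r", symmetric] z_def using A[OF r] N by (intro mult_left_mono riemann_sum_le)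
      finally show ?thesis .
    qed
    define P where "P K n x = (\<Sum>k\<in>{- int K..int K}. c (z k) * ((\<i> * of_real (z k)) ^ n * cis (z k * x)))" for K n x
    have P: "(\<lambda>K. P K n x) \<longlonglongrightarrow> B n x" if x: "\<bar>x\<bar> \<le> N" for n x
    proof -
      have "\<bar>x\<bar> < pi * N" using x N pi_gt3 mult_strict_right_mono[of 1 pi N] by linarith
      moreover have "(B n has_vector_derivative B (Suc n) x) (at x)" using B by (simp add: jet_def)
      ultimately have "(\<lambda>K. \<Sum>k\<in>{- int K..int K}. fourier_coeff N (B n) k * cis (of_int k * x / N)) \<longlonglongrightarrow> B n x"
        using N by (intro fourier_series_tendsto jet_continuous_on[OF B]) auto
      then show ?thesis
        by (simp add: P_def jet_fourier_coeff[OF B supp N] c_def z_def mult_ac)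
    qed
    \<comment> \<open>At this rate \<open>\<bar>z k\<bar> ^ n\<close> is at most
      \<open>h ^ n * fact n powr s\<close> times the weight, so one tail of the sums
      \<open>S r\<close> controls the tails for all \<open>n\<close> and \<open>x\<close>
      simultaneously.\<close>
    define r where "r = s * h powr (- 1 / s)"
    have r: "r > 0" using s h by (simp add: r_def)
    have mono: "incseq (S r)"
      unfolding S_def by (intro monoI sum_mono2) auto
    then obtain L where L: "S r \<longlonglongrightarrow> L" using incseq_convergent[OF mono] S[OF r] by blast
    then have "\<forall>\<^sub>F K in sequentially. S r K > L - 1 / N"
      using N by (intro order_tendstoD) auto
    then obtain K where K: "S r K > L - 1 / N" by (auto simp: eventually_sequentially)
    have diff: "cmod (P K' n x - P K n x) \<le> 1 / N * (h ^ n * fact n powr s)" if "K \<le> K'" for K' n x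
    proof -
      have sub: "{- int K..int K} \<subseteq> {- int K'..int K'}" using that by auto
      have "cmod (P K' n x - P K n x) = cmod (\<Sum>k\<in>{- int K'..int K'} - {- int K..int K}. c (z k) * ((\<i> * of_real (z k)) ^ n * cis (z k * x)))"
        unfolding P_def by (subst sum_diff[OF _ sub]) auto
      also have "\<dots> \<le> (\<Sum>k\<in>{- int K'..int K'} - {- int K..int K}. cmod (c (z k)) * exp (r * \<bar>z k\<bar> powr (1 / s)) * (h ^ n * fact n powr s))"
      proof (intro order_trans[OF norm_sum] sum_mono)
        fix k
        have "\<bar>z k\<bar> ^ n \<le> h ^ n * fact n powr s * exp (r * \<bar>z k\<bar> powr (1 / s))"
          unfolding r_def using h s by (intro power_le_fact_powr_mult_exp) auto
        from mult_left_mono[OF this, of "cmod (c (z k))"]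
        show "cmod (c (z k) * ((\<i> * of_real (z k)) ^ n * cis (z k * x))) \<le>
            cmod (c (z k)) * exp (r * \<bar>z k\<bar> powr (1 / s)) * (h ^ n * fact n powr s)"
          by (simp add: norm_mult norm_power mult_ac)
      qed
      also have "\<dots> = (S r K' - S r K) * (h ^ n * fact n powr s)"
        unfolding S_def sum_distrib_right[symmetric] by (subst sum_diff[OF _ sub]) auto
      also have "\<dots> \<le> 1 / N * (h ^ n * fact n powr s)"
        using incseq_le[OF mono L, of K'] K h by (intro mult_right_mono) auto
      finally show ?thesis .
    qed
    have inj: "inj_on z X" for X using N by (auto simp: z_def inj_on_def)
    show "\<exists>F c. finite F \<and>
      (\<forall>r>0. (\<Sum>\<zeta>\<in>F. cmod (c \<zeta>) * exp (r * \<bar>\<zeta>\<bar> powr (1 / s))) \<le> A r * (1 + pi)) \<and>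
      (\<forall>n x. \<bar>x\<bar> \<le> N \<longrightarrow> cmod (B n x - (\<Sum>\<zeta>\<in>F. c \<zeta> * ((\<i> * of_real \<zeta>) ^ n * cis (\<zeta> * x)))) \<le> 1 / N * (h ^ n * fact n powr s))"
    proof (intro exI conjI allI impI)
      show "finite (z ` {- int K..int K})" by simp
      show "(\<Sum>\<zeta>\<in>z ` {- int K..int K}. cmod (c \<zeta>) * exp (r * \<bar>\<zeta>\<bar> powr (1 / s))) \<le> A r * (1 + pi)" if "r > 0" for r
        using S[OF that, of K] by (simp add: sum.reindex[OF inj] S_def)
      show "cmod (B n x - (\<Sum>\<zeta>\<in>z ` {- int K..int K}. c \<zeta> * ((\<i> * of_real \<zeta>) ^ n * cis (\<zeta> * x)))) \<le> 1 / N * (h ^ n * fact n powr s)"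
        if x: "\<bar>x\<bar> \<le> N" for n x
      proof (rule tendsto_upperbound)
        \<comment> \<open>Letting \<open>K'\<close> tend to infinity in \<open>diff\<close> replaces
          the longer sum by \<open>B n x\<close>.\<close>
        show "(\<lambda>K'. cmod (P K' n x - P K n x)) \<longlonglongrightarrow>
          cmod (B n x - (\<Sum>\<zeta>\<in>z ` {- int K..int K}. c \<zeta> * ((\<i> * of_real \<zeta>) ^ n * cis (\<zeta> * x))))"
          using tendsto_norm[OF tendsto_diff[OF P[OF x] tendsto_const[of "P K n x"]]]
          by (simp add: sum.reindex[OF inj] P_def)
        show "\<forall>\<^sub>F K' in sequentially. cmod (P K' n x - P K n x) \<le> 1 / N * (h ^ n * fact n powr s)"
          using diff eventually_sequentially by blast
      qed simp
    qed
  qed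
qed

section \<open>Microlocalization\<close>

lemma gevrey_bound_tensor:
  fixes J :: "'n::finite \<Rightarrow> nat \<Rightarrow> real \<Rightarrow> complex"
  assumes "\<And>i. jet (J i)" "\<And>i n x. cmod (J i n x) \<le> C * (h ^ n * fact n powr s)"
  shows "gevrey_bound s h (\<lambda>_. C ^ CARD('n)) (tensor J)"
  unfolding gevrey_bound_def pderivs_tensor[of J, OF assms(1)]
proof (intro allI)
  fix ks :: "'n list" and y :: "real^'n"
  have "cmod (\<Prod>i\<in>UNIV. J i (count_list ks i) (y $ i)) \<le> (\<Prod>i\<in>UNIV. C * (h ^ count_list ks i * fact (count_list ks i) powr s))"
    unfolding prod_norm[symmetric] by (intro prod_mono conjI assms(2)) simp
  also have "\<dots> = C ^ CARD('n) * (h ^ length ks * mfact (count_list ks) powr s)"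
    by (simp add: prod.distrib mfact_powr flip: power_msize msize_count_list)
  finally show "cmod (\<Prod>i\<in>UNIV. J i (count_list ks i) (y $ i)) \<le> C ^ CARD('n) * (h ^ length ks * mfact (count_list ks) powr s)" .
qed

section \<open>Modulated test functions and the growth of functionals on them\<close>

definition cis_jet :: "real \<Rightarrow> nat \<Rightarrow> real \<Rightarrow> complex" where
  "cis_jet \<zeta> n x = (\<i> * of_real \<zeta>) ^ n * cis (\<zeta> * x)"

lemma jet_cis_jet: "jet (cis_jet \<zeta>)"
  unfolding jet_def
proof (intro allI)
  fix n x
  from has_vector_derivative_mult_right[OF has_vector_derivative_cis[of \<zeta> x UNIV], of "(\<i> * of_real \<zeta>) ^ n"]
  show "(cis_jet \<zeta> n has_vector_derivative cis_jet \<zeta> (Suc n) x) (at x)"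
    by (simp add: cis_jet_def[abs_def] mult_ac)
qed

lemma exp_inner_eq_tensor: "exp (\<i> * complex_of_real (y \<bullet> \<xi>)) = tensor (\<lambda>i. cis_jet (\<xi> $ i)) y"
  by (simp add: tensor_def cis_jet_def cis_conv_exp inner_vec_def sum_distrib_left exp_sum mult_ac)

lemma smooth_fun_exp_inner: "smooth_fun (\<lambda>y. exp (\<i> * complex_of_real (y \<bullet> \<xi>)))"
  using smooth_fun_tensor[of "\<lambda>i. cis_jet (\<xi> $ i)"] jet_cis_jet by (simp add: exp_inner_eq_tensor)

text \<open>In modulus the derivatives are monomials in \<open>\<xi>\<close>, so
  \<open>abs_mpow_le\<close> applies with order \<open>s\<close>: a high frequency costs an
  exponential weight in frequency.\<close>

lemma gevrey_bound_exp_inner: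
  assumes "h > 0" "s > 0"
  shows "gevrey_bound s h (\<lambda>_. exp (s * h powr (- 1 / s) * wt s \<xi>)) (\<lambda>y. exp (\<i> * complex_of_real (y \<bullet> \<xi>)))"
  unfolding gevrey_bound_def exp_inner_eq_tensor pderivs_tensor[of "\<lambda>i. cis_jet (\<xi> $ i)", OF jet_cis_jet]
proof (intro allI)
  fix ks :: "'a list" and y :: "real^'a"
  have "cmod (\<Prod>i\<in>UNIV. cis_jet (\<xi> $ i) (count_list ks i) (y $ i)) = \<bar>mpow \<xi> (count_list ks)\<bar>"
    by (simp add: cis_jet_def norm_mult norm_power abs_mpow flip: prod_norm)
  also have "\<dots> \<le> exp (s * h powr (- 1 / s) * wt s \<xi>) * (h ^ length ks * mfact (count_list ks) powr s)"
    using abs_mpow_le[OF assms, of \<xi> "count_list ks"] by (simp add: msize_count_list mult_ac)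
  finally show "cmod (\<Prod>i\<in>UNIV. cis_jet (\<xi> $ i) (count_list ks i) (y $ i)) \<le>
      exp (s * h powr (- 1 / s) * wt s \<xi>) * (h ^ length ks * mfact (count_list ks) powr s)" .
qed

lemma GS_space_translate:
  assumes f: "f \<in> GS_space t s" and t: "t \<ge> 1"
  shows "translate a f \<in> GS_space t s"
proof (rule GS_spaceI_bound)
  note sm = GS_space_smooth[OF f]
  show "smooth_fun (translate a f)" by (rule smooth_fun_translate[OF sm])
  fix h R :: real assume h: "h > 0" and R: "R > 0"
  obtain M where M: "M \<ge> 0" "gevrey_bound s h (\<lambda>y. M * exp (- R * wt t y)) f"
    using GS_spaceD_bound[OF f h R] t by auto
  have "gevrey_bound s h (\<lambda>y. M * exp (- R * wt t (y - a))) (translate a f)"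
    using M(2) unfolding gevrey_bound_def pderivs_translate[OF sm] by (simp add: translate_def)
  then have "gevrey_bound s h (\<lambda>y. M * exp (R * wt t a) * exp (- R * wt t y)) (translate a f)"
  proof (rule gevrey_bound_mono)
    fix y
    have "wt t y \<le> wt t (y - a) + wt t a" using wt_add_le[OF t, of "y - a" a] by simp
    then have "R * wt t y \<le> R * wt t (y - a) + R * wt t a"
      using R by (metis distrib_left less_imp_le mult_left_mono)
    then have "exp (- R * wt t (y - a)) \<le> exp (R * wt t a + - R * wt t y)" by simp
    then show "M * exp (- R * wt t (y - a)) \<le> M * exp (R * wt t a) * exp (- R * wt t y)"
      using M(1) unfolding exp_add mult.assoc by (intro mult_left_mono)
  qed (use M h in auto)
  then show "\<exists>M\<ge>0. gevrey_bound s h (\<lambda>y. M * exp (- R * wt t y)) (translate a f)"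
    using M(1) by (intro exI[of _ "M * exp (R * wt t a)"]) simp
qed (use t in simp)

text \<open>The surplus decay \<open>\<delta>\<close> of one factor pays for the growth of the
  other; \<open>\<delta>\<close> is 0 for exponentials and cutoffs and 1 for truncation
  errors.\<close>

lemma gevrey_bound_mult_exp_wt:
  assumes "smooth_fun f1" "smooth_fun f2" "0 \<le> h" "0 \<le> s" "0 \<le> M" "0 \<le> Q"
    and "gevrey_bound s h (\<lambda>y. M * exp (- (R + \<delta>) * wt t y)) f1"
    and "gevrey_bound s h (\<lambda>y. Q * exp (\<delta> * wt t y)) f2"
  shows "gevrey_bound s (2 * h) (\<lambda>y. M * Q * exp (- R * wt t y)) (\<lambda>y. f1 y * f2 y)"
proof -
  have "gevrey_bound s (2 * h) (\<lambda>y. (M * exp (- (R + \<delta>) * wt t y)) * (Q * exp (\<delta> * wt t y))) (\<lambda>y. f1 y * f2 y)"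
    by (rule gevrey_bound_mult) (use assms in auto)
  also have "(\<lambda>y. (M * exp (- (R + \<delta>) * wt t y)) * (Q * exp (\<delta> * wt t y))) = (\<lambda>y. M * Q * exp (- R * wt t y))"
    by (simp add: algebra_simps flip: exp_add)
  finally show ?thesis .
qed

lemma GS_space_mult:
  assumes f: "f \<in> GS_space t s" and g: "smooth_fun g" and ts: "t > 0" "s \<ge> 0" "\<delta> \<ge> 0"
    and b: "\<And>h. h > 0 \<Longrightarrow> \<exists>Q\<ge>0. gevrey_bound s h (\<lambda>y. Q * exp (\<delta> * wt t y)) g"
  shows "(\<lambda>y. f y * g y) \<in> GS_space t s"
proof (rule GS_spaceI_bound[OF _ ts(1)])
  note sm = GS_space_smooth[OF f]
  show "smooth_fun (\<lambda>y. f y * g y)" by (rule smooth_fun_mult[OF sm g])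
  fix h R :: real assume h: "h > 0" and R: "R > 0"
  obtain Q where Q: "Q \<ge> 0" "gevrey_bound s (h / 2) (\<lambda>y. Q * exp (\<delta> * wt t y)) g"
    using b[of "h / 2"] h by auto
  obtain M where M: "M \<ge> 0" "gevrey_bound s (h / 2) (\<lambda>y. M * exp (- (R + \<delta>) * wt t y)) f"
    by (rule GS_spaceD_bound[OF f _ _ ts(1), of "h / 2" "R + \<delta>"]) (use h R ts in auto)
  have "gevrey_bound s (2 * (h / 2)) (\<lambda>y. M * Q * exp (- R * wt t y)) (\<lambda>y. f y * g y)"
    by (rule gevrey_bound_mult_exp_wt[OF sm g _ ts(2) M(1) Q(1) M(2) Q(2)]) (use h in simp)
  then show "\<exists>M\<ge>0. gevrey_bound s h (\<lambda>y. M * exp (- R * wt t y)) (\<lambda>y. f y * g y)"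
    using M Q by (intro exI[of _ "M * Q"]) simp
qed

lemma modulate_eq_mult: "modulate \<xi> w = (\<lambda>y. w y * exp (\<i> * complex_of_real (y \<bullet> \<xi>)))"
  by (simp add: modulate_def mult.commute)

lemma modulate_in_GS_space:
  assumes "w \<in> GS_space t s" "t > 0" "s > 0"
  shows "modulate \<xi> w \<in> GS_space t s"
  unfolding modulate_eq_mult
proof (rule GS_space_mult[OF assms(1) smooth_fun_exp_inner assms(2), of 0])
  fix h :: real assume "h > 0"
  from gevrey_bound_exp_inner[OF this assms(3), of \<xi>]
  show "\<exists>Q\<ge>0. gevrey_bound s h (\<lambda>y. Q * exp (0 * wt t y)) (\<lambda>y. exp (\<i> * complex_of_real (y \<bullet> \<xi>)))"
    by (intro exI[of _ "exp (s * h powr (- 1 / s) * wt s \<xi>)"]) simp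
qed (use assms in auto)

text \<open>A priori growth of the short-time Fourier transform over one base point: modulation
  changes only the constant in the bound for \<open>w\<close>, by an exponential weight in
  \<open>\<eta>\<close>.\<close>

lemma GS_dual_modulate_bound:
  assumes u: "u \<in> GS_dual t s" and w: "w \<in> GS_space t s" and ts: "t > 0" "s > 0"
  obtains C r where "C \<ge> 0" "r > 0" "\<And>\<eta>. cmod (u (modulate \<eta> w)) \<le> C * exp (r * wt s \<eta>)"
proof -
  obtain h R C where h: "h > 0" and R: "R > 0" and C: "C \<ge> 0" and
    u: "\<And>f M. f \<in> GS_space t s \<Longrightarrow> 0 \<le> M \<Longrightarrow> gevrey_bound s h (\<lambda>y. M * exp (- R * wt t y)) f \<Longrightarrow> cmod (u f) \<le> C * M"
    using GS_dual_bound[OF u ts(1)] by blast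
  obtain M where M: "M \<ge> 0" "gevrey_bound s (h / 2) (\<lambda>y. M * exp (- R * wt t y)) w"
    by (rule GS_spaceD_bound[OF w _ R ts(1), of "h / 2"]) (use h in auto)
  define r where "r = s * (h / 2) powr (- 1 / s)"
  show ?thesis
  proof (rule that)
    show "C * M \<ge> 0" "r > 0" using C M ts h by (auto simp: r_def)
    fix \<eta>
    have "gevrey_bound s (2 * (h / 2)) (\<lambda>y. M * exp (r * wt s \<eta>) * exp (- R * wt t y)) (modulate \<eta> w)"
      unfolding modulate_eq_mult
      by (rule gevrey_bound_mult_exp_wt[where \<delta> = 0])
         (use gevrey_bound_exp_inner[of "h / 2" s \<eta>] M h ts GS_space_smooth[OF w] smooth_fun_exp_inner in \<open>auto simp: r_def\<close>)
    then have "cmod (u (modulate \<eta> w)) \<le> C * (M * exp (r * wt s \<eta>))"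
      using M by (intro u modulate_in_GS_space[OF w ts]) auto
    then show "cmod (u (modulate \<eta> w)) \<le> C * M * exp (r * wt s \<eta>)" by (simp add: mult.assoc)
  qed
qed

lemma GS_space_sum:
  assumes "finite S" "\<And>i. i \<in> S \<Longrightarrow> f i \<in> GS_space t s" "t > 0"
  shows "(\<lambda>x. \<Sum>i\<in>S. c i * f i x) \<in> GS_space t s"
  using assms(1,2)
  by (induction S) (simp_all add: GS_space_zero GS_space_add GS_space_cmult assms(3))

lemma GS_dual_add:
  "u \<in> GS_dual t s \<Longrightarrow> f \<in> GS_space t s \<Longrightarrow> g \<in> GS_space t s \<Longrightarrow> u (\<lambda>x. f x + g x) = u f + u g"
  unfolding GS_dual_def by blast

lemma GS_dual_cmult:
  "u \<in> GS_dual t s \<Longrightarrow> f \<in> GS_space t s \<Longrightarrow> u (\<lambda>x. c * f x) = cnj c * u f"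
  unfolding GS_dual_def by blast

lemma GS_dual_sum:
  assumes u: "u \<in> GS_dual t s" and "finite S" "\<And>i. i \<in> S \<Longrightarrow> f i \<in> GS_space t s" and t: "t > 0"
  shows "u (\<lambda>x. \<Sum>i\<in>S. c i * f i x) = (\<Sum>i\<in>S. cnj (c i) * u (f i))"
  using assms(2,3)
proof (induction S)
  case empty
  show ?case using GS_dual_cmult[OF u GS_space_zero[OF t], of 0] by simp
next
  case (insert i S)
  have "u (\<lambda>x. c i * f i x + (\<Sum>i\<in>S. c i * f i x)) = u (\<lambda>x. c i * f i x) + u (\<lambda>x. \<Sum>i\<in>S. c i * f i x)"
    using insert t by (intro GS_dual_add[OF u] GS_space_cmult GS_space_sum) auto
  moreover have "u (\<lambda>x. c i * f i x) = cnj (c i) * u (f i)"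
    using insert.prems by (intro GS_dual_cmult[OF u]) auto
  ultimately show ?case using insert by simp
qed

lemma abs_nth_le_exp_wt:
  assumes "t > 0" shows "\<bar>y $ i\<bar> \<le> t powr t * exp (wt t y)"
proof -
  \<comment> \<open>The scale \<open>h = t powr t\<close> makes the rate
    \<open>t * h powr (- 1 / t)\<close> equal to 1.\<close>
  have "\<bar>y $ i\<bar> ^ 1 \<le> (t powr t) ^ 1 * fact 1 powr t * exp (t * (t powr t) powr (- 1 / t) * \<bar>y $ i\<bar> powr (1 / t))"
    using assms by (intro power_le_fact_powr_mult_exp) auto
  then have "\<bar>y $ i\<bar> \<le> t powr t * exp (\<bar>y $ i\<bar> powr (1 / t))"
    using assms by (simp add: powr_powr powr_minus)
  also have "\<dots> \<le> t powr t * exp (wt t y)"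
    unfolding wt_def by (intro mult_left_mono exp_le_cancel_iff[THEN iffD2] member_le_sum) auto
  finally show ?thesis .
qed

text \<open>Dividing by \<open>q i\<close> brings all factors into the unit disc, where a difference
  of products is at most the sum of the differences.\<close>

lemma norm_prod_diff_le:
  fixes z w :: "'i::finite \<Rightarrow> complex"
  assumes "\<And>i. cmod (z i) \<le> q i" "\<And>i. cmod (w i) \<le> q i" "\<And>i. cmod (z i - w i) \<le> e * q i" "\<And>i. q i > 0"
  shows "cmod ((\<Prod>i\<in>UNIV. z i) - (\<Prod>i\<in>UNIV. w i)) \<le> real CARD('i) * e * (\<Prod>i\<in>UNIV. q i)"
proof -
  have q: "\<bar>q i\<bar> = q i" for i using assms(4)[of i] by simp
  have "cmod ((\<Prod>i\<in>UNIV. z i / of_real (q i)) - (\<Prod>i\<in>UNIV. w i / of_real (q i))) \<le>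
      (\<Sum>i\<in>UNIV. cmod (z i / of_real (q i) - w i / of_real (q i)))"
    using assms by (intro norm_prod_diff) (auto simp: norm_divide q divide_le_eq)
  also have "\<dots> \<le> (\<Sum>i\<in>(UNIV :: 'i set). e)"
    using assms by (intro sum_mono) (simp add: norm_divide q divide_le_eq flip: diff_divide_distrib)
  also have "(\<Prod>i\<in>UNIV. z i / of_real (q i)) - (\<Prod>i\<in>UNIV. w i / of_real (q i)) =
      ((\<Prod>i\<in>UNIV. z i) - (\<Prod>i\<in>UNIV. w i)) / of_real (\<Prod>i\<in>UNIV. q i)"
    by (simp add: prod_dividef diff_divide_distrib)
  finally have "cmod ((\<Prod>i\<in>UNIV. z i) - (\<Prod>i\<in>UNIV. w i)) / (\<Prod>i\<in>UNIV. q i) \<le> CARD('i) * e"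
    using assms(4) by (simp add: norm_divide prod_nonneg less_imp_le del: of_real_prod)
  then show ?thesis
    using assms(4) by (simp add: divide_le_eq prod_pos)
qed

text \<open>Inside the box of half-width \<open>N\<close> both products are close; outside, the weight \<open>exp (wt t y)\<close>
  makes up for the factor \<open>1 / N\<close>.\<close>

lemma gevrey_bound_tensor_diff:
  fixes J1 J2 :: "'n::finite \<Rightarrow> nat \<Rightarrow> real \<Rightarrow> complex" and x0 :: "real^'n"
  assumes J: "\<And>i. jet (J1 i)" "\<And>i. jet (J2 i)" and h: "h > 0" and t: "t > 0" and N: "N \<ge> 1" and D: "D \<ge> 1"
    and b: "\<And>i n x. cmod (J1 i n x) \<le> D * (h ^ n * fact n powr s)"
      "\<And>i n x. cmod (J2 i n x) \<le> D * (h ^ n * fact n powr s)"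
    and near: "\<And>i n x. \<bar>x - x0 $ i\<bar> \<le> N \<Longrightarrow> cmod (J1 i n x - J2 i n x) \<le> 1 / N * (h ^ n * fact n powr s)"
  shows "gevrey_bound s h (\<lambda>y. (D ^ CARD('n) * (real CARD('n) + 2 * (norm x0 + t powr t)) / N) * exp (1 * wt t y))
    (\<lambda>y. tensor J1 y - tensor J2 y)"
  unfolding gevrey_bound_def pderivs_diff[OF smooth_fun_tensor[of J1, OF J(1)] smooth_fun_tensor[of J2, OF J(2)]]
    pderivs_tensor[of J1, OF J(1)] pderivs_tensor[of J2, OF J(2)]
proof (intro allI)
  fix ks :: "'n list" and y :: "real^'n"
  let ?d = "real CARD('n)" and ?X = "norm x0 + t powr t"
  define z where "z i = J1 i (count_list ks i) (y $ i)" for i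
  define w where "w i = J2 i (count_list ks i) (y $ i)" for i
  define q where "q i = D * (h ^ count_list ks i * fact (count_list ks i) powr s)" for i
  define P where "P = h ^ length ks * mfact (count_list ks) powr s"
  have P: "P > 0" unfolding P_def using h mfact_pos[of "count_list ks"] by simp
  have q0: "q i > 0" for i using D h by (simp add: q_def)
  have q: "(\<Prod>i\<in>UNIV. q i) = D ^ CARD('n) * P"
    by (simp add: q_def P_def prod.distrib mfact_powr flip: power_msize msize_count_list)
  have DP: "D ^ CARD('n) * P \<ge> 0" using D P by simp
  have zw: "cmod (z i) \<le> q i" "cmod (w i) \<le> q i" for i
    using b by (auto simp: z_def w_def q_def)
  have e1: "1 \<le> exp (wt t y)" using wt_nonneg[of t y] by simp
  have "cmod ((\<Prod>i\<in>UNIV. z i) - (\<Prod>i\<in>UNIV. w i)) \<le> D ^ CARD('n) * P * ((?d + 2 * ?X) / N * exp (wt t y))"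
  proof (cases "\<forall>i. \<bar>y $ i - x0 $ i\<bar> \<le> N")
    case True
    have "cmod (z i - w i) \<le> 1 / N * q i" for i
    proof -
      have "cmod (z i - w i) \<le> 1 / N * (1 * (h ^ count_list ks i * fact (count_list ks i) powr s))"
        using near True by (simp add: z_def w_def)
      also have "\<dots> \<le> 1 / N * q i" unfolding q_def using D N h by (intro mult_left_mono mult_right_mono) auto
      finally show ?thesis .
    qed
    from norm_prod_diff_le[of z q w, OF zw this q0]
    have "cmod ((\<Prod>i\<in>UNIV. z i) - (\<Prod>i\<in>UNIV. w i)) \<le> ?d * (1 / N) * (D ^ CARD('n) * P)"
      unfolding q .
    also have "\<dots> = D ^ CARD('n) * P * (?d / N * 1)" by simp
    also have "\<dots> \<le> D ^ CARD('n) * P * ((?d + 2 * ?X) / N * exp (wt t y))"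
      using N e1 DP by (intro mult_left_mono mult_mono divide_right_mono) auto
    finally show ?thesis .
  next
    case False
    then obtain i where i: "N < \<bar>y $ i - x0 $ i\<bar>" by (auto simp: not_le)
    also have "\<dots> \<le> \<bar>y $ i\<bar> + \<bar>x0 $ i\<bar>" by (rule abs_triangle_ineq4)
    also have "\<dots> \<le> t powr t * exp (wt t y) + norm x0 * exp (wt t y)"
      using e1 mult_left_mono[OF e1 norm_ge_zero[of x0]] component_le_norm_cart[of x0 i]
      by (intro add_mono abs_nth_le_exp_wt t) auto
    also have "\<dots> = ?X * exp (wt t y)" by (simp add: algebra_simps)
    finally have 1: "1 \<le> ?X / N * exp (wt t y)" using N by (simp add: field_simps)
    have "cmod ((\<Prod>i\<in>UNIV. z i) - (\<Prod>i\<in>UNIV. w i)) \<le> (\<Prod>i\<in>UNIV. q i) + (\<Prod>i\<in>UNIV. q i)"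
      using zw by (intro order_trans[OF norm_triangle_ineq4] add_mono) (auto simp flip: prod_norm intro!: prod_mono)
    also have "\<dots> = D ^ CARD('n) * P * (2 * 1)" unfolding q by simp
    also have "\<dots> \<le> D ^ CARD('n) * P * (2 * (?X / N * exp (wt t y)))"
      using 1 DP by (intro mult_left_mono) auto
    also have "\<dots> \<le> D ^ CARD('n) * P * ((?d + 2 * ?X) / N * exp (wt t y))"
      using N DP by (intro mult_left_mono) (auto simp: field_simps)
    finally show ?thesis .
  qed
  then show "cmod ((\<Prod>i\<in>UNIV. J1 i (count_list ks i) (y $ i)) - (\<Prod>i\<in>UNIV. J2 i (count_list ks i) (y $ i))) \<le>
     (D ^ CARD('n) * (?d + 2 * ?X) / N) * exp (1 * wt t y) * (h ^ length ks * mfact (count_list ks) powr s)"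
    by (simp add: z_def w_def P_def mult_ac)
qed

lemma jet_shift: "jet J \<Longrightarrow> jet (\<lambda>n x. J n (x - a))"
  unfolding jet_def
proof (intro allI)
  fix n x assume "\<forall>n x. (J n has_vector_derivative J (Suc n) x) (at x)"
  then have "(J n has_vector_derivative J (Suc n) (x - a)) (at (x - a))" by blast
  moreover have "((\<lambda>x. x - a) has_vector_derivative 1) (at x)"
    by (auto intro!: derivative_eq_intros)
  ultimately show "((\<lambda>x. J n (x - a)) has_vector_derivative J (Suc n) (x - a)) (at x)"
    using vector_diff_chain_at[of "\<lambda>x. x - a" 1 x "J n" "J (Suc n) (x - a)"] by (simp add: o_def)
qed

lemma jet_sum: "(\<And>i. i \<in> S \<Longrightarrow> jet (J i)) \<Longrightarrow> jet (\<lambda>n x. \<Sum>i\<in>S. c i * J i n x)"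
  unfolding jet_def by (auto intro!: has_vector_derivative_sum has_vector_derivative_mult_right)


text \<open>Coefficients and weight are both products over the coordinates, so the sum over the grid
  is a product of sums in one variable.\<close>

lemma sum_PiE_prod_le:
  fixes f :: "'n::finite \<Rightarrow> real \<Rightarrow> complex"
  assumes F: "finite F" and le: "\<And>i. (\<Sum>\<zeta>\<in>F. cmod (f i \<zeta>) * exp (r * \<bar>\<zeta>\<bar> powr (1 / s))) \<le> A"
  shows "(\<Sum>g\<in>PiE UNIV (\<lambda>_. F). cmod (\<Prod>i\<in>UNIV. f i (g i)) * exp (r * wt s (vec_lambda g))) \<le> A ^ CARD('n)"
proof -
  have "(\<Sum>g\<in>PiE UNIV (\<lambda>_. F). cmod (\<Prod>i\<in>UNIV. f i (g i)) * exp (r * wt s (vec_lambda g))) =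
      (\<Sum>g\<in>PiE UNIV (\<lambda>_. F). \<Prod>i\<in>UNIV. cmod (f i (g i)) * exp (r * \<bar>g i\<bar> powr (1 / s)))"
    by (simp add: wt_def sum_distrib_left exp_sum prod.distrib flip: prod_norm)
  also have "\<dots> = (\<Prod>i\<in>UNIV. \<Sum>\<zeta>\<in>F. cmod (f i \<zeta>) * exp (r * \<bar>\<zeta>\<bar> powr (1 / s)))"
    by (rule prod_sum_PiE[symmetric]) (use F in auto)
  also have "\<dots> \<le> (\<Prod>i\<in>(UNIV :: 'n set). A)"
    using le by (intro prod_mono conjI sum_nonneg) auto
  finally show ?thesis by simp
qed

text \<open>Multiplying out over the coordinates; the shift by \<open>x0\<close> only contributes
  phases to the coefficients.\<close>

lemma tensor_sum_cis:
  fixes x0 :: "real^'n::finite"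
  assumes F: "finite F"
  shows "tensor (\<lambda>i n x. \<Sum>\<zeta>\<in>F. c \<zeta> * cis_jet \<zeta> n (x - x0 $ i)) y =
    (\<Sum>g\<in>PiE UNIV (\<lambda>_. F). (\<Prod>i\<in>UNIV. c (g i) * cis (- (g i * x0 $ i))) * exp (\<i> * complex_of_real (y \<bullet> vec_lambda g)))"
proof -
  have cj: "c \<zeta> * cis_jet \<zeta> 0 (y $ i - x0 $ i) = c \<zeta> * cis (- (\<zeta> * x0 $ i)) * cis (\<zeta> * y $ i)" for \<zeta> i
    by (simp add: cis_jet_def mult.assoc cis_mult algebra_simps)
  have "tensor (\<lambda>i n x. \<Sum>\<zeta>\<in>F. c \<zeta> * cis_jet \<zeta> n (x - x0 $ i)) y =
      (\<Sum>g\<in>PiE UNIV (\<lambda>_. F). \<Prod>i\<in>UNIV. c (g i) * cis (- (g i * x0 $ i)) * cis (g i * y $ i))"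
    unfolding tensor_def cj by (rule prod_sum_PiE) (use F in auto)
  then show ?thesis
    by (simp add: prod.distrib exp_inner_eq_tensor tensor_def cis_jet_def)
qed

lemma GS_space_cutoff:
  fixes x0 :: "real^'n::finite"
  assumes f: "f \<in> GS_space t s" and ts: "t > 0" "s > 0" and B: "jet B"
    and bound: "\<And>h. h > 0 \<Longrightarrow> \<exists>C>0. \<forall>n x. cmod (B n x) \<le> C * (h ^ n * fact n powr s)"
  shows "(\<lambda>y. f y * tensor (\<lambda>i n x. B n (x - x0 $ i)) y) \<in> GS_space t s"
proof (rule GS_space_mult[OF f smooth_fun_tensor ts(1), of _ 0])
  show J: "jet (\<lambda>n x. B n (x - x0 $ i))" for i by (rule jet_shift[OF B])
  fix h :: real assume "h > 0"
  then obtain C where "C > 0" "\<forall>n x. cmod (B n x) \<le> C * (h ^ n * fact n powr s)" using bound by blast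
  then show "\<exists>Q\<ge>0. gevrey_bound s h (\<lambda>y. Q * exp (0 * wt t y)) (tensor (\<lambda>i n x. B n (x - x0 $ i)))"
    using gevrey_bound_tensor[of "\<lambda>i n x. B n (x - x0 $ i)", OF J, of C h s]
    by (intro exI[of _ "C ^ CARD('n)"]) simp
qed (use ts in auto)

text \<open>The pairing of \<open>u\<close> with \<open>w e\<^bsup>i\<langle>y, \<xi>\<rangle>\<^esup> \<chi>\<close> is a limit of averages of \<open>\<eta> \<mapsto> (u, w e\<^bsup>i\<langle>y, \<eta>\<rangle>\<^esup>)\<close>
  over \<open>\<eta> = \<xi> + \<zeta>\<close>, where the weights decay as fast as \<open>exp (- r wt s \<zeta>)\<close> for every \<open>r\<close>.\<close>

lemma GS_dual_cutoff_bound: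
  fixes u :: "(real^'n::finite \<Rightarrow> complex) \<Rightarrow> complex" and x0 :: "real^'n"
  assumes u: "u \<in> GS_dual t s" and w: "w \<in> GS_space t s" and ts: "t > 0" "s > 1"
    and B: "jet B" and supp: "\<And>n x. \<bar>x\<bar> \<ge> 1 \<Longrightarrow> B n x = 0"
    and bound: "\<And>h. h > 0 \<Longrightarrow> \<exists>C>0. \<forall>n x. cmod (B n x) \<le> C * (h ^ n * fact n powr s)"
  obtains A :: "real \<Rightarrow> real" where
    "\<And>\<xi> b1 b2 \<kappa>. \<kappa> > 0 \<Longrightarrow> b1 \<ge> 0 \<Longrightarrow> b2 \<ge> 0 \<Longrightarrow>
        (\<And>\<zeta>. cmod (u (modulate (\<xi> + \<zeta>) w)) \<le> b1 + b2 * exp (\<kappa> * wt s \<zeta>)) \<Longrightarrow>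
      cmod (u (\<lambda>y. modulate \<xi> w y * tensor (\<lambda>i n x. B n (x - x0 $ i)) y)) \<le> b1 * A 1 + b2 * A \<kappa>"
proof -
  define J where "J i n x = B n (x - x0 $ i)" for i n x
  have J: "jet (J i)" for i
    using jet_shift[OF B, of "x0 $ i"] by (simp add: J_def[abs_def])
  obtain A where A: "\<And>h N. h > 0 \<Longrightarrow> N \<ge> 1 \<Longrightarrow> \<exists>F c. finite F \<and>
      (\<forall>r>0. (\<Sum>\<zeta>\<in>F. cmod (c \<zeta>) * exp (r * \<bar>\<zeta>\<bar> powr (1 / s))) \<le> A r) \<and>
      (\<forall>n x. \<bar>x\<bar> \<le> N \<longrightarrow> cmod (B n x - (\<Sum>\<zeta>\<in>F. c \<zeta> * ((\<i> * of_real \<zeta>) ^ n * cis (\<zeta> * x)))) \<le> 1 / N * (h ^ n * fact n powr s))"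
    using bump_trig_approx[OF B supp ts(2) bound] by blast
  obtain h R C where h: "h > 0" and R: "R > 0" and C: "C \<ge> 0" and
    ub: "\<And>f M. f \<in> GS_space t s \<Longrightarrow> 0 \<le> M \<Longrightarrow> gevrey_bound s h (\<lambda>y. M * exp (- R * wt t y)) f \<Longrightarrow> cmod (u f) \<le> C * M"
    using GS_dual_bound[OF u ts(1)] by blast
  \<comment> \<open>Multiplication doubles the scale, so the factors are estimated at half the scale
    of \<open>u\<close>.\<close>
  define h0 where "h0 = h / 2"
  have h0: "h0 > 0" "2 * h0 = h" using h by (auto simp: h0_def)
  have modw: "modulate \<xi> w \<in> GS_space t s" for \<xi>
    by (rule modulate_in_GS_space[OF w]) (use ts in auto)
  obtain CB where CB: "CB > 0" "\<And>n x. cmod (B n x) \<le> CB * (h0 ^ n * fact n powr s)"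
    using bound[OF h0(1)] by blast
  define r0 where "r0 = s * h0 powr (- 1 / s)"
  have r0: "r0 > 0" using ts h0 by (simp add: r0_def)
  \<comment> \<open>One constant for the bump and, through \<open>A r0\<close>, for all its
    trigonometric approximations, independent of \<open>N\<close>.\<close>
  define D where "D = max 1 (max CB (A r0))"
  have D: "D \<ge> 1" "CB \<le> D" "A r0 \<le> D" by (auto simp: D_def)
  define Q where "Q = D ^ CARD('n) * (real CARD('n) + 2 * (norm x0 + t powr t))"
  have Q: "Q \<ge> 0" using D by (simp add: Q_def)
  have ftensor: "(\<lambda>y. modulate \<xi> w y * tensor J y) \<in> GS_space t s" for \<xi>
    unfolding J_def[abs_def] by (rule GS_space_cutoff[OF modw ts(1) _ B bound]) (use ts in auto)
  show ?thesis
  proof (rule that[of "\<lambda>r. A r ^ CARD('n)"])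
    fix \<xi> :: "real^'n" and b1 b2 \<kappa> :: real
    assume \<kappa>: "\<kappa> > 0" and b: "b1 \<ge> 0" "b2 \<ge> 0" and
      G: "\<And>\<zeta>. cmod (u (modulate (\<xi> + \<zeta>) w)) \<le> b1 + b2 * exp (\<kappa> * wt s \<zeta>)"
    let ?H = "u (\<lambda>y. modulate \<xi> w y * tensor J y)"
    \<comment> \<open>One unit of decay beyond the rate \<open>R\<close> of \<open>u\<close> offsets
      the weight \<open>exp (1 * wt t y)\<close> in \<open>gevrey_bound_tensor_diff\<close>.\<close>
    obtain M where M: "M \<ge> 0" "gevrey_bound s h0 (\<lambda>y. M * exp (- (R + 1) * wt t y)) (modulate \<xi> w)"
      by (rule GS_spaceD_bound[OF modw[of \<xi>] h0(1) _ ts(1), of "R + 1"]) (use R in auto)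
    have main: "cmod ?H \<le> (b1 * A 1 ^ CARD('n) + b2 * A \<kappa> ^ CARD('n)) + C * (M * Q) / real (Suc N)" for N
    proof -
      obtain F c where F: "finite F"
        and FA: "\<And>r. r > 0 \<Longrightarrow> (\<Sum>\<zeta>\<in>F. cmod (c \<zeta>) * exp (r * \<bar>\<zeta>\<bar> powr (1 / s))) \<le> A r"
        and FN: "\<And>n x. \<bar>x\<bar> \<le> real (Suc N) \<Longrightarrow>
          cmod (B n x - (\<Sum>\<zeta>\<in>F. c \<zeta> * ((\<i> * of_real \<zeta>) ^ n * cis (\<zeta> * x)))) \<le> 1 / real (Suc N) * (h0 ^ n * fact n powr s)"
        using A[OF h0(1), of "real (Suc N)"] by auto
      define J' where "J' i n x = (\<Sum>\<zeta>\<in>F. c \<zeta> * cis_jet \<zeta> n (x - x0 $ i))" for i n x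
      have J': "jet (J' i)" for i
        unfolding J'_def[abs_def] by (rule jet_sum[OF jet_shift[OF jet_cis_jet]])
      have cj: "cmod (c \<zeta> * cis_jet \<zeta> n x) \<le> cmod (c \<zeta>) * exp (r * \<bar>\<zeta>\<bar> powr (1 / s)) * (k ^ n * fact n powr s)"
        if "k > 0" "r = s * k powr (- 1 / s)" for \<zeta> n x k r
      proof -
        have "\<bar>\<zeta>\<bar> ^ n \<le> k ^ n * fact n powr s * exp (s * k powr (- 1 / s) * \<bar>\<zeta>\<bar> powr (1 / s))"
          using that ts by (intro power_le_fact_powr_mult_exp) auto
        from mult_left_mono[OF this, of "cmod (c \<zeta>)"] show ?thesis
          by (simp add: cis_jet_def norm_mult norm_power that mult_ac)
      qed
      have J'b: "cmod (J' i n x) \<le> A r * (k ^ n * fact n powr s)"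
        if "k > 0" "r = s * k powr (- 1 / s)" for i n x k r
      proof -
        have "cmod (J' i n x) \<le> (\<Sum>\<zeta>\<in>F. cmod (c \<zeta>) * exp (r * \<bar>\<zeta>\<bar> powr (1 / s)) * (k ^ n * fact n powr s))"
          unfolding J'_def using cj[OF that] by (intro order_trans[OF norm_sum] sum_mono) auto
        also have "\<dots> \<le> A r * (k ^ n * fact n powr s)"
          unfolding sum_distrib_right[symmetric] using that ts by (intro mult_right_mono FA) auto
        finally show ?thesis .
      qed
      define S where "S = PiE (UNIV :: 'n set) (\<lambda>_. F)"
      have S: "finite S" unfolding S_def using F by (intro finite_PiE) auto
      define a :: "('n \<Rightarrow> real) \<Rightarrow> complex" where "a g = (\<Prod>i\<in>UNIV. c (g i) * cis (- (g i * x0 $ i)))" for g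
      have Pu: "(\<lambda>y. modulate \<xi> w y * tensor J' y) = (\<lambda>y. \<Sum>g\<in>S. a g * modulate (\<xi> + vec_lambda g) w y)"
      proof
        fix y
        have "exp (\<i> * complex_of_real (y \<bullet> (\<xi> + v))) = exp (\<i> * complex_of_real (y \<bullet> \<xi>)) * exp (\<i> * complex_of_real (y \<bullet> v))" for v
          by (simp add: inner_add_right distrib_left exp_add)
        then show "modulate \<xi> w y * tensor J' y = (\<Sum>g\<in>S. a g * modulate (\<xi> + vec_lambda g) w y)"
          unfolding J'_def[abs_def] tensor_sum_cis[OF F]
          by (simp add: S_def a_def modulate_def sum_distrib_left mult_ac)
      qed
      have "u (\<lambda>y. modulate \<xi> w y * tensor J' y) = (\<Sum>g\<in>S. cnj (a g) * u (modulate (\<xi> + vec_lambda g) w))"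
        unfolding Pu by (rule GS_dual_sum[OF u S modw ts(1)])
      also have "cmod \<dots> \<le> (\<Sum>g\<in>S. b1 * (cmod (a g) * exp (1 * wt s (vec_lambda g))) + b2 * (cmod (a g) * exp (\<kappa> * wt s (vec_lambda g))))"
      proof (intro order_trans[OF norm_sum] sum_mono)
        fix g :: "'n \<Rightarrow> real"
        \<comment> \<open>\<open>FA\<close> concerns positive rates, so the constant part
          \<open>b1\<close> is weighted at rate 1; this is the origin of \<open>A 1\<close>.\<close>
        have "1 \<le> exp (1 * wt s (vec_lambda g))" using wt_nonneg[of s "vec_lambda g"] by simp
        then have "b1 \<le> b1 * exp (1 * wt s (vec_lambda g))" using b(1) mult_left_mono by fastforce
        then have "cmod (u (modulate (\<xi> + vec_lambda g) w)) \<le> b1 * exp (1 * wt s (vec_lambda g)) + b2 * exp (\<kappa> * wt s (vec_lambda g))"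
          using G[of "vec_lambda g"] by linarith
        from mult_left_mono[OF this, of "cmod (a g)"]
        show "cmod (cnj (a g) * u (modulate (\<xi> + vec_lambda g) w)) \<le>
            b1 * (cmod (a g) * exp (1 * wt s (vec_lambda g))) + b2 * (cmod (a g) * exp (\<kappa> * wt s (vec_lambda g)))"
          by (simp add: norm_mult distrib_left mult_ac)
      qed
      also have "\<dots> = b1 * (\<Sum>g\<in>S. cmod (a g) * exp (1 * wt s (vec_lambda g))) + b2 * (\<Sum>g\<in>S. cmod (a g) * exp (\<kappa> * wt s (vec_lambda g)))"
        by (simp add: sum.distrib sum_distrib_left)
      also have "\<dots> \<le> b1 * A 1 ^ CARD('n) + b2 * A \<kappa> ^ CARD('n)"
        unfolding S_def a_def using b \<kappa> FA FA[of 1]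
        by (intro add_mono mult_left_mono sum_PiE_prod_le[OF F]) (auto simp: norm_mult)
      finally have P: "cmod (u (\<lambda>y. modulate \<xi> w y * tensor J' y)) \<le> b1 * A 1 ^ CARD('n) + b2 * A \<kappa> ^ CARD('n)" .
      have E: "gevrey_bound s h0 (\<lambda>y. (D ^ CARD('n) * (real CARD('n) + 2 * (norm x0 + t powr t)) / real (Suc N)) * exp (1 * wt t y))
          (\<lambda>y. tensor J y - tensor J' y)"
      proof (rule gevrey_bound_tensor_diff[OF J J' h0(1) ts(1) _ D(1)])
        fix i n x
        have q: "0 \<le> h0 ^ n * fact n powr s" using h0 by simp
        show "cmod (J i n x) \<le> D * (h0 ^ n * fact n powr s)"
          unfolding J_def using CB(2)[of n "x - x0 $ i"] mult_right_mono[OF D(2) q] by linarith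
        show "cmod (J' i n x) \<le> D * (h0 ^ n * fact n powr s)"
          using J'b[OF h0(1) r0_def, of i n x] mult_right_mono[OF D(3) q] by linarith
        show "cmod (J i n x - J' i n x) \<le> 1 / real (Suc N) * (h0 ^ n * fact n powr s)" if "\<bar>x - x0 $ i\<bar> \<le> real (Suc N)"
          using FN[OF that, of n] by (simp add: J_def J'_def cis_jet_def)
      qed simp
      let ?E = "\<lambda>y. modulate \<xi> w y * (tensor J y - tensor J' y)"
      have smE: "smooth_fun (\<lambda>y. tensor J y - tensor J' y)"
        by (intro smooth_fun_diff smooth_fun_tensor J J')
      have "gevrey_bound s (2 * h0) (\<lambda>y. M * (Q / real (Suc N)) * exp (- R * wt t y)) ?E"
        by (rule gevrey_bound_mult_exp_wt[OF GS_space_smooth[OF modw] smE _ _ M(1) _ M(2)])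
           (use E Q h0 ts in \<open>auto simp: Q_def\<close>)
      moreover have gsP: "(\<lambda>y. modulate \<xi> w y * tensor J' y) \<in> GS_space t s"
        unfolding Pu by (rule GS_space_sum[OF S modw ts(1)])
      moreover have "?E \<in> GS_space t s"
        using GS_space_add[OF ftensor[of \<xi>] GS_space_cmult[OF gsP ts(1), of "-1"] ts(1)]
        by (simp add: right_diff_distrib)
      ultimately have "cmod (u ?E) \<le> C * (M * (Q / real (Suc N)))"
        using M Q h0 by (intro ub) auto
      moreover have "?H = u ?E + u (\<lambda>y. modulate \<xi> w y * tensor J' y)"
        using GS_dual_add[OF u \<open>?E \<in> GS_space t s\<close> gsP] by (simp add: right_diff_distrib)
      ultimately show ?thesis
        using P norm_triangle_ineq[of "u ?E" "u (\<lambda>y. modulate \<xi> w y * tensor J' y)"] by simp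
    qed
    have "(\<lambda>N. (b1 * A 1 ^ CARD('n) + b2 * A \<kappa> ^ CARD('n)) + C * (M * Q) / real (Suc N)) \<longlonglongrightarrow>
        (b1 * A 1 ^ CARD('n) + b2 * A \<kappa> ^ CARD('n)) + 0"
      by (intro tendsto_add tendsto_const LIMSEQ_Suc[OF lim_const_over_n])
    then have "cmod ?H \<le> (b1 * A 1 ^ CARD('n) + b2 * A \<kappa> ^ CARD('n)) + 0"
      by (rule tendsto_lowerbound) (use main in auto)
    then show "cmod (u (\<lambda>y. modulate \<xi> w y * tensor (\<lambda>i n x. B n (x - x0 $ i)) y)) \<le>
        b1 * A 1 ^ CARD('n) + b2 * A \<kappa> ^ CARD('n)"
      by (simp add: J_def[abs_def])
  qed
qed


text \<open>The conjugate anticipates \<open>udist_mult\<close>, which conjugates the cutoff; the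
  scalar will normalize the value at \<open>x0\<close>.\<close>

lemma Gevrey_c_cutoff:
  fixes w :: "real^'n::finite \<Rightarrow> complex"
  assumes w: "w \<in> GS_space t s" and ts: "t > 0" "s > 0"
    and B: "jet B" and supp: "\<And>n x. \<bar>x\<bar> \<ge> 1 \<Longrightarrow> B n x = 0"
    and bound: "\<And>h. h > 0 \<Longrightarrow> \<exists>C>0. \<forall>n x. cmod (B n x) \<le> C * (h ^ n * fact n powr s)"
  shows "(\<lambda>y. cnj (\<kappa> * (w y * tensor (\<lambda>i n x. B n (x - x0 $ i)) y))) \<in> Gevrey_c s"
proof -
  define J where "J i n x = B n (x - x0 $ i)" for i :: 'n and n x
  have J: "jet (J i)" for i
    using jet_shift[OF B, of "x0 $ i"] by (simp add: J_def[abs_def])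
  let ?f = "\<lambda>y. w y * tensor J y" and ?\<phi> = "\<lambda>y. cnj (\<kappa> * (w y * tensor J y))"
  note smw = GS_space_smooth[OF w] and smJ = smooth_fun_tensor[of J, OF J]
  note smf = smooth_fun_mult[OF smw smJ]
  have L: "bounded_linear (\<lambda>z. cnj (\<kappa> * z))"
    by (rule bounded_linear_compose[OF bounded_linear_cnj bounded_linear_mult_right])
  have "\<exists>C>0. \<forall>x\<in>K. \<forall>\<alpha>. cmod (mderiv \<alpha> ?\<phi> x) \<le> C * h ^ msize \<alpha> * mfact \<alpha> powr s" if h: "h > 0" for K h
  proof -
    from bound[of "h / 2"] h obtain C where C: "C > 0" "\<forall>n x. cmod (B n x) \<le> C * ((h / 2) ^ n * fact n powr s)"
      by auto
    then have bJ: "gevrey_bound s (h / 2) (\<lambda>_. C ^ CARD('n)) (tensor J)"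
      by (intro gevrey_bound_tensor[of J, OF J]) (simp add: J_def)
    obtain M where M: "M \<ge> 0" "gevrey_bound s (h / 2) (\<lambda>y. M * exp (- 1 * wt t y)) w"
      by (rule GS_spaceD_bound[OF w _ _ ts(1), of "h / 2" 1]) (use h in auto)
    have "gevrey_bound s (h / 2) (\<lambda>_. M) w"
      by (rule gevrey_bound_mono[OF M(2)]) (use M(1) h in \<open>auto intro!: mult_left_le simp: wt_nonneg\<close>)
    then have b: "gevrey_bound s (2 * (h / 2)) (\<lambda>_. M * C ^ CARD('n)) ?f"
      by (rule gevrey_bound_mult[OF smw smJ _ bJ]) (use M C h ts in auto)
    \<comment> \<open>The summand 1 keeps the constant positive even if \<open>\<kappa>\<close> or
      \<open>M\<close> is 0.\<close>
    define Z where "Z = cmod \<kappa> * (M * C ^ CARD('n)) + 1"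
    have Z: "Z > 0" using M C by (simp add: Z_def add_nonneg_pos)
    show ?thesis
    proof (intro exI[of _ Z] conjI ballI allI Z)
      fix x and \<alpha> :: "'n mindex"
      obtain ks where ks: "count_list ks = \<alpha>" using ex_count_list[of \<alpha>] by auto
      let ?q = "h ^ length ks * mfact (count_list ks) powr s"
      have "cmod (pderivs ks ?\<phi> x) = cmod \<kappa> * cmod (pderivs ks ?f x)"
        unfolding pderivs_bounded_linear[OF smf L] by (simp add: norm_mult)
      also have "\<dots> \<le> cmod \<kappa> * (M * C ^ CARD('n) * ?q)"
        using gevrey_boundD[OF b, of ks x] by (intro mult_left_mono) auto
      also have "\<dots> \<le> Z * ?q"
        unfolding Z_def using h by (simp add: distrib_right mult.assoc)
      finally show "cmod (mderiv \<alpha> ?\<phi> x) \<le> Z * h ^ msize \<alpha> * mfact \<alpha> powr s"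
        unfolding ks[symmetric] mderiv_eq_pderivs[OF smooth_fun_bounded_linear[OF smf L]] msize_count_list
        by (simp add: mult.assoc)
    qed
  qed
  then have "?\<phi> \<in> Gevrey s"
    unfolding Gevrey_def using smooth_fun_bounded_linear[OF smf L] by blast
  moreover have "{x. ?\<phi> x \<noteq> 0} \<subseteq> cbox (\<chi> i. x0 $ i - 1) (\<chi> i. x0 $ i + 1)"
  proof
    fix y assume "y \<in> {x. ?\<phi> x \<noteq> 0}"
    then have "J i 0 (y $ i) \<noteq> 0" for i by (auto simp: tensor_def)
    then have "\<bar>y $ i - x0 $ i\<bar> < 1" for i
      using supp[of "y $ i - x0 $ i" 0] by (force simp: J_def)
    then show "y \<in> cbox (\<chi> i. x0 $ i - 1) (\<chi> i. x0 $ i + 1)"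
      by (auto simp: mem_box_cart abs_less_iff intro: less_imp_le) (smt (verit))+
  qed
  then have "compact (closure {x. ?\<phi> x \<noteq> 0})"
    using bounded_subset[OF bounded_cbox] compact_closure by blast
  ultimately show ?thesis unfolding Gevrey_c_def J_def[abs_def] by blast
qed

text \<open>While \<open>a\<close> and \<open>\<zeta>\<close> are small after rescaling,
  \<open>near\<close> applies. Otherwise \<open>l\<close> is below the constant \<open>l0\<close> or
  at most a multiple of \<open>wt s \<zeta>\<close>; then \<open>exp (k * l)\<close> can be charged
  to \<open>b\<close> or to the weight in \<open>\<zeta>\<close>, and the a priori growth
  \<open>far\<close> suffices.\<close>

lemma WF_bound_imp_shifted_bound:
  fixes \<xi>0 a :: "real^'n::finite" and G :: "real^'n \<Rightarrow> complex"
  assumes ts: "t > 0" "s \<ge> 1" and \<epsilon>: "\<epsilon> > 0" and \<rho>: "\<rho> > 0" and m: "m \<ge> 0"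
    and near: "\<And>l \<eta>. l > 0 \<Longrightarrow> norm a < \<epsilon> * l powr t \<Longrightarrow> norm (\<eta> - \<xi>0) < \<epsilon> \<Longrightarrow>
      cmod (G ((l powr s) *\<^sub>R \<eta>)) \<le> C1 * exp (- \<rho> * l)" and C1: "C1 \<ge> 0"
    and far: "\<And>\<eta>. cmod (G \<eta>) \<le> C0 * exp (r0 * wt s \<eta>)" and C0: "C0 \<ge> 0" "r0 > 0"
  shows "\<exists>b\<ge>0. \<exists>\<kappa>>0. \<forall>l \<xi> \<zeta>. l > 0 \<longrightarrow> wt s \<xi> \<le> m * l \<longrightarrow> norm (\<xi> /\<^sub>R (l powr s) - \<xi>0) < \<epsilon> / 2 \<longrightarrow>
      cmod (G (\<xi> + \<zeta>)) \<le> exp (- \<rho> * l) * (C1 + b * exp (\<kappa> * wt s \<zeta>))"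
proof -
  \<comment> \<open>From \<open>l0\<close> on, \<open>norm a < \<epsilon> * l powr t\<close>: the
    fixed base point has been scaled into the neighbourhood.\<close>
  define l0 where "l0 = (norm a / \<epsilon> + 1) powr (1 / t)"
  \<comment> \<open>Taking the root of order \<open>s\<close> in
    \<open>\<epsilon> / 2 * l powr s \<le> norm \<zeta>\<close> gives
    \<open>c * l \<le> wt s \<zeta>\<close>.\<close>
  define c where "c = (\<epsilon> / 2) powr (1 / s)"
  \<comment> \<open>The loss per unit of \<open>l\<close> when \<open>far\<close> is used: the decay
    \<open>\<rho>\<close> to be produced plus the growth \<open>r0 * m\<close> due to
    \<open>\<xi>\<close>.\<close>
  define k where "k = \<rho> + r0 * m"
  define \<kappa> where "\<kappa> = k / c + r0"
  have c: "c > 0" using \<epsilon> by (simp add: c_def)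
  have k: "k > 0" using \<rho> m C0 by (simp add: k_def add_pos_nonneg)
  have \<kappa>: "\<kappa> > 0" "r0 \<le> \<kappa>" using k c C0 by (auto simp: \<kappa>_def add_pos_pos)
  have l0: "l0 \<ge> 0" by (simp add: l0_def)
  have main: "cmod (G (\<xi> + \<zeta>)) \<le> exp (- \<rho> * l) * (C1 + C0 * exp (k * l0) * exp (\<kappa> * wt s \<zeta>))"
    if l: "l > 0" and m: "wt s \<xi> \<le> m * l" and \<xi>: "norm (\<xi> /\<^sub>R (l powr s) - \<xi>0) < \<epsilon> / 2" for l \<xi> \<zeta>
  proof -
    let ?L = "l powr s"
    have L: "?L > 0" using l by simp
    \<comment> \<open>Both cases that rely on \<open>far\<close> come down to this comparison of
      exponents.\<close>
    have fin: "cmod (G (\<xi> + \<zeta>)) \<le> exp (- \<rho> * l) * (C1 + C0 * exp (k * l0) * exp (\<kappa> * wt s \<zeta>))"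
      if "k * l + r0 * wt s \<zeta> \<le> k * l0 + \<kappa> * wt s \<zeta>"
    proof -
      have "r0 * wt s (\<xi> + \<zeta>) \<le> r0 * (m * l + wt s \<zeta>)"
        using wt_add_le[OF ts(2), of \<xi> \<zeta>] m C0 by (intro mult_left_mono) auto
      also have "\<dots> = - \<rho> * l + (k * l + r0 * wt s \<zeta>)" by (simp add: k_def algebra_simps)
      also have "\<dots> \<le> - \<rho> * l + (k * l0 + \<kappa> * wt s \<zeta>)" using that by simp
      finally have "C0 * exp (r0 * wt s (\<xi> + \<zeta>)) \<le> C0 * (exp (- \<rho> * l) * (exp (k * l0) * exp (\<kappa> * wt s \<zeta>)))"
        unfolding exp_add[symmetric] using C0 by (intro mult_left_mono) auto
      with far[of "\<xi> + \<zeta>"] have "cmod (G (\<xi> + \<zeta>)) \<le> exp (- \<rho> * l) * (C0 * exp (k * l0) * exp (\<kappa> * wt s \<zeta>))"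
        by (simp add: mult_ac)
      also have "\<dots> \<le> exp (- \<rho> * l) * (C1 + C0 * exp (k * l0) * exp (\<kappa> * wt s \<zeta>))"
        using C1 by (intro mult_left_mono) auto
      finally show ?thesis .
    qed
    consider "l \<le> l0" | "l > l0" "norm \<zeta> < \<epsilon> / 2 * ?L" | "\<epsilon> / 2 * ?L \<le> norm \<zeta>" by linarith
    then show "cmod (G (\<xi> + \<zeta>)) \<le> exp (- \<rho> * l) * (C1 + C0 * exp (k * l0) * exp (\<kappa> * wt s \<zeta>))"
    proof cases
      case 1
      then show ?thesis
        using l l0 k \<kappa> wt_nonneg[of s \<zeta>] by (intro fin add_mono mult_mono) auto
    next
      case 2
      have "l0 powr t \<le> l powr t" using 2 l0 ts by (intro powr_mono2) auto
      then have "norm a / \<epsilon> + 1 \<le> l powr t"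
        using ts \<epsilon> by (simp add: l0_def powr_powr add_nonneg_nonneg)
      then have a: "norm a < \<epsilon> * l powr t" using \<epsilon> by (simp add: field_simps)
      have "norm ((\<xi> + \<zeta>) /\<^sub>R ?L - \<xi>0) \<le> norm (\<xi> /\<^sub>R ?L - \<xi>0) + norm (\<zeta> /\<^sub>R ?L)"
        by (rule order_trans[OF _ norm_triangle_ineq]) (simp add: scaleR_right_distrib algebra_simps)
      also have "\<dots> < \<epsilon> / 2 + \<epsilon> / 2"
        using 2 L \<xi> by (intro add_strict_mono) (simp_all add: field_simps)
      finally have "norm ((\<xi> + \<zeta>) /\<^sub>R ?L - \<xi>0) < \<epsilon>" by simp
      from near[OF l a this] have "cmod (G (\<xi> + \<zeta>)) \<le> exp (- \<rho> * l) * C1"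
        using L by (simp add: mult.commute)
      also have "\<dots> \<le> exp (- \<rho> * l) * (C1 + C0 * exp (k * l0) * exp (\<kappa> * wt s \<zeta>))"
        using C0 by (intro mult_left_mono) auto
      finally show ?thesis .
    next
      case 3
      have "c * l = (\<epsilon> / 2 * ?L) powr (1 / s)"
        unfolding c_def using \<epsilon> l ts by (subst powr_mult) (auto simp: powr_powr)
      also have "\<dots> \<le> norm \<zeta> powr (1 / s)" using 3 \<epsilon> ts by (intro powr_mono2) auto
      also have "\<dots> \<le> wt s \<zeta>" by (rule norm_powr_le_wt[OF ts(2)])
      finally have "k * l \<le> k / c * wt s \<zeta>" using k c by (simp add: field_simps)
      moreover have "0 \<le> k * l0" using k l0 by simp
      ultimately show ?thesis by (intro fin) (simp add: \<kappa>_def distrib_right)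
    qed
  qed
  moreover have "C0 * exp (k * l0) \<ge> 0" using C0 by simp
  ultimately show ?thesis using \<kappa>(1) by blast
qed

theorem proposition5p1:
  fixes t s :: real
    and u :: "(real^('n::finite) \<Rightarrow> complex) \<Rightarrow> complex"
    and \<psi> :: "real^'n \<Rightarrow> complex"
  assumes "t \<ge> s" and "s > 1"
    and "u \<in> GS_dual t s"
    and "\<psi> \<in> GS_space t s" and "\<psi> \<noteq> (\<lambda>x. 0)"
  shows "{0} \<times> snd ` Gevrey_WF s u \<subseteq> GS_WF t s \<psi> u"
proof
  fix p :: "(real^'n) \<times> (real^'n)" assume "p \<in> {0} \<times> snd ` Gevrey_WF s u"
  then obtain x0 \<xi>0 where p: "p = (0, \<xi>0)" and WF: "(x0, \<xi>0) \<in> Gevrey_WF s u" by auto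
  have ts: "t > 0" "s > 0" "t \<ge> 1" "s \<ge> 1" using assms by auto
  show "p \<in> GS_WF t s \<psi> u"
  proof (rule ccontr)
    assume "p \<notin> GS_WF t s \<psi> u"
    moreover have \<xi>0: "\<xi>0 \<noteq> 0" using WF by (simp add: Gevrey_WF_def)
    ultimately obtain U where U: "open U" "(0, \<xi>0) \<in> U" and
      Ub: "\<And>r. r > 0 \<Longrightarrow> bdd_above {exp (r * l) * cmod (STFT \<psi> u ((l powr t) *\<^sub>R x) ((l powr s) *\<^sub>R \<xi>)) |l x \<xi>. l > 0 \<and> (x, \<xi>) \<in> U}"
      unfolding p GS_WF_def by (auto simp: zero_prod_def)
    obtain \<epsilon>1 where \<epsilon>1: "\<epsilon>1 > 0" "ball (0, \<xi>0) \<epsilon>1 \<subseteq> U" using U open_contains_ball by blast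
    \<comment> \<open>Half the radius, because the norm of a pair is estimated by the sum of the
      norms.\<close>
    define \<epsilon> where "\<epsilon> = \<epsilon>1 / 2"
    have \<epsilon>: "\<epsilon> > 0" using \<epsilon>1 by (simp add: \<epsilon>_def)
    obtain y0 where y0: "\<psi> y0 \<noteq> 0" using assms(5) by auto
    define a where "a = x0 - y0"
    define w where "w = translate a \<psi>"
    have w: "w \<in> GS_space t s" unfolding w_def by (rule GS_space_translate[OF assms(4) ts(3)])
    define G where "G \<eta> = u (modulate \<eta> w)" for \<eta>
    define K where "K = (2 * pi) powr (- real CARD('n) / 2)"
    have K: "K > 0" by (simp add: K_def)
    obtain C0 r0 where far: "C0 \<ge> 0" "r0 > 0" "\<And>\<eta>. cmod (G \<eta>) \<le> C0 * exp (r0 * wt s \<eta>)"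
      using GS_dual_modulate_bound[OF assms(3) w ts(1,2)] unfolding G_def by blast
    obtain B where B: "jet B" "\<And>n x. \<bar>x\<bar> \<ge> 1 \<Longrightarrow> B n x = 0" "B 0 0 \<noteq> 0"
      "\<And>h. h > 0 \<Longrightarrow> \<exists>C>0. \<forall>n x. cmod (B n x) \<le> C * (h ^ n * fact n powr s)"
      using ex_gevrey_bump[OF assms(2)] by blast
    let ?\<chi> = "tensor (\<lambda>i n x. B n (x - x0 $ i))"
    define k where "k = 1 / (w x0 * ?\<chi> x0)"
    define \<phi> where "\<phi> = (\<lambda>y. cnj (k * (w y * ?\<chi> y)))"
    have \<phi>: "\<phi> \<in> Gevrey_c s"
      unfolding \<phi>_def by (rule Gevrey_c_cutoff[OF w ts(1,2) B(1,2,4)])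
    have "w x0 \<noteq> 0" using y0 by (simp add: w_def translate_def a_def)
    then have \<phi>1: "\<phi> x0 = 1" using B(3) by (simp add: \<phi>_def k_def tensor_def)
    obtain A where A: "\<And>\<xi> b1 b2 \<kappa>. \<kappa> > 0 \<Longrightarrow> b1 \<ge> 0 \<Longrightarrow> b2 \<ge> 0 \<Longrightarrow>
        (\<And>\<zeta>. cmod (u (modulate (\<xi> + \<zeta>) w)) \<le> b1 + b2 * exp (\<kappa> * wt s \<zeta>)) \<Longrightarrow>
      cmod (u (\<lambda>y. modulate \<xi> w y * ?\<chi> y)) \<le> b1 * A 1 + b2 * A \<kappa>"
      using GS_dual_cutoff_bound[OF assms(3) w ts(1) assms(2) B(1,2,4), of x0] by blast
    \<comment> \<open>Since \<open>cnj \<phi>\<close> is a multiple of \<open>w\<close> times the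
      bump, the exponential kernel merges with \<open>w\<close> into the time-frequency shift of
      \<open>\<psi>\<close> by \<open>(a, \<xi>)\<close>.\<close>
    have four: "cmod (udist_fourier (udist_mult u \<phi>) \<xi>) = K * (cmod k * cmod (u (\<lambda>y. modulate \<xi> w y * ?\<chi> y)))" for \<xi>
    proof -
      have gs: "(\<lambda>y. modulate \<xi> w y * ?\<chi> y) \<in> GS_space t s"
        by (intro GS_space_cutoff[OF _ ts(1,2) B(1,4)] modulate_in_GS_space[OF w ts(1,2)])
      have "udist_mult u \<phi> (\<lambda>x. exp (\<i> * complex_of_real (x \<bullet> \<xi>))) = u (\<lambda>y. k * (modulate \<xi> w y * ?\<chi> y))"
        by (simp add: udist_mult_def \<phi>_def modulate_def mult_ac)
      also have "\<dots> = cnj k * u (\<lambda>y. modulate \<xi> w y * ?\<chi> y)"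
        by (rule GS_dual_cmult[OF assms(3) gs])
      finally show ?thesis
        by (simp add: udist_fourier_def K_def norm_mult)
    qed
    \<comment> \<open>Directions are compared on the sphere of radius \<open>norm \<xi>0\<close>.
      The radius \<open>\<epsilon> / 2\<close> leaves the other half for the shift
      \<open>\<zeta>\<close>.\<close>
    define \<Gamma> where "\<Gamma> = {\<xi>. \<xi> \<noteq> 0 \<and> norm ((norm \<xi>0 / norm \<xi>) *\<^sub>R \<xi> - \<xi>0) < \<epsilon> / 2}"
    have "open_cone \<Gamma>"
      unfolding open_cone_def
    proof (intro conjI ballI allI impI)
      have "open (- {0} \<inter> (\<lambda>\<xi>. norm ((norm \<xi>0 / norm \<xi>) *\<^sub>R \<xi> - \<xi>0)) -` {..<\<epsilon> / 2})"
        by (intro continuous_open_preimage continuous_intros) auto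
      moreover have "- {0} \<inter> (\<lambda>\<xi>. norm ((norm \<xi>0 / norm \<xi>) *\<^sub>R \<xi> - \<xi>0)) -` {..<\<epsilon> / 2} = \<Gamma>"
        by (auto simp: \<Gamma>_def)
      ultimately show "open \<Gamma>" by (simp only:)
    qed (auto simp: \<Gamma>_def)
    moreover have "\<xi>0 \<in> \<Gamma>" using \<xi>0 \<epsilon> by (simp add: \<Gamma>_def)
    moreover have "bdd_above {exp (r * norm \<xi> powr (1 / s)) * cmod (udist_fourier (udist_mult u \<phi>) \<xi>) |\<xi>. \<xi> \<in> \<Gamma>}"
      if r: "r > 0" for r
    proof -
      define n where "n = norm \<xi>0 powr (1 / s)"
      \<comment> \<open>With the dilation \<open>l\<close> chosen below,
        \<open>norm \<xi> powr (1 / s) = n * l\<close>, so rate \<open>r\<close> in frequency is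
        rate \<open>\<rho>\<close> in \<open>l\<close>.\<close>
      define \<rho> where "\<rho> = r * n"
      have n: "n > 0" using \<xi>0 by (simp add: n_def)
      have \<rho>: "\<rho> > 0" using r n by (simp add: \<rho>_def)
      obtain C where C: "\<And>v. v \<in> {exp (\<rho> * l) * cmod (STFT \<psi> u ((l powr t) *\<^sub>R x) ((l powr s) *\<^sub>R \<xi>)) |l x \<xi>. l > 0 \<and> (x, \<xi>) \<in> U} \<Longrightarrow> v \<le> C"
        using Ub[OF \<rho>] unfolding bdd_above_def by blast
      define C1 where "C1 = max 0 C / K"
      have C1: "C1 \<ge> 0" using K by (simp add: C1_def)
      have near: "cmod (G ((l powr s) *\<^sub>R \<eta>)) \<le> C1 * exp (- \<rho> * l)"
        if l: "l > 0" and "norm a < \<epsilon> * l powr t" and "norm (\<eta> - \<xi>0) < \<epsilon>" for l \<eta>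
      proof -
        let ?x = "a /\<^sub>R (l powr t)"
        have L: "l powr t > 0" using l by simp
        have "norm ?x < \<epsilon>" using that L by (simp add: field_simps)
        moreover have "dist (0, \<xi>0) (?x, \<eta>) \<le> norm ?x + norm (\<eta> - \<xi>0)"
          using norm_Pair_le[of "- ?x" "\<xi>0 - \<eta>"] by (simp add: dist_norm norm_minus_commute)
        ultimately have "dist (0, \<xi>0) (?x, \<eta>) < \<epsilon>1" using that by (simp add: \<epsilon>_def)
        then have "(?x, \<eta>) \<in> U" using \<epsilon>1 by auto
        with C l have "exp (\<rho> * l) * cmod (STFT \<psi> u ((l powr t) *\<^sub>R ?x) ((l powr s) *\<^sub>R \<eta>)) \<le> C" by blast
        moreover have "STFT \<psi> u ((l powr t) *\<^sub>R ?x) ((l powr s) *\<^sub>R \<eta>) = of_real K * G ((l powr s) *\<^sub>R \<eta>)"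
          using L by (simp add: STFT_def K_def G_def w_def)
        ultimately have "exp (\<rho> * l) * (K * cmod (G ((l powr s) *\<^sub>R \<eta>))) \<le> max 0 C"
          using K by (simp add: norm_mult)
        then show ?thesis using K by (simp add: C1_def exp_minus field_simps)
      qed
      have m: "0 \<le> real CARD('n) * n" using n by simp
      from WF_bound_imp_shifted_bound[where G = G and a = a, OF ts(1,4) \<epsilon> \<rho> m near C1 far(3,1,2)]
      obtain b \<kappa> where b: "b \<ge> 0" "\<kappa> > 0" and shift: "\<forall>l \<xi> \<zeta>. l > 0 \<longrightarrow> wt s \<xi> \<le> (real CARD('n) * n) * l \<longrightarrow>
          norm (\<xi> /\<^sub>R (l powr s) - \<xi>0) < \<epsilon> / 2 \<longrightarrow>
          cmod (G (\<xi> + \<zeta>)) \<le> exp (- \<rho> * l) * (C1 + b * exp (\<kappa> * wt s \<zeta>))"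
        by blast
      show ?thesis
      proof (rule bdd_aboveI)
        fix v assume "v \<in> {exp (r * norm \<xi> powr (1 / s)) * cmod (udist_fourier (udist_mult u \<phi>) \<xi>) |\<xi>. \<xi> \<in> \<Gamma>}"
        then obtain \<xi> where \<xi>: "\<xi> \<noteq> 0" "norm ((norm \<xi>0 / norm \<xi>) *\<^sub>R \<xi> - \<xi>0) < \<epsilon> / 2"
          and v: "v = exp (r * norm \<xi> powr (1 / s)) * cmod (udist_fourier (udist_mult u \<phi>) \<xi>)"
          by (auto simp: \<Gamma>_def)
        \<comment> \<open>The dilation for which \<open>\<xi> /\<^sub>R (l powr s)\<close> has the
          norm of \<open>\<xi>0\<close>, matching the definition of \<open>\<Gamma>\<close>.\<close>
        define l where "l = (norm \<xi> / norm \<xi>0) powr (1 / s)"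
        have l: "l > 0" "l powr s = norm \<xi> / norm \<xi>0" using \<xi>(1) \<xi>0 ts by (auto simp: l_def powr_powr)
        have nl: "norm \<xi> powr (1 / s) = n * l" using \<xi>0 by (simp add: l_def n_def powr_divide)
        let ?e = "exp (- \<rho> * l)"
        have "wt s \<xi> \<le> (real CARD('n) * n) * l"
          using wt_le_norm_powr[OF ts(4), of \<xi>] by (simp add: nl mult.assoc)
        moreover have "norm (\<xi> /\<^sub>R (l powr s) - \<xi>0) < \<epsilon> / 2" using \<xi>(2) by (simp add: l(2))
        ultimately have "cmod (G (\<xi> + \<zeta>)) \<le> ?e * C1 + ?e * b * exp (\<kappa> * wt s \<zeta>)" for \<zeta>
          using shift[rule_format, OF l(1), of \<xi> \<zeta>] by (simp add: distrib_left mult.assoc)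
        then have "cmod (u (\<lambda>y. modulate \<xi> w y * ?\<chi> y)) \<le> ?e * C1 * A 1 + ?e * b * A \<kappa>"
          using b C1 unfolding G_def by (intro A) auto
        then have "cmod (udist_fourier (udist_mult u \<phi>) \<xi>) \<le> K * (cmod k * (?e * (C1 * A 1 + b * A \<kappa>)))"
          unfolding four using K by (intro mult_left_mono) (auto simp: distrib_left mult.assoc)
        from mult_left_mono[OF this, of "exp (\<rho> * l)"]
        have "v \<le> exp (\<rho> * l) * (K * (cmod k * (?e * (C1 * A 1 + b * A \<kappa>))))"
          unfolding v nl by (simp add: \<rho>_def mult_ac)
        also have "\<dots> = (exp (\<rho> * l) * ?e) * (K * (cmod k * (C1 * A 1 + b * A \<kappa>)))"
          by (simp only: mult_ac)
        also have "exp (\<rho> * l) * ?e = 1" by (simp flip: exp_add)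
        finally show "v \<le> 1 * (K * (cmod k * (C1 * A 1 + b * A \<kappa>)))" .
      qed
    qed
    ultimately have "(x0, \<xi>0) \<notin> Gevrey_WF s u"
      unfolding Gevrey_WF_def using \<phi> \<phi>1 by blast
    with WF show False by blast
  qed
qed

end
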